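(* Let $R=T(V)/\langle x_\alpha\otimes x_\beta-(-1)^{|x_\alpha||x_\beta|}x_\beta\otimes x_\alpha \mid \alpha,\beta\in\Lambda\rangle$ be equipped with a differential $d$ and a bracket $\{\cdot,\cdot\}$ making it a DG Poisson algebra, let $I$ be a DG Poisson ideal of $R$, and let $A=R/I$ with the induced DG Poisson structure. Let $\mathcal{A}=F(R)/J$, with differential $\partial$, and let $m,h:A\to\mathcal{A}$ be the $\Bbbk$-linear maps induced by $m(f)=f$ and $h(f)=\psi(f)$ (all as defined in the context). Then $(\mathcal{A},m,h)$ is the universal enveloping algebra of the DG Poisson algebra $A$.
   Context: $\Bbbk$ is a field; graded means $\mathbb{Z}$-graded; algebras are associative unital $\Bbbk$-algebras; $|a|$ is the degree of a homogeneous element $a$. A DG algebra is a graded algebra with a $\Bbbk$-linear map $d$ of degree $1$ with $d^2=0$ and $d(ab)=d(a)b+(-1)^{|a|}a\,d(b)$. DG algebra maps are degree $0$ algebra maps commuting with differentials. A DG Poisson algebra $(A,\cdot,\{\cdot,\cdot\},d)$ is a DG algebra $(A,d)$ which is graded commutative ($ab=(-1)^{|a||b|}ba$) with a $\Bbbk$-bilinear bracket of degree $0$ such that, for homogeneous $a,b,c$: $\{a,b\}=-(-1)^{|a||b|}\{b,a\}$; $\{a,\{b,c\}\}=\{\{a,b\},c\}+(-1)^{|a||b|}\{b,\{a,c\}\}$; $\{a,bc\}=\{a,b\}c+(-1)^{|a||b|}b\{a,c\}$; $d(\{a,b\})=\{d(a),b\}+(-1)^{|a|}\{a,d(b)\}$.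 A DG Poisson ideal is a homogeneous ideal $I$ with $d(I)\subseteq I$ and $\{I,A\}\subseteq I$. For a DG algebra $D$, $D_P$ denotes $D$ with the bracket $[a,b]=ab-(-1)^{|a||b|}ba$. A DG Lie algebra map is a degree $0$ linear map preserving brackets and commuting with differentials. A universal enveloping algebra of $A$ is a triple $(A^{ue},\alpha,\beta)$ with $(A^{ue},\partial)$ a DG algebra, $\alpha:A\to A^{ue}$ a DG algebra map and $\beta:A\to A^{ue}_P$ a DG Lie algebra map such that for all homogeneous $a,b\in A$: $\alpha(\{a,b\})=\beta(a)\alpha(b)-(-1)^{|a||b|}\alpha(b)\beta(a)$ and $\beta(ab)=\alpha(a)\beta(b)+(-1)^{|a||b|}\alpha(b)\beta(a)$; and universal: for every DG algebra $D$ with a DG algebra map $f:A\to D$ and a DG Lie algebra map $g:A\to D_P$ satisfying the same two identities (with $f,g$ in place of $\alpha,\beta$), there is a unique DG algebra map $\phi:A^{ue}\to D$ with $\phi\alpha=f$ and $\phi\beta=g$. Setting: $V$ is a graded vector space with homogeneous basis $\{x_\alpha:\alpha\in\Lambda\}$ and $T(V)$ is its tensor algebra. For $\alpha\in\Lambda$, $\psi_\alpha:R\to R$ is the $\Bbbk$-linear map with $\psi_\alpha(x_\beta)=\delta_{\alpha\beta}$ and $\psi_\alpha(ab)=a\psi_\alpha(b)+(-1)^{|a||b|}b\psi_\alpha(a)$ for homogeneous $a,b\in R$. $F(R)=R\langle y_\alpha\mid\alpha\in\Lambda\rangle$ is the graded algebra freely generated over $R$ by noncommuting indeterminates $y_\alpha$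 with $|y_\alpha|=|x_\alpha|$ (the free product of $R$ with the free algebra on the $y_\alpha$). $\psi:R\to F(R)$ is $\psi(f)=\sum_\alpha\psi_\alpha(f)y_\alpha$ (a finite sum). $J$ is the graded two-sided ideal of $F(R)$ generated by $I$, $\psi(I)$, and, for all $\alpha,\beta\in\Lambda$, $y_\alpha y_\beta-(-1)^{|x_\alpha||x_\beta|}y_\beta y_\alpha-\psi(\{x_\alpha,x_\beta\})$ and $y_\alpha x_\beta-(-1)^{|x_\alpha||x_\beta|}x_\beta y_\alpha-\{x_\alpha,x_\beta\}$. The differential $\partial$ on $\mathcal{A}=F(R)/J$ is given by $\partial x_\alpha=d(x_\alpha)$, $\partial y_\alpha=\psi(d(x_\alpha))$ and the graded Leibniz rule; $(\mathcal A,\partial)$ is a DG algebra. *)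

theory Defs
  imports "HOL-Algebra.QuotRing" "HOL-Algebra.Module"
begin

section \<open>DG Poisson algebras and universal enveloping algebras\<close>

text \<open>The ground field is a ring record \<open>K\<close> on the type \<open>'k\<close>, passed separately. The set
  \<open>homog A n\<close> is the degree \<open>n\<close> part of \<open>A\<close>; it contains \<open>0\<close> for every \<open>n\<close>.\<close>

record ('k, 'a) galg = "('k, 'a) module" +
  homog :: "int \<Rightarrow> 'a set"

record ('k, 'a) dgalg = "('k, 'a) galg" +
  dif :: "'a \<Rightarrow> 'a"

record ('k, 'a) dgbalg = "('k, 'a) dgalg" +
  bracket :: "'a \<Rightarrow> 'a \<Rightarrow> 'a"

definition add_dif :: "('k, 'a) galg \<Rightarrow> ('a \<Rightarrow> 'a) \<Rightarrow> ('k, 'a) dgalg" where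
  "add_dif A d = galg.extend A (dgalg.fields d)"

definition add_bracket :: "('k, 'a) dgalg \<Rightarrow> ('a \<Rightarrow> 'a \<Rightarrow> 'a) \<Rightarrow> ('k, 'a) dgbalg" where
  "add_bracket A br = dgalg.extend A (dgbalg.fields br)"

text \<open>\<open>koszul A n a\<close> is \<open>(-1)\<^sup>n a\<close>.\<close>

definition koszul :: "('a, 'n) ring_scheme \<Rightarrow> int \<Rightarrow> 'a \<Rightarrow> 'a" where
  "koszul A n a = (if even n then a else \<ominus>\<^bsub>A\<^esub> a)"

definition linear_map ::
  "('k, 'm) ring_scheme \<Rightarrow> ('k, 'a, 'n) module_scheme \<Rightarrow> ('k, 'b, 'p) module_scheme
    \<Rightarrow> ('a \<Rightarrow> 'b) \<Rightarrow> bool" where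
  "linear_map K M N f \<longleftrightarrow>
     f \<in> carrier M \<rightarrow> carrier N \<and>
     (\<forall>a\<in>carrier M. \<forall>b\<in>carrier M. f (a \<oplus>\<^bsub>M\<^esub> b) = f a \<oplus>\<^bsub>N\<^esub> f b) \<and>
     (\<forall>c\<in>carrier K. \<forall>a\<in>carrier M. f (c \<odot>\<^bsub>M\<^esub> a) = c \<odot>\<^bsub>N\<^esub> f a)"

locale k_algebra = V?: module K A + A?: ring A
  for K :: "('k, 'm) ring_scheme" and A :: "('k, 'a, 'n) module_scheme" (structure) +
  assumes smult_mult_left:
    "\<lbrakk>c \<in> carrier K; a \<in> carrier A; b \<in> carrier A\<rbrakk> \<Longrightarrow> (c \<odot> a) \<otimes> b = c \<odot> (a \<otimes> b)"
    and smult_mult_right: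
    "\<lbrakk>c \<in> carrier K; a \<in> carrier A; b \<in> carrier A\<rbrakk> \<Longrightarrow> a \<otimes> (c \<odot> b) = c \<odot> (a \<otimes> b)"

definition homog_decomp :: "('k, 'a, 'n) galg_scheme \<Rightarrow> 'a \<Rightarrow> (int \<Rightarrow> 'a) \<Rightarrow> bool" where
  "homog_decomp A a f \<longleftrightarrow>
     (\<forall>n. f n \<in> homog A n) \<and> finite {n. f n \<noteq> \<zero>\<^bsub>A\<^esub>} \<and>
     a = (\<Oplus>\<^bsub>A\<^esub>n\<in>{n. f n \<noteq> \<zero>\<^bsub>A\<^esub>}. f n)"

text \<open>\<open>hcomp A a n\<close> is the homogeneous component of \<open>a\<close> in degree \<open>n\<close>.\<close>

definition hcomp :: "('k, 'a, 'n) galg_scheme \<Rightarrow> 'a \<Rightarrow> int \<Rightarrow> 'a" where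
  "hcomp A a = (THE f. homog_decomp A a f)"

locale graded_algebra = k_algebra K A
  for K :: "('k, 'm) ring_scheme" and A :: "('k, 'a, 'n) galg_scheme" (structure) +
  assumes homog_submodule: "submodule (homog A n) K A"
    and direct_sum: "a \<in> carrier A \<Longrightarrow> \<exists>!f. homog_decomp A a f"
    and one_homog: "\<one> \<in> homog A 0"
    and mult_homog: "\<lbrakk>a \<in> homog A p; b \<in> homog A q\<rbrakk> \<Longrightarrow> a \<otimes> b \<in> homog A (p + q)"

locale dg_algebra = graded_algebra K A
  for K :: "('k, 'm) ring_scheme" and A :: "('k, 'a, 'n) dgalg_scheme" (structure) +
  assumes dif_linear: "linear_map K A A (dif A)"
    and dif_degree: "a \<in> homog A n \<Longrightarrow> dif A a \<in> homog A (n + 1)"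
    and dif_dif: "a \<in> carrier A \<Longrightarrow> dif A (dif A a) = \<zero>"
    and leibniz: "\<lbrakk>a \<in> homog A n; b \<in> carrier A\<rbrakk> \<Longrightarrow>
      dif A (a \<otimes> b) = dif A a \<otimes> b \<oplus> koszul A n (a \<otimes> dif A b)"

locale dg_poisson_algebra = dg_algebra K A
  for K :: "('k, 'm) ring_scheme" and A :: "('k, 'a, 'n) dgbalg_scheme" (structure) +
  assumes graded_commutative: "\<lbrakk>a \<in> homog A p; b \<in> homog A q\<rbrakk> \<Longrightarrow>
      a \<otimes> b = koszul A (p * q) (b \<otimes> a)"
    and bracket_linear_left: "b \<in> carrier A \<Longrightarrow> linear_map K A A (\<lambda>a. bracket A a b)"
    and bracket_linear_right: "a \<in> carrier A \<Longrightarrow> linear_map K A A (bracket A a)"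
    and bracket_degree: "\<lbrakk>a \<in> homog A p; b \<in> homog A q\<rbrakk> \<Longrightarrow> bracket A a b \<in> homog A (p + q)"
    and antisymmetry: "\<lbrakk>a \<in> homog A p; b \<in> homog A q\<rbrakk> \<Longrightarrow>
      bracket A a b = \<ominus> (koszul A (p * q) (bracket A b a))"
    and jacobi: "\<lbrakk>a \<in> homog A p; b \<in> homog A q; c \<in> homog A r\<rbrakk> \<Longrightarrow>
      bracket A a (bracket A b c) =
        bracket A (bracket A a b) c \<oplus> koszul A (p * q) (bracket A b (bracket A a c))"
    and bracket_mult: "\<lbrakk>a \<in> homog A p; b \<in> homog A q; c \<in> homog A r\<rbrakk> \<Longrightarrow>
      bracket A a (b \<otimes> c) = bracket A a b \<otimes> c \<oplus> koszul A (p * q) (b \<otimes> bracket A a c)"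
    and dif_bracket: "\<lbrakk>a \<in> homog A p; b \<in> homog A q\<rbrakk> \<Longrightarrow>
      dif A (bracket A a b) = bracket A (dif A a) b \<oplus> koszul A p (bracket A a (dif A b))"

definition dg_poisson_ideal :: "('k, 'a, 'n) dgbalg_scheme \<Rightarrow> 'a set \<Rightarrow> bool" where
  "dg_poisson_ideal A I \<longleftrightarrow>
     ideal I A \<and>
     (\<forall>a\<in>I. \<forall>n. hcomp A a n \<in> I) \<and>
     (\<forall>a\<in>I. dif A a \<in> I) \<and>
     (\<forall>a\<in>I. \<forall>b\<in>carrier A. bracket A a b \<in> I)"

definition dg_algebra_map ::
  "('k, 'm) ring_scheme \<Rightarrow> ('k, 'a, 'n) dgalg_scheme \<Rightarrow> ('k, 'b, 'p) dgalg_scheme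
    \<Rightarrow> ('a \<Rightarrow> 'b) \<Rightarrow> bool" where
  "dg_algebra_map K A B f \<longleftrightarrow>
     f \<in> ring_hom A B \<and> linear_map K A B f \<and>
     (\<forall>n. f ` homog A n \<subseteq> homog B n) \<and>
     (\<forall>a\<in>carrier A. f (dif A a) = dif B (f a))"

definition dg_lie_map ::
  "('k, 'm) ring_scheme \<Rightarrow> ('k, 'a, 'n) dgbalg_scheme \<Rightarrow> ('k, 'b, 'p) dgbalg_scheme
    \<Rightarrow> ('a \<Rightarrow> 'b) \<Rightarrow> bool" where
  "dg_lie_map K L M g \<longleftrightarrow>
     linear_map K L M g \<and>
     (\<forall>n. g ` homog L n \<subseteq> homog M n) \<and>
     (\<forall>a\<in>carrier L. \<forall>b\<in>carrier L. g (bracket L a b) = bracket M (g a) (g b)) \<and>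
     (\<forall>a\<in>carrier L. g (dif L a) = dif M (g a))"

text \<open>The graded commutator \<open>ab - (-1)\<^bsup>pq\<^esup> ba\<close> of homogeneous elements of degrees
  \<open>p\<close> and \<open>q\<close>, extended bilinearly to all elements, and the algebra \<open>D\<^sub>P\<close>.\<close>

definition graded_commutator :: "('k, 'a, 'n) galg_scheme \<Rightarrow> 'a \<Rightarrow> 'a \<Rightarrow> 'a" where
  "graded_commutator D a b =
     (\<Oplus>\<^bsub>D\<^esub>p\<in>{p. hcomp D a p \<noteq> \<zero>\<^bsub>D\<^esub>}. \<Oplus>\<^bsub>D\<^esub>q\<in>{q. hcomp D b q \<noteq> \<zero>\<^bsub>D\<^esub>}.
        hcomp D a p \<otimes>\<^bsub>D\<^esub> hcomp D b q \<ominus>\<^bsub>D\<^esub> koszul D (p * q) (hcomp D b q \<otimes>\<^bsub>D\<^esub> hcomp D a p))"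

definition commutator_lie :: "('k, 'a) dgalg \<Rightarrow> ('k, 'a) dgbalg" where
  "commutator_lie D = add_bracket D (graded_commutator D)"

definition enveloping_pair ::
  "('k, 'm) ring_scheme \<Rightarrow> ('k, 'a, 'n) dgbalg_scheme \<Rightarrow> ('k, 'b) dgalg
    \<Rightarrow> ('a \<Rightarrow> 'b) \<Rightarrow> ('a \<Rightarrow> 'b) \<Rightarrow> bool" where
  "enveloping_pair K A D f g \<longleftrightarrow>
     dg_algebra_map K A D f \<and>
     dg_lie_map K A (commutator_lie D) g \<and>
     (\<forall>p q. \<forall>a\<in>homog A p. \<forall>b\<in>homog A q.
        f (bracket A a b) = g a \<otimes>\<^bsub>D\<^esub> f b \<ominus>\<^bsub>D\<^esub> koszul D (p * q) (f b \<otimes>\<^bsub>D\<^esub> g a) \<and>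
        g (a \<otimes>\<^bsub>A\<^esub> b) = f a \<otimes>\<^bsub>D\<^esub> g b \<oplus>\<^bsub>D\<^esub> koszul D (p * q) (f b \<otimes>\<^bsub>D\<^esub> g a))"

text \<open>The DG algebras \<open>D\<close> of the universal property live on an arbitrary type \<open>'d\<close>, which a
  theorem with this conclusion leaves free. Maps are unique as functions on the carrier, hence
  \<open>extensional\<close>.\<close>

definition universal_enveloping_algebra ::
  "'d itself \<Rightarrow> ('k, 'm) ring_scheme \<Rightarrow> ('k, 'a, 'n) dgbalg_scheme \<Rightarrow> ('k, 'u) dgalg
    \<Rightarrow> ('a \<Rightarrow> 'u) \<Rightarrow> ('a \<Rightarrow> 'u) \<Rightarrow> bool" where
  "universal_enveloping_algebra TYPE('d) K A U \<alpha> \<beta> \<longleftrightarrow>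
     dg_algebra K U \<and>
     enveloping_pair K A U \<alpha> \<beta> \<and>
     (\<forall>(D :: ('k, 'd) dgalg) f g. dg_algebra K D \<and> enveloping_pair K A D f g \<longrightarrow>
        (\<exists>!\<phi>. \<phi> \<in> extensional (carrier U) \<and> dg_algebra_map K U D \<phi> \<and>
           (\<forall>a\<in>carrier A. \<phi> (\<alpha> a) = f a) \<and> (\<forall>a\<in>carrier A. \<phi> (\<beta> a) = g a)))"


section \<open>Quotients\<close>

text \<open>The map sending the class of \<open>a\<close> to the class \<open>J + g a\<close>, in the union style of
  \<^const>\<open>rcoset_mult\<close>; the union is a single coset whenever the map is well defined.\<close>

definition induced_map :: "('b, 'n) ring_scheme \<Rightarrow> 'b set \<Rightarrow> ('a \<Rightarrow> 'b) \<Rightarrow> 'a set \<Rightarrow> 'b set" where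
  "induced_map B J g X = (\<Union>a\<in>X. J +>\<^bsub>B\<^esub> g a)"

definition quot_galg :: "('k, 'a, 'n) galg_scheme \<Rightarrow> 'a set \<Rightarrow> ('k, 'a set) galg" where
  "quot_galg A I =
     \<lparr>carrier = carrier (A Quot I), monoid.mult = monoid.mult (A Quot I),
      one = \<one>\<^bsub>A Quot I\<^esub>, zero = \<zero>\<^bsub>A Quot I\<^esub>, add = add (A Quot I),
      smult = \<lambda>c. induced_map A I (\<lambda>a. c \<odot>\<^bsub>A\<^esub> a),
      homog = \<lambda>n. (\<lambda>a. I +>\<^bsub>A\<^esub> a) ` homog A n\<rparr>"

definition quot_dgbalg :: "('k, 'a, 'n) dgbalg_scheme \<Rightarrow> 'a set \<Rightarrow> ('k, 'a set) dgbalg" where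
  "quot_dgbalg A I =
     add_bracket (add_dif (quot_galg A I) (induced_map A I (dif A)))
       (\<lambda>X Y. \<Union>a\<in>X. \<Union>b\<in>Y. I +>\<^bsub>A\<^esub> bracket A a b)"


section \<open>Tensor algebra and free graded commutative algebra\<close>

text \<open>The free associative algebra on the set \<open>X\<close>: finitely supported functions on words over
  \<open>X\<close> with concatenation product. If \<open>V\<close> is the graded vector space with homogeneous basis
  \<open>(x\<^sub>\<alpha>)\<close> indexed by \<open>X\<close>, the words of length \<open>n\<close> are the basis
  \<open>x\<^bsub>\<alpha>1\<^esub> \<otimes> \<dots> \<otimes> x\<^bsub>\<alpha>n\<^esub>\<close> of the \<open>n\<close>-th tensor power of \<open>V\<close>, so this is \<open>T(V)\<close>.\<close>

definition free_galg ::
  "('k, 'm) ring_scheme \<Rightarrow> 'x set \<Rightarrow> ('x \<Rightarrow> int) \<Rightarrow> ('k, 'x list \<Rightarrow> 'k) galg" where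
  "free_galg K X deg =
    (let S = {f. (\<forall>w. f w \<in> carrier K) \<and> finite {w. f w \<noteq> \<zero>\<^bsub>K\<^esub>} \<and>
                 (\<forall>w. f w \<noteq> \<zero>\<^bsub>K\<^esub> \<longrightarrow> w \<in> lists X)}
     in
     \<lparr>carrier = S,
      monoid.mult = \<lambda>f g w. \<Oplus>\<^bsub>K\<^esub>i\<in>{..length w}. f (take i w) \<otimes>\<^bsub>K\<^esub> g (drop i w),
      one = \<lambda>w. if w = [] then \<one>\<^bsub>K\<^esub> else \<zero>\<^bsub>K\<^esub>,
      zero = \<lambda>w. \<zero>\<^bsub>K\<^esub>,
      add = \<lambda>f g w. f w \<oplus>\<^bsub>K\<^esub> g w,
      smult = \<lambda>c f w. c \<otimes>\<^bsub>K\<^esub> f w,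
      homog = \<lambda>n. {f \<in> S. \<forall>w. f w \<noteq> \<zero>\<^bsub>K\<^esub> \<longrightarrow> sum_list (map deg w) = n}\<rparr>)"

definition free_gen :: "('k, 'm) ring_scheme \<Rightarrow> 'x \<Rightarrow> 'x list \<Rightarrow> 'k" where
  "free_gen K x = (\<lambda>w. if w = [x] then \<one>\<^bsub>K\<^esub> else \<zero>\<^bsub>K\<^esub>)"

definition sym_ideal ::
  "('k, 'm) ring_scheme \<Rightarrow> 'i set \<Rightarrow> ('i \<Rightarrow> int) \<Rightarrow> ('i list \<Rightarrow> 'k) set" where
  "sym_ideal K \<Lambda> deg =
    (let T = free_galg K \<Lambda> deg; x = free_gen K in
     Idl\<^bsub>T\<^esub> {x \<alpha> \<otimes>\<^bsub>T\<^esub> x \<beta> \<ominus>\<^bsub>T\<^esub> koszul T (deg \<alpha> * deg \<beta>) (x \<beta> \<otimes>\<^bsub>T\<^esub> x \<alpha>) | \<alpha> \<beta>.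
              \<alpha> \<in> \<Lambda> \<and> \<beta> \<in> \<Lambda>})"

definition sym_galg ::
  "('k, 'm) ring_scheme \<Rightarrow> 'i set \<Rightarrow> ('i \<Rightarrow> int) \<Rightarrow> ('k, ('i list \<Rightarrow> 'k) set) galg" where
  "sym_galg K \<Lambda> deg = quot_galg (free_galg K \<Lambda> deg) (sym_ideal K \<Lambda> deg)"

definition sym_var ::
  "('k, 'm) ring_scheme \<Rightarrow> 'i set \<Rightarrow> ('i \<Rightarrow> int) \<Rightarrow> 'i \<Rightarrow> ('i list \<Rightarrow> 'k) set" where
  "sym_var K \<Lambda> deg \<alpha> = sym_ideal K \<Lambda> deg +>\<^bsub>free_galg K \<Lambda> deg\<^esub> free_gen K \<alpha>"


section \<open>The graded algebra freely generated over a graded algebra\<close>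

text \<open>\<open>F(R)\<close>, the free product of \<open>R\<close> with the free algebra on the \<open>y\<^sub>\<alpha>\<close>, is presented by a
  generator \<open>Inl (n, r)\<close> of degree \<open>n\<close> for each \<open>r\<close> in the degree \<open>n\<close> part of \<open>R\<close> and a generator
  \<open>Inr \<alpha>\<close> for each \<open>\<alpha>\<close>, subject to the relations saying that \<open>r \<mapsto> Inl (n, r)\<close> is, over all
  \<open>n\<close>, a map of graded unital algebras. Tagging by degree makes the relations homogeneous;
  \<open>ext_incl\<close> below is the resulting map \<open>R \<rightarrow> F(R)\<close> on arbitrary elements.\<close>

type_synonym ('i, 'r) ext_gen = "(int \<times> 'r) + 'i"

definition ext_free ::
  "('k, 'm) ring_scheme \<Rightarrow> ('k, 'r, 'n) galg_scheme \<Rightarrow> 'i set \<Rightarrow> ('i \<Rightarrow> int)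
    \<Rightarrow> ('k, ('i, 'r) ext_gen list \<Rightarrow> 'k) galg" where
  "ext_free K R \<Lambda> deg =
     free_galg K ({Inl (n, r) | n r. r \<in> homog R n} \<union> Inr ` \<Lambda>) (case_sum fst deg)"

definition ext_ideal ::
  "('k, 'm) ring_scheme \<Rightarrow> ('k, 'r, 'n) galg_scheme \<Rightarrow> 'i set \<Rightarrow> ('i \<Rightarrow> int)
    \<Rightarrow> (('i, 'r) ext_gen list \<Rightarrow> 'k) set" where
  "ext_ideal K R \<Lambda> deg =
    (let T = ext_free K R \<Lambda> deg; e = (\<lambda>n r. free_gen K (Inl (n, r))) in
     Idl\<^bsub>T\<^esub>
      ({e n (r \<oplus>\<^bsub>R\<^esub> s) \<ominus>\<^bsub>T\<^esub> (e n r \<oplus>\<^bsub>T\<^esub> e n s) | n r s. r \<in> homog R n \<and> s \<in> homog R n} \<union>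
       {e n (c \<odot>\<^bsub>R\<^esub> r) \<ominus>\<^bsub>T\<^esub> c \<odot>\<^bsub>T\<^esub> e n r | n c r. c \<in> carrier K \<and> r \<in> homog R n} \<union>
       {e (p + q) (r \<otimes>\<^bsub>R\<^esub> s) \<ominus>\<^bsub>T\<^esub> e p r \<otimes>\<^bsub>T\<^esub> e q s | p q r s. r \<in> homog R p \<and> s \<in> homog R q} \<union>
       {e 0 \<one>\<^bsub>R\<^esub> \<ominus>\<^bsub>T\<^esub> \<one>\<^bsub>T\<^esub>}))"

definition free_ext ::
  "('k, 'm) ring_scheme \<Rightarrow> ('k, 'r, 'n) galg_scheme \<Rightarrow> 'i set \<Rightarrow> ('i \<Rightarrow> int)
    \<Rightarrow> ('k, (('i, 'r) ext_gen list \<Rightarrow> 'k) set) galg" where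
  "free_ext K R \<Lambda> deg = quot_galg (ext_free K R \<Lambda> deg) (ext_ideal K R \<Lambda> deg)"

definition ext_incl ::
  "('k, 'm) ring_scheme \<Rightarrow> ('k, 'r, 'n) galg_scheme \<Rightarrow> 'i set \<Rightarrow> ('i \<Rightarrow> int)
    \<Rightarrow> 'r \<Rightarrow> (('i, 'r) ext_gen list \<Rightarrow> 'k) set" where
  "ext_incl K R \<Lambda> deg r =
     (\<Oplus>\<^bsub>free_ext K R \<Lambda> deg\<^esub>n\<in>{n. hcomp R r n \<noteq> \<zero>\<^bsub>R\<^esub>}.
        ext_ideal K R \<Lambda> deg +>\<^bsub>ext_free K R \<Lambda> deg\<^esub> free_gen K (Inl (n, hcomp R r n)))"

definition ext_var ::
  "('k, 'm) ring_scheme \<Rightarrow> ('k, 'r, 'n) galg_scheme \<Rightarrow> 'i set \<Rightarrow> ('i \<Rightarrow> int)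
    \<Rightarrow> 'i \<Rightarrow> (('i, 'r) ext_gen list \<Rightarrow> 'k) set" where
  "ext_var K R \<Lambda> deg \<alpha> =
     ext_ideal K R \<Lambda> deg +>\<^bsub>ext_free K R \<Lambda> deg\<^esub> free_gen K (Inr \<alpha>)"


section \<open>The algebra \<open>\<A>\<close>\<close>

text \<open>Below, \<open>x \<alpha>\<close> are the generators of \<open>R\<close>. On \<open>carrier R\<close> the conditions defining
  \<open>psi_comp\<close> determine a single map, so the choice operator only affects values off the carrier.\<close>

definition psi_comp ::
  "('k, 'm) ring_scheme \<Rightarrow> ('k, 'r, 'n) galg_scheme \<Rightarrow> 'i set \<Rightarrow> ('i \<Rightarrow> 'r) \<Rightarrow> 'i \<Rightarrow> 'r \<Rightarrow> 'r" where
  "psi_comp K R \<Lambda> x \<alpha> =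
    (SOME D. linear_map K R R D \<and>
       (\<forall>\<beta>\<in>\<Lambda>. D (x \<beta>) = (if \<alpha> = \<beta> then \<one>\<^bsub>R\<^esub> else \<zero>\<^bsub>R\<^esub>)) \<and>
       (\<forall>p q. \<forall>a\<in>homog R p. \<forall>b\<in>homog R q.
          D (a \<otimes>\<^bsub>R\<^esub> b) = a \<otimes>\<^bsub>R\<^esub> D b \<oplus>\<^bsub>R\<^esub> koszul R (p * q) (b \<otimes>\<^bsub>R\<^esub> D a)))"

definition psi ::
  "('k, 'm) ring_scheme \<Rightarrow> ('k, 'r, 'n) galg_scheme \<Rightarrow> 'i set \<Rightarrow> ('i \<Rightarrow> int) \<Rightarrow> ('i \<Rightarrow> 'r)
    \<Rightarrow> 'r \<Rightarrow> (('i, 'r) ext_gen list \<Rightarrow> 'k) set" where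
  "psi K R \<Lambda> deg x f =
     (\<Oplus>\<^bsub>free_ext K R \<Lambda> deg\<^esub>\<alpha>\<in>{\<alpha>\<in>\<Lambda>. psi_comp K R \<Lambda> x \<alpha> f \<noteq> \<zero>\<^bsub>R\<^esub>}.
        ext_incl K R \<Lambda> deg (psi_comp K R \<Lambda> x \<alpha> f) \<otimes>\<^bsub>free_ext K R \<Lambda> deg\<^esub> ext_var K R \<Lambda> deg \<alpha>)"

definition env_ideal ::
  "('k, 'm) ring_scheme \<Rightarrow> ('k, 'r, 'n) dgbalg_scheme \<Rightarrow> 'i set \<Rightarrow> ('i \<Rightarrow> int) \<Rightarrow> ('i \<Rightarrow> 'r)
    \<Rightarrow> 'r set \<Rightarrow> (('i, 'r) ext_gen list \<Rightarrow> 'k) set set" where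
  "env_ideal K R \<Lambda> deg x I =
    (let F = free_ext K R \<Lambda> deg; i = ext_incl K R \<Lambda> deg; y = ext_var K R \<Lambda> deg;
         \<psi> = psi K R \<Lambda> deg x in
     Idl\<^bsub>F\<^esub>
      (i ` I \<union> \<psi> ` I \<union>
       {y \<alpha> \<otimes>\<^bsub>F\<^esub> y \<beta> \<ominus>\<^bsub>F\<^esub> koszul F (deg \<alpha> * deg \<beta>) (y \<beta> \<otimes>\<^bsub>F\<^esub> y \<alpha>) \<ominus>\<^bsub>F\<^esub> \<psi> (bracket R (x \<alpha>) (x \<beta>))
          | \<alpha> \<beta>. \<alpha> \<in> \<Lambda> \<and> \<beta> \<in> \<Lambda>} \<union>
       {y \<alpha> \<otimes>\<^bsub>F\<^esub> i (x \<beta>) \<ominus>\<^bsub>F\<^esub> koszul F (deg \<alpha> * deg \<beta>) (i (x \<beta>) \<otimes>\<^bsub>F\<^esub> y \<alpha>)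
            \<ominus>\<^bsub>F\<^esub> i (bracket R (x \<alpha>) (x \<beta>))
          | \<alpha> \<beta>. \<alpha> \<in> \<Lambda> \<and> \<beta> \<in> \<Lambda>}))"

definition env_galg ::
  "('k, 'm) ring_scheme \<Rightarrow> ('k, 'r, 'n) dgbalg_scheme \<Rightarrow> 'i set \<Rightarrow> ('i \<Rightarrow> int) \<Rightarrow> ('i \<Rightarrow> 'r)
    \<Rightarrow> 'r set \<Rightarrow> ('k, (('i, 'r) ext_gen list \<Rightarrow> 'k) set set) galg" where
  "env_galg K R \<Lambda> deg x I = quot_galg (free_ext K R \<Lambda> deg) (env_ideal K R \<Lambda> deg x I)"

text \<open>As with \<open>psi_comp\<close>, the differential is determined on the carrier, since the classes of
  the \<open>x \<alpha>\<close> and \<open>y\<^sub>\<alpha>\<close> generate the algebra.\<close>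

definition env_dif ::
  "('k, 'm) ring_scheme \<Rightarrow> ('k, 'r, 'n) dgbalg_scheme \<Rightarrow> 'i set \<Rightarrow> ('i \<Rightarrow> int) \<Rightarrow> ('i \<Rightarrow> 'r)
    \<Rightarrow> 'r set \<Rightarrow> (('i, 'r) ext_gen list \<Rightarrow> 'k) set set \<Rightarrow> (('i, 'r) ext_gen list \<Rightarrow> 'k) set set" where
  "env_dif K R \<Lambda> deg x I =
    (let F = free_ext K R \<Lambda> deg; J = env_ideal K R \<Lambda> deg x I; U = env_galg K R \<Lambda> deg x I;
         i = ext_incl K R \<Lambda> deg; y = ext_var K R \<Lambda> deg; \<psi> = psi K R \<Lambda> deg x in
     SOME D. linear_map K U U D \<and>
       (\<forall>n. \<forall>a\<in>homog U n. \<forall>b\<in>carrier U.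
          D (a \<otimes>\<^bsub>U\<^esub> b) = D a \<otimes>\<^bsub>U\<^esub> b \<oplus>\<^bsub>U\<^esub> koszul U n (a \<otimes>\<^bsub>U\<^esub> D b)) \<and>
       (\<forall>\<alpha>\<in>\<Lambda>. D (J +>\<^bsub>F\<^esub> i (x \<alpha>)) = J +>\<^bsub>F\<^esub> i (dif R (x \<alpha>))) \<and>
       (\<forall>\<alpha>\<in>\<Lambda>. D (J +>\<^bsub>F\<^esub> y \<alpha>) = J +>\<^bsub>F\<^esub> \<psi> (dif R (x \<alpha>))))"

definition env_dgalg ::
  "('k, 'm) ring_scheme \<Rightarrow> ('k, 'r, 'n) dgbalg_scheme \<Rightarrow> 'i set \<Rightarrow> ('i \<Rightarrow> int) \<Rightarrow> ('i \<Rightarrow> 'r)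
    \<Rightarrow> 'r set \<Rightarrow> ('k, (('i, 'r) ext_gen list \<Rightarrow> 'k) set set) dgalg" where
  "env_dgalg K R \<Lambda> deg x I = add_dif (env_galg K R \<Lambda> deg x I) (env_dif K R \<Lambda> deg x I)"

definition env_m ::
  "('k, 'm) ring_scheme \<Rightarrow> ('k, 'r, 'n) dgbalg_scheme \<Rightarrow> 'i set \<Rightarrow> ('i \<Rightarrow> int) \<Rightarrow> ('i \<Rightarrow> 'r)
    \<Rightarrow> 'r set \<Rightarrow> 'r set \<Rightarrow> (('i, 'r) ext_gen list \<Rightarrow> 'k) set set" where
  "env_m K R \<Lambda> deg x I =
     induced_map (free_ext K R \<Lambda> deg) (env_ideal K R \<Lambda> deg x I) (ext_incl K R \<Lambda> deg)"

definition env_h ::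
  "('k, 'm) ring_scheme \<Rightarrow> ('k, 'r, 'n) dgbalg_scheme \<Rightarrow> 'i set \<Rightarrow> ('i \<Rightarrow> int) \<Rightarrow> ('i \<Rightarrow> 'r)
    \<Rightarrow> 'r set \<Rightarrow> 'r set \<Rightarrow> (('i, 'r) ext_gen list \<Rightarrow> 'k) set set" where
  "env_h K R \<Lambda> deg x I =
     induced_map (free_ext K R \<Lambda> deg) (env_ideal K R \<Lambda> deg x I) (psi K R \<Lambda> deg x)"

end

theory Submission
  imports Defs
begin

text \<open>A homomorphism out of \<open>\<A>\<close> is the same as an algebra map \<open>f\<close> on \<open>R\<close> together with a linear map
  \<open>g\<close> on \<open>R\<close> that both vanish on \<open>I\<close>, satisfy \<open>g(ab) = f(a)g(b) \<plusminus> f(b)g(a)\<close>, and satisfy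
  \<open>f{a,b} = [g(a),f(b)]\<close> and \<open>g{a,b} = [g(a),g(b)]\<close> for generators \<open>a\<close>, \<open>b\<close> of \<open>R\<close>; by biderivation
  arguments the last two identities then hold for all \<open>a\<close>, \<open>b\<close>. Applied to \<open>\<A>\<close> itself this shows that
  \<open>(m, h)\<close> is an enveloping pair, and applied to another enveloping pair it gives the universal map.
  The derivations \<open>\<psi>\<^sub>\<alpha>\<close> of \<open>R\<close> and \<open>\<partial>\<close> of \<open>\<A>\<close> are not constructed by hand: a skew derivation is a
  homomorphism into an algebra of twisted dual numbers, so both come from universal properties.\<close>

text \<open>\<open>psi_comp\<close> and \<open>env_dif\<close> are choices, so nothing is known
  about them until some map with the prescribed properties exists; defining one directly on a
  quotient would mean checking it on a whole ideal. In the dual numbers this check shrinks to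
  finitely described relations between generators. For the partial derivative along \<alpha> the
  twist multiplies a right factor b by (-1)^(deg \<alpha> * |b|), and graded commutativity turns
  that into the sign demanded of \<open>psi_comp\<close>. For the differential, the pairs (m r, m (d
  r)) and (h r, h (d r)) meet the hypotheses of \<open>env_lift\<close> because d respects product,
  bracket and I. Signs depend on degrees. Identities are therefore proved for homogeneous elements,
  by an induction that carries the degree along, and reach the carrier by linearity. Targets such as
  the dual numbers carry no grading, so sign exponents are passed as integers. The bracket relation
  for m has to be extended before the one for h, since expanding h({a,x} b) produces m{a,x}. Maps
  defined component by component all rest on one fact about sums whose finite index set varies with
  the argument.\<close>

section \<open>Signs and graded commutators\<close>

text \<open>The parity of \<open>n\<close> is the sign: \<open>signed_comm A (p * q) a b\<close> is the graded commutator of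
  homogeneous \<open>a\<close> and \<open>b\<close> of degrees \<open>p\<close> and \<open>q\<close>.\<close>

definition signed_comm :: "('a, 'n) ring_scheme \<Rightarrow> int \<Rightarrow> 'a \<Rightarrow> 'a \<Rightarrow> 'a" where
  "signed_comm A n a b = a \<otimes>\<^bsub>A\<^esub> b \<ominus>\<^bsub>A\<^esub> koszul A n (b \<otimes>\<^bsub>A\<^esub> a)"

context ring
begin

lemma koszul_closed [simp, intro]: "a \<in> carrier R \<Longrightarrow> koszul R n a \<in> carrier R"
  by (simp add: koszul_def)

lemma koszul_zero [simp]: "koszul R n \<zero> = \<zero>"
  by (simp add: koszul_def)

lemma koszul_0 [simp]: "koszul R 0 a = a"
  by (simp add: koszul_def)

lemma koszul_add:
  "\<lbrakk>a \<in> carrier R; b \<in> carrier R\<rbrakk> \<Longrightarrow> koszul R n (a \<oplus> b) = koszul R n a \<oplus> koszul R n b"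
  by (simp add: koszul_def minus_add)

lemma koszul_minus: "a \<in> carrier R \<Longrightarrow> koszul R n (\<ominus> a) = \<ominus> koszul R n a"
  by (simp add: koszul_def)

lemma koszul_koszul: "a \<in> carrier R \<Longrightarrow> koszul R m (koszul R n a) = koszul R (m + n) a"
  by (simp add: koszul_def)

lemma koszul_mult_left:
  "\<lbrakk>a \<in> carrier R; b \<in> carrier R\<rbrakk> \<Longrightarrow> koszul R n a \<otimes> b = koszul R n (a \<otimes> b)"
  by (simp add: koszul_def l_minus)

lemma koszul_mult_right:
  "\<lbrakk>a \<in> carrier R; b \<in> carrier R\<rbrakk> \<Longrightarrow> a \<otimes> koszul R n b = koszul R n (a \<otimes> b)"
  by (simp add: koszul_def r_minus)

lemmas koszul_simps = koszul_add koszul_minus koszul_koszul koszul_mult_left koszul_mult_right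

text \<open>Ordered rewriting with \<open>a_lcomm\<close> can leave a term standing between
  \<open>a\<close> and its negative; this rule cancels the pair, so that \<open>ring_nf\<close>
  normalises sums in a noncommutative ring.\<close>

lemma r_neg3: "\<lbrakk>a \<in> carrier R; b \<in> carrier R\<rbrakk> \<Longrightarrow> a \<oplus> (b \<oplus> \<ominus> a) = b"
  using a_lcomm[of a b "\<ominus> a"] by (simp add: r_neg)

lemmas ring_nf = l_distr r_distr l_minus r_minus minus_add minus_minus a_minus_def
  a_assoc a_comm a_lcomm m_assoc r_neg1 r_neg2 r_neg3 l_neg r_neg

lemma signed_comm_closed [simp, intro]:
  "\<lbrakk>a \<in> carrier R; b \<in> carrier R\<rbrakk> \<Longrightarrow> signed_comm R n a b \<in> carrier R"
  by (simp add: signed_comm_def)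

lemma signed_comm_one_right [simp]: "a \<in> carrier R \<Longrightarrow> even n \<Longrightarrow> signed_comm R n a \<one> = \<zero>"
  by (simp add: signed_comm_def koszul_def a_minus_def r_neg)

lemma signed_comm_zero [simp]:
  "a \<in> carrier R \<Longrightarrow> signed_comm R n a \<zero> = \<zero>" "a \<in> carrier R \<Longrightarrow> signed_comm R n \<zero> a = \<zero>"
  by (simp_all add: signed_comm_def a_minus_def)

lemma signed_comm_add_right:
  "\<lbrakk>a \<in> carrier R; b \<in> carrier R; c \<in> carrier R\<rbrakk> \<Longrightarrow>
    signed_comm R n a (b \<oplus> c) = signed_comm R n a b \<oplus> signed_comm R n a c"
  by (simp add: signed_comm_def koszul_add ring_nf)

lemma signed_comm_add_left:
  "\<lbrakk>a \<in> carrier R; b \<in> carrier R; c \<in> carrier R\<rbrakk> \<Longrightarrow>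
    signed_comm R n (a \<oplus> b) c = signed_comm R n a c \<oplus> signed_comm R n b c"
  by (simp add: signed_comm_def koszul_add ring_nf)

lemma signed_comm_koszul_right:
  "\<lbrakk>a \<in> carrier R; b \<in> carrier R\<rbrakk> \<Longrightarrow> signed_comm R n a (koszul R k b) = koszul R k (signed_comm R n a b)"
  by (simp add: signed_comm_def koszul_def ring_nf)

lemma signed_comm_koszul_left:
  "\<lbrakk>a \<in> carrier R; b \<in> carrier R\<rbrakk> \<Longrightarrow> signed_comm R n (koszul R k a) b = koszul R k (signed_comm R n a b)"
  by (simp add: signed_comm_def koszul_def ring_nf)

text \<open>The derivation rule of a graded commutator for elements of degrees p, q, r. Signs see
  only parities, so eight cases reduce it to identities in a noncommutative ring. The same applies
  to the left argument below.\<close>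

lemma signed_comm_mult_right:
  assumes "a \<in> carrier R" "b \<in> carrier R" "c \<in> carrier R"
  shows "signed_comm R (p * (q + r)) a (b \<otimes> c) =
    signed_comm R (p * q) a b \<otimes> c \<oplus> koszul R (p * q) (b \<otimes> signed_comm R (p * r) a c)"
  using assms by (cases "even p"; cases "even q"; cases "even r")
    (simp_all add: signed_comm_def koszul_def ring_nf)

lemma signed_comm_mult_left:
  assumes "a \<in> carrier R" "b \<in> carrier R" "c \<in> carrier R"
  shows "signed_comm R ((p + q) * r) (a \<otimes> b) c =
    a \<otimes> signed_comm R (q * r) b c \<oplus> koszul R (q * r) (signed_comm R (p * r) a c \<otimes> b)"
  using assms by (cases "even p"; cases "even q"; cases "even r")
    (simp_all add: signed_comm_def koszul_def ring_nf)

lemma signed_comm_antisym: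
  assumes "a \<in> carrier R" "b \<in> carrier R"
  shows "signed_comm R (p * q) a b = \<ominus> koszul R (p * q) (signed_comm R (q * p) b a)"
  using assms by (simp add: signed_comm_def koszul_def ring_nf)

lemma signed_comm_eq_zero:
  assumes "a \<in> carrier R" "b \<in> carrier R" "a \<otimes> b = koszul R n (b \<otimes> a)"
  shows "signed_comm R n a b = \<zero>"
  using assms by (simp add: signed_comm_def a_minus_def r_neg)

end

section \<open>Linear maps and algebra homomorphisms\<close>

lemma linear_mapI:
  assumes "\<And>a. a \<in> carrier M \<Longrightarrow> f a \<in> carrier N"
    and "\<And>a b. \<lbrakk>a \<in> carrier M; b \<in> carrier M\<rbrakk> \<Longrightarrow> f (a \<oplus>\<^bsub>M\<^esub> b) = f a \<oplus>\<^bsub>N\<^esub> f b"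
    and "\<And>c a. \<lbrakk>c \<in> carrier K; a \<in> carrier M\<rbrakk> \<Longrightarrow> f (c \<odot>\<^bsub>M\<^esub> a) = c \<odot>\<^bsub>N\<^esub> f a"
  shows "linear_map K M N f"
  using assms by (auto simp: linear_map_def)

lemma
  assumes "linear_map K M N f"
  shows linear_map_closed: "a \<in> carrier M \<Longrightarrow> f a \<in> carrier N"
    and linear_map_add: "\<lbrakk>a \<in> carrier M; b \<in> carrier M\<rbrakk> \<Longrightarrow> f (a \<oplus>\<^bsub>M\<^esub> b) = f a \<oplus>\<^bsub>N\<^esub> f b"
    and linear_map_smult:
      "\<lbrakk>c \<in> carrier K; a \<in> carrier M\<rbrakk> \<Longrightarrow> f (c \<odot>\<^bsub>M\<^esub> a) = c \<odot>\<^bsub>N\<^esub> f a"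
  using assms by (auto simp: linear_map_def)

lemma linear_map_zero:
  assumes "linear_map K M N f" "abelian_group M" "abelian_group N"
  shows "f \<zero>\<^bsub>M\<^esub> = \<zero>\<^bsub>N\<^esub>"
proof -
  interpret M: abelian_group M by fact
  interpret N: abelian_group N by fact
  have "f \<zero>\<^bsub>M\<^esub> = f \<zero>\<^bsub>M\<^esub> \<oplus>\<^bsub>N\<^esub> f \<zero>\<^bsub>M\<^esub>"
    using linear_map_add[OF assms(1), of "\<zero>\<^bsub>M\<^esub>" "\<zero>\<^bsub>M\<^esub>"] by simp
  then show ?thesis
    using linear_map_closed[OF assms(1) M.zero_closed] by (metis N.add.r_cancel_one')
qed

lemma linear_map_minus:
  assumes "linear_map K M N f" "abelian_group M" "abelian_group N" "a \<in> carrier M"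
  shows "f (\<ominus>\<^bsub>M\<^esub> a) = \<ominus>\<^bsub>N\<^esub> f a"
proof -
  interpret M: abelian_group M by fact
  interpret N: abelian_group N by fact
  have "f (\<ominus>\<^bsub>M\<^esub> a) \<oplus>\<^bsub>N\<^esub> f a = \<zero>\<^bsub>N\<^esub>"
    using linear_map_add[OF assms(1), of "\<ominus>\<^bsub>M\<^esub> a" a] linear_map_zero[OF assms(1-3)] assms(4)
    by (simp add: M.l_neg)
  then show ?thesis
    using linear_map_closed[OF assms(1)] assms(4) by (metis M.a_inv_closed N.minus_equality)
qed

lemma linear_map_koszul:
  assumes "linear_map K M N f" "abelian_group M" "abelian_group N" "a \<in> carrier M"
  shows "f (koszul M n a) = koszul N n (f a)"
  using linear_map_minus[OF assms] by (simp add: koszul_def)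

lemma linear_map_comp:
  assumes "linear_map K L M f" "linear_map K M N g"
  shows "linear_map K L N (\<lambda>a. g (f a))"
  using assms by (auto simp: linear_map_def Pi_iff)

lemma linear_map_plus:
  assumes "module K M" "module K N" "linear_map K M N f" "linear_map K M N g"
  shows "linear_map K M N (\<lambda>a. f a \<oplus>\<^bsub>N\<^esub> g a)"
proof -
  interpret M: module K M by fact
  interpret N: module K N by fact
  note [simp] = linear_map_closed[OF assms(3)] linear_map_closed[OF assms(4)]
    linear_map_add[OF assms(3)] linear_map_add[OF assms(4)]
    linear_map_smult[OF assms(3)] linear_map_smult[OF assms(4)]
  show ?thesis
    by (rule linear_mapI) (auto simp: N.smult_r_distr N.a_assoc N.a_lcomm)
qed

lemma linear_map_id: "linear_map K M M (\<lambda>a. a)"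
  by (rule linear_mapI) auto

text \<open>Set on \<open>module_scheme\<close>, without grading or differential, so that it also
  covers maps into the dual numbers.\<close>

definition alg_hom ::
  "('k, 'm) ring_scheme \<Rightarrow> ('k, 'a, 'n) module_scheme \<Rightarrow> ('k, 'b, 'p) module_scheme
    \<Rightarrow> ('a \<Rightarrow> 'b) \<Rightarrow> bool" where
  "alg_hom K A B f \<longleftrightarrow> f \<in> ring_hom A B \<and> linear_map K A B f"

lemma alg_homI:
  assumes "linear_map K A B f"
    and "\<And>a b. \<lbrakk>a \<in> carrier A; b \<in> carrier A\<rbrakk> \<Longrightarrow> f (a \<otimes>\<^bsub>A\<^esub> b) = f a \<otimes>\<^bsub>B\<^esub> f b"
    and "f \<one>\<^bsub>A\<^esub> = \<one>\<^bsub>B\<^esub>"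
  shows "alg_hom K A B f"
  using assms unfolding alg_hom_def by (auto intro!: ring_hom_memI simp: linear_map_def)

lemma
  assumes "alg_hom K A B f"
  shows alg_hom_linear: "linear_map K A B f"
    and alg_hom_closed: "a \<in> carrier A \<Longrightarrow> f a \<in> carrier B"
    and alg_hom_add: "\<lbrakk>a \<in> carrier A; b \<in> carrier A\<rbrakk> \<Longrightarrow> f (a \<oplus>\<^bsub>A\<^esub> b) = f a \<oplus>\<^bsub>B\<^esub> f b"
    and alg_hom_smult: "\<lbrakk>c \<in> carrier K; a \<in> carrier A\<rbrakk> \<Longrightarrow> f (c \<odot>\<^bsub>A\<^esub> a) = c \<odot>\<^bsub>B\<^esub> f a"
    and alg_hom_mult: "\<lbrakk>a \<in> carrier A; b \<in> carrier A\<rbrakk> \<Longrightarrow> f (a \<otimes>\<^bsub>A\<^esub> b) = f a \<otimes>\<^bsub>B\<^esub> f b"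
    and alg_hom_one: "f \<one>\<^bsub>A\<^esub> = \<one>\<^bsub>B\<^esub>"
  using assms by (auto simp: alg_hom_def linear_map_def ring_hom_def)

lemma alg_hom_comp:
  assumes "alg_hom K A B f" "alg_hom K B C g"
  shows "alg_hom K A C (\<lambda>a. g (f a))"
  using assms
  by (auto simp: alg_hom_def linear_map_def ring_hom_def Pi_iff)

lemma alg_hom_id: "alg_hom K A A (\<lambda>a. a)"
  by (rule alg_homI) (auto intro: linear_map_id)

lemma alg_hom_signed_comm:
  assumes "alg_hom K A B f" "ring A" "ring B" "a \<in> carrier A" "b \<in> carrier A"
  shows "f (signed_comm A n a b) = signed_comm B n (f a) (f b)"
proof -
  interpret A: ring A by fact
  interpret B: ring B by fact
  note ag = A.is_abelian_group B.is_abelian_group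
  note lin = alg_hom_linear[OF assms(1)]
  show ?thesis
    using assms(4,5) alg_hom_mult[OF assms(1)] alg_hom_add[OF assms(1)]
      linear_map_koszul[OF lin ag] linear_map_minus[OF lin ag]
    by (simp add: signed_comm_def a_minus_def)
qed

context k_algebra
begin

lemma koszul_smult: "\<lbrakk>c \<in> carrier K; a \<in> carrier A\<rbrakk> \<Longrightarrow> koszul A n (c \<odot> a) = c \<odot> koszul A n a"
  by (simp add: koszul_def V.smult_r_minus)

lemma linear_koszul: "linear_map K A A (koszul A n)"
  by (rule linear_mapI) (simp_all add: koszul_add koszul_smult)

lemma linear_lmult: "b \<in> carrier A \<Longrightarrow> linear_map K A A (\<lambda>a. b \<otimes> a)"
  by (rule linear_mapI) (auto simp: r_distr smult_mult_right)

lemma linear_rmult: "b \<in> carrier A \<Longrightarrow> linear_map K A A (\<lambda>a. a \<otimes> b)"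
  by (rule linear_mapI) (auto simp: l_distr smult_mult_left)

lemma linear_signed_comm_right: "a \<in> carrier A \<Longrightarrow> linear_map K A A (signed_comm A n a)"
  by (rule linear_mapI, simp, simp add: signed_comm_add_right)
    (simp add: signed_comm_def smult_mult_left smult_mult_right koszul_smult a_minus_def
      V.smult_r_distr V.smult_r_minus)

lemma linear_signed_comm_left: "b \<in> carrier A \<Longrightarrow> linear_map K A A (\<lambda>a. signed_comm A n a b)"
  by (rule linear_mapI, simp, simp add: signed_comm_add_left)
    (simp add: signed_comm_def smult_mult_left smult_mult_right koszul_smult a_minus_def
      V.smult_r_distr V.smult_r_minus)

end

section \<open>Structures with the same operations\<close>

text \<open>Adding a differential or a bracket to a record changes its type but not its operations.
  The transfer facts of this section carry structure between such records, for instance from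
  \<open>sym_galg\<close> to the given R and from \<open>env_galg\<close> to
  \<open>env_dgalg\<close>.\<close>

lemma a_inv_cong:
  assumes "carrier B = carrier A" "\<zero>\<^bsub>B\<^esub> = \<zero>\<^bsub>A\<^esub>" "add B = add A"
  shows "a_inv B = a_inv A"
  using assms by (simp add: a_inv_def m_inv_def fun_eq_iff)

lemma finsum_record_cong:
  assumes "carrier B = carrier A" "\<zero>\<^bsub>B\<^esub> = \<zero>\<^bsub>A\<^esub>" "add B = add A"
  shows "finsum B = finsum A"
  using assms by (intro ext) (simp add: finsum_def finprod_def)

lemma koszul_record_cong:
  assumes "carrier B = carrier A" "\<zero>\<^bsub>B\<^esub> = \<zero>\<^bsub>A\<^esub>" "add B = add A"
  shows "koszul B = koszul A"
  using a_inv_cong[OF assms] by (simp add: koszul_def fun_eq_iff)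

lemma abelian_group_record_cong:
  assumes "abelian_group A" "carrier B = carrier A" "\<zero>\<^bsub>B\<^esub> = \<zero>\<^bsub>A\<^esub>" "add B = add A"
  shows "abelian_group B"
proof -
  interpret A: abelian_group A by fact
  show ?thesis
    using assms by (intro abelian_groupI) (auto simp: A.a_ac intro: A.l_neg)
qed

lemma k_algebra_record_cong:
  assumes "k_algebra K A" "carrier B = carrier A" "\<zero>\<^bsub>B\<^esub> = \<zero>\<^bsub>A\<^esub>" "add B = add A"
    "monoid.mult B = monoid.mult A" "\<one>\<^bsub>B\<^esub> = \<one>\<^bsub>A\<^esub>" "smult B = smult A"
  shows "k_algebra K B"
proof -
  interpret A: k_algebra K A by fact
  have ag: "abelian_group B"
    using A.M.abelian_group_axioms assms(2-4) by (rule abelian_group_record_cong)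
  have "monoid B"
    using assms by (intro monoidI) (auto simp: A.m_assoc)
  then have "ring B"
    using ag assms by (intro ringI) (auto simp: A.l_distr A.r_distr)
  moreover have "module K B"
    using ag assms by (intro moduleI) (auto simp: A.smult_l_distr A.smult_r_distr A.smult_assoc1 A.R.cring_axioms)
  ultimately show ?thesis
    using assms by (intro k_algebra.intro k_algebra_axioms.intro)
      (auto simp: A.smult_mult_left A.smult_mult_right)
qed

lemma homog_decomp_record_cong:
  assumes "carrier B = carrier A" "\<zero>\<^bsub>B\<^esub> = \<zero>\<^bsub>A\<^esub>" "add B = add A" "homog B = homog A"
  shows "homog_decomp B = homog_decomp A"
  using assms by (intro ext) (simp add: homog_decomp_def finsum_record_cong[OF assms(1-3)])

lemma hcomp_record_cong:
  assumes "carrier B = carrier A" "\<zero>\<^bsub>B\<^esub> = \<zero>\<^bsub>A\<^esub>" "add B = add A" "homog B = homog A"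
  shows "hcomp B = hcomp A"
  using homog_decomp_record_cong[OF assms] by (simp add: hcomp_def fun_eq_iff)

lemma graded_algebra_record_cong:
  assumes "graded_algebra K A" "carrier B = carrier A" "\<zero>\<^bsub>B\<^esub> = \<zero>\<^bsub>A\<^esub>" "add B = add A"
    "monoid.mult B = monoid.mult A" "\<one>\<^bsub>B\<^esub> = \<one>\<^bsub>A\<^esub>" "smult B = smult A" "homog B = homog A"
  shows "graded_algebra K B"
proof -
  interpret A: graded_algebra K A by fact
  interpret B: k_algebra K B
    using A.k_algebra_axioms assms(2-7) by (rule k_algebra_record_cong)
  have "submodule (homog B n) K B" for n
    using assms A.V.submoduleE[OF A.homog_submodule[of n]] a_inv_cong[OF assms(2-4)]
      subgroup.one_closed[OF submodule.axioms(1)[OF A.homog_submodule[of n]]]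
    by (intro B.V.submoduleI) auto
  then show ?thesis
    using homog_decomp_record_cong[OF assms(2-4,8)] assms A.direct_sum A.one_homog A.mult_homog
    by (intro graded_algebra.intro B.k_algebra_axioms graded_algebra_axioms.intro) auto
qed

lemma linear_map_finsum:
  assumes "linear_map K M N f" "abelian_group M" "abelian_group N" "g \<in> S \<rightarrow> carrier M"
  shows "f (finsum M g S) = finsum N (\<lambda>i. f (g i)) S"
proof -
  interpret M: abelian_group M by fact
  interpret N: abelian_group N by fact
  show ?thesis
    using assms(4)
  proof (induction S rule: infinite_finite_induct)
    case (insert i S)
    then have "f (finsum M g (insert i S)) = f (g i \<oplus>\<^bsub>M\<^esub> finsum M g S)"
      by (subst M.finsum_insert) auto
    also have "\<dots> = f (g i) \<oplus>\<^bsub>N\<^esub> f (finsum M g S)"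
      using insert.prems by (intro linear_map_add[OF assms(1)] M.finsum_closed) auto
    also have "\<dots> = finsum N (\<lambda>i. f (g i)) (insert i S)"
      using insert linear_map_closed[OF assms(1)]
      by (subst N.finsum_insert) (auto simp: Pi_iff)
    finally show ?case .
  qed (use linear_map_zero[OF assms(1-3)] in auto)
qed

text \<open>The index set depends on \<open>a\<close>, so additivity is not immediate. All sums
  involved are first taken over one common finite set; the terms added are images of zero. Each
  \<open>t n\<close> need be linear only on \<open>C n\<close>, because maps such as the inclusion
  into F(R) are given degree by degree. The sign automorphism, the bilinear commutator, that
  inclusion, \<open>psi\<close> and evaluation on the free algebra are all obtained from
  this.\<close>

lemma linear_map_supp_sum:
  fixes N :: "('k, 'b, 'p) module_scheme" and L :: "('k, 'c, 'q) module_scheme"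
  assumes "module K M" "module K L" "module K N"
    and c: "\<And>n. n \<in> X \<Longrightarrow> linear_map K M L (c n)"
    and cC: "\<And>n a. \<lbrakk>n \<in> X; a \<in> carrier M\<rbrakk> \<Longrightarrow> c n a \<in> C n"
    and t: "\<And>n. n \<in> X \<Longrightarrow> linear_map K (L\<lparr>carrier := C n\<rparr>) N (t n)"
    and fin: "\<And>a. a \<in> carrier M \<Longrightarrow> finite {n \<in> X. c n a \<noteq> \<zero>\<^bsub>L\<^esub>}"
  shows "linear_map K M N (\<lambda>a. \<Oplus>\<^bsub>N\<^esub>n\<in>{n \<in> X. c n a \<noteq> \<zero>\<^bsub>L\<^esub>}. t n (c n a))"
proof -
  interpret M: module K M by fact
  interpret L: module K L by fact
  interpret N: module K N by fact
  define supp where "supp a = {n \<in> X. c n a \<noteq> \<zero>\<^bsub>L\<^esub>}" for a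
  have t_closed: "t n (c n a) \<in> carrier N" if "n \<in> X" "a \<in> carrier M" for n a
    using linear_map_closed[OF t[OF that(1)]] cC[OF that] by simp
  \<comment> \<open>\<open>L\<close> with carrier \<open>C n\<close> is not known to be a group, so
    the value at zero is read off from additivity alone.\<close>
  have t_zero: "t n \<zero>\<^bsub>L\<^esub> = \<zero>\<^bsub>N\<^esub>" if "n \<in> X" for n
  proof -
    have "c n \<zero>\<^bsub>M\<^esub> = \<zero>\<^bsub>L\<^esub>"
      using linear_map_zero[OF c[OF that] M.M.abelian_group_axioms L.M.abelian_group_axioms] .
    then have z: "\<zero>\<^bsub>L\<^esub> \<in> C n" using cC[OF that M.M.zero_closed] by simp
    have "t n \<zero>\<^bsub>L\<^esub> = t n \<zero>\<^bsub>L\<^esub> \<oplus>\<^bsub>N\<^esub> t n \<zero>\<^bsub>L\<^esub>"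
      using linear_map_add[OF t[OF that], of "\<zero>\<^bsub>L\<^esub>" "\<zero>\<^bsub>L\<^esub>"] z by simp
    moreover have "t n \<zero>\<^bsub>L\<^esub> \<in> carrier N" using linear_map_closed[OF t[OF that]] z by simp
    ultimately show ?thesis by (metis N.M.add.r_cancel_one')
  qed
  have pad: "(\<Oplus>\<^bsub>N\<^esub>n\<in>supp a. t n (c n a)) = (\<Oplus>\<^bsub>N\<^esub>n\<in>S. t n (c n a))"
    if "a \<in> carrier M" "finite S" "supp a \<subseteq> S" "S \<subseteq> X" for a S
    by (rule N.M.add.finprod_mono_neutral_cong_left)
      (use that in \<open>auto simp: supp_def t_closed t_zero Pi_iff\<close>)
  have "linear_map K M N (\<lambda>a. \<Oplus>\<^bsub>N\<^esub>n\<in>supp a. t n (c n a))"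
  proof (rule linear_mapI)
    fix a assume a: "a \<in> carrier M"
    show "(\<Oplus>\<^bsub>N\<^esub>n\<in>supp a. t n (c n a)) \<in> carrier N"
      using a t_closed by (intro N.M.finsum_closed) (auto simp: supp_def)
    fix b assume b: "b \<in> carrier M"
    define S where "S = supp a \<union> supp b \<union> supp (a \<oplus>\<^bsub>M\<^esub> b)"
    have S: "finite S" "S \<subseteq> X" using a b fin by (auto simp: S_def supp_def)
    have "(\<Oplus>\<^bsub>N\<^esub>n\<in>supp (a \<oplus>\<^bsub>M\<^esub> b). t n (c n (a \<oplus>\<^bsub>M\<^esub> b))) =
        (\<Oplus>\<^bsub>N\<^esub>n\<in>S. t n (c n (a \<oplus>\<^bsub>M\<^esub> b)))"
      using a b S by (intro pad) (auto simp: S_def)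
    also have "\<dots> = (\<Oplus>\<^bsub>N\<^esub>n\<in>S. t n (c n a) \<oplus>\<^bsub>N\<^esub> t n (c n b))"
    proof (rule N.M.finsum_cong')
      fix n assume "n \<in> S"
      then have n: "n \<in> X" using S by auto
      show "t n (c n (a \<oplus>\<^bsub>M\<^esub> b)) = t n (c n a) \<oplus>\<^bsub>N\<^esub> t n (c n b)"
        using linear_map_add[OF c[OF n] a b] linear_map_add[OF t[OF n], of "c n a" "c n b"]
          cC[OF n a] cC[OF n b] by simp
    qed (use S a b t_closed in auto)
    also have "\<dots> = (\<Oplus>\<^bsub>N\<^esub>n\<in>S. t n (c n a)) \<oplus>\<^bsub>N\<^esub> (\<Oplus>\<^bsub>N\<^esub>n\<in>S. t n (c n b))"
      using S a b t_closed by (intro N.M.finsum_addf) auto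
    also have "(\<Oplus>\<^bsub>N\<^esub>n\<in>S. t n (c n a)) = (\<Oplus>\<^bsub>N\<^esub>n\<in>supp a. t n (c n a))"
      using a S by (intro pad[symmetric]) (auto simp: S_def)
    also have "(\<Oplus>\<^bsub>N\<^esub>n\<in>S. t n (c n b)) = (\<Oplus>\<^bsub>N\<^esub>n\<in>supp b. t n (c n b))"
      using b S by (intro pad[symmetric]) (auto simp: S_def)
    finally show "(\<Oplus>\<^bsub>N\<^esub>n\<in>supp (a \<oplus>\<^bsub>M\<^esub> b). t n (c n (a \<oplus>\<^bsub>M\<^esub> b))) =
      (\<Oplus>\<^bsub>N\<^esub>n\<in>supp a. t n (c n a)) \<oplus>\<^bsub>N\<^esub> (\<Oplus>\<^bsub>N\<^esub>n\<in>supp b. t n (c n b))" .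
  next
    fix k a assume k: "k \<in> carrier K" and a: "a \<in> carrier M"
    define S where "S = supp a \<union> supp (k \<odot>\<^bsub>M\<^esub> a)"
    have S: "finite S" "S \<subseteq> X" using a k fin by (auto simp: S_def supp_def)
    have "(\<Oplus>\<^bsub>N\<^esub>n\<in>supp (k \<odot>\<^bsub>M\<^esub> a). t n (c n (k \<odot>\<^bsub>M\<^esub> a))) =
        (\<Oplus>\<^bsub>N\<^esub>n\<in>S. t n (c n (k \<odot>\<^bsub>M\<^esub> a)))"
      using a k S by (intro pad) (auto simp: S_def)
    also have "\<dots> = (\<Oplus>\<^bsub>N\<^esub>n\<in>S. k \<odot>\<^bsub>N\<^esub> t n (c n a))"
    proof (rule N.M.finsum_cong')
      fix n assume "n \<in> S"
      then have n: "n \<in> X" using S by auto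
      show "t n (c n (k \<odot>\<^bsub>M\<^esub> a)) = k \<odot>\<^bsub>N\<^esub> t n (c n a)"
        using linear_map_smult[OF c[OF n] k a] linear_map_smult[OF t[OF n] k, of "c n a"]
          cC[OF n a] by simp
    qed (use S a k t_closed in auto)
    also have "\<dots> = k \<odot>\<^bsub>N\<^esub> (\<Oplus>\<^bsub>N\<^esub>n\<in>S. t n (c n a))"
    proof (rule linear_map_finsum[symmetric])
      show "linear_map K N N (\<lambda>a. k \<odot>\<^bsub>N\<^esub> a)"
        using k by (intro linear_mapI) (auto simp: N.smult_r_distr M.R.m_comm simp flip: N.smult_assoc1)
    qed (use S a t_closed in \<open>auto intro: N.M.abelian_group_axioms\<close>)
    also have "(\<Oplus>\<^bsub>N\<^esub>n\<in>S. t n (c n a)) = (\<Oplus>\<^bsub>N\<^esub>n\<in>supp a. t n (c n a))"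
      using a S by (intro pad[symmetric]) (auto simp: S_def)
    finally show "(\<Oplus>\<^bsub>N\<^esub>n\<in>supp (k \<odot>\<^bsub>M\<^esub> a). t n (c n (k \<odot>\<^bsub>M\<^esub> a))) =
      k \<odot>\<^bsub>N\<^esub> (\<Oplus>\<^bsub>N\<^esub>n\<in>supp a. t n (c n a))" .
  qed
  then show ?thesis by (simp add: supp_def)
qed

section \<open>Homogeneous components\<close>

text \<open>The twist of the dual numbers: exponent \<open>deg \<alpha>\<close> serves the partial
  derivative along \<alpha>, exponent 1 the differential. It also lets a degree-dependent sign be
  written as a linear map when the argument is not homogeneous.\<close>

definition sgn_aut :: "('k, 'a, 'n) galg_scheme \<Rightarrow> int \<Rightarrow> 'a \<Rightarrow> 'a" where
  "sgn_aut A k a =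
    (\<Oplus>\<^bsub>A\<^esub>n\<in>{n. hcomp A a n \<noteq> \<zero>\<^bsub>A\<^esub>}. koszul A (k * n) (hcomp A a n))"

context graded_algebra
begin

lemma homog_closed: "a \<in> homog A n \<Longrightarrow> a \<in> carrier A"
  using V.submoduleE(1)[OF homog_submodule] by blast

lemma homog_add: "\<lbrakk>a \<in> homog A n; b \<in> homog A n\<rbrakk> \<Longrightarrow> a \<oplus> b \<in> homog A n"
  using V.submoduleE(5)[OF homog_submodule] .

lemma homog_minus: "a \<in> homog A n \<Longrightarrow> \<ominus> a \<in> homog A n"
  using V.submoduleE(3)[OF homog_submodule] .

lemma homog_smult: "\<lbrakk>c \<in> carrier K; a \<in> homog A n\<rbrakk> \<Longrightarrow> c \<odot> a \<in> homog A n"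
  using V.submoduleE(4)[OF homog_submodule] .

lemma homog_zero: "\<zero> \<in> homog A n"
  using subgroup.one_closed[OF submodule.axioms(1)[OF homog_submodule]] by simp

lemma homog_koszul: "a \<in> homog A n \<Longrightarrow> koszul A k a \<in> homog A n"
  by (simp add: koszul_def homog_minus)

lemma homog_diff: "\<lbrakk>a \<in> homog A n; b \<in> homog A n\<rbrakk> \<Longrightarrow> a \<ominus> b \<in> homog A n"
  by (simp add: a_minus_def homog_minus homog_add)

lemma signed_comm_homog: "\<lbrakk>a \<in> homog A p; b \<in> homog A q\<rbrakk> \<Longrightarrow> signed_comm A k a b \<in> homog A (p + q)"
  using mult_homog[of b q a p] by (auto simp: signed_comm_def add.commute intro!: homog_diff homog_koszul mult_homog)

lemma hcomp_decomp: "a \<in> carrier A \<Longrightarrow> homog_decomp A a (hcomp A a)"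
  unfolding hcomp_def by (rule theI'[OF direct_sum])

lemma hcomp_eqI: "\<lbrakk>a \<in> carrier A; homog_decomp A a f\<rbrakk> \<Longrightarrow> hcomp A a = f"
  using hcomp_decomp direct_sum by blast

lemma hcomp_homog: "a \<in> carrier A \<Longrightarrow> hcomp A a n \<in> homog A n"
  using hcomp_decomp by (auto simp: homog_decomp_def)

lemma hcomp_closed [simp]: "a \<in> carrier A \<Longrightarrow> hcomp A a n \<in> carrier A"
  using hcomp_homog homog_closed by blast

lemma hcomp_finite: "a \<in> carrier A \<Longrightarrow> finite {n. hcomp A a n \<noteq> \<zero>}"
  using hcomp_decomp by (auto simp: homog_decomp_def)

lemma hcomp_sum: "a \<in> carrier A \<Longrightarrow> a = (\<Oplus>n\<in>{n. hcomp A a n \<noteq> \<zero>}. hcomp A a n)"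
  using hcomp_decomp by (auto simp: homog_decomp_def)

lemma hcomp_of_homog:
  assumes "a \<in> homog A n"
  shows "hcomp A a = (\<lambda>m. if m = n then a else \<zero>)"
proof (rule hcomp_eqI)
  show "a \<in> carrier A" using assms by (rule homog_closed)
  then have "finsum A (\<lambda>m. if m = n then a else \<zero>) {m. m = n \<and> a \<noteq> \<zero>} = a"
    by (cases "a = \<zero>") auto
  moreover have "{m. (if m = n then a else \<zero>) \<noteq> \<zero>} = {m. m = n \<and> a \<noteq> \<zero>}" by auto
  ultimately show "homog_decomp A a (\<lambda>m. if m = n then a else \<zero>)"
    using assms by (simp add: homog_decomp_def homog_zero)
qed

text \<open>Adding or scaling decompositions componentwise gives a decomposition of the sum or the
  multiple, and decompositions are unique.\<close>

lemma linear_hcomp: "linear_map K A A (\<lambda>a. hcomp A a n)"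
proof (rule linear_mapI)
  fix a b assume a: "a \<in> carrier A" and b: "b \<in> carrier A"
  define S where "S = {n. hcomp A a n \<noteq> \<zero>} \<union> {n. hcomp A b n \<noteq> \<zero>}"
  have S: "finite S" using a b hcomp_finite by (auto simp: S_def)
  have "hcomp A (a \<oplus> b) = (\<lambda>n. hcomp A a n \<oplus> hcomp A b n)"
  proof (rule hcomp_eqI)
    have "a \<oplus> b = (\<Oplus>n\<in>S. hcomp A a n) \<oplus> (\<Oplus>n\<in>S. hcomp A b n)"
      using hcomp_sum[OF a] hcomp_sum[OF b] a b S
      by (intro arg_cong2[where f = "(\<oplus>)"]; elim trans, intro add.finprod_mono_neutral_cong_left)
        (auto simp: S_def)
    also have "\<dots> = (\<Oplus>n\<in>S. hcomp A a n \<oplus> hcomp A b n)"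
      using a b by (intro finsum_addf[symmetric]) auto
    also have "\<dots> = (\<Oplus>n\<in>{n. hcomp A a n \<oplus> hcomp A b n \<noteq> \<zero>}. hcomp A a n \<oplus> hcomp A b n)"
      using a b S by (intro add.finprod_mono_neutral_cong_right) (auto simp: S_def)
    finally show "homog_decomp A (a \<oplus> b) (\<lambda>n. hcomp A a n \<oplus> hcomp A b n)"
      using a b by (auto simp: homog_decomp_def hcomp_homog intro!: homog_add finite_subset[OF _ S])
        (auto simp: S_def)
  qed (use a b in auto)
  then show "hcomp A (a \<oplus> b) n = hcomp A a n \<oplus> hcomp A b n" by simp
next
  fix c a assume c: "c \<in> carrier K" and a: "a \<in> carrier A"
  define S where "S = {n. hcomp A a n \<noteq> \<zero>}"
  have S: "finite S" using a hcomp_finite by (auto simp: S_def)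
  have "hcomp A (c \<odot> a) = (\<lambda>n. c \<odot> hcomp A a n)"
  proof (rule hcomp_eqI)
    have lin: "linear_map K A A (\<lambda>a. c \<odot> a)"
      using c by (intro linear_mapI) (auto simp: V.smult_r_distr V.R.m_comm simp flip: V.smult_assoc1)
    have "c \<odot> a = c \<odot> (\<Oplus>n\<in>S. hcomp A a n)"
      using hcomp_sum[OF a] by (simp add: S_def)
    also have "\<dots> = (\<Oplus>n\<in>S. c \<odot> hcomp A a n)"
      using a by (intro linear_map_finsum[OF lin]) (auto intro: V.M.abelian_group_axioms)
    also have "\<dots> = (\<Oplus>n\<in>{n. c \<odot> hcomp A a n \<noteq> \<zero>}. c \<odot> hcomp A a n)"
      using a c S by (intro add.finprod_mono_neutral_cong_right) (auto simp: S_def)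
    finally show "homog_decomp A (c \<odot> a) (\<lambda>n. c \<odot> hcomp A a n)"
      using a c by (auto simp: homog_decomp_def hcomp_homog intro!: homog_smult finite_subset[OF _ S])
        (auto simp: S_def)
  qed (use a c in auto)
  then show "hcomp A (c \<odot> a) n = c \<odot> hcomp A a n" by simp
qed simp

lemmas hcomp_add = linear_map_add[OF linear_hcomp]
  and hcomp_minus = linear_map_minus[OF linear_hcomp V.M.abelian_group_axioms V.M.abelian_group_axioms]
  and hcomp_zero [simp] = linear_map_zero[OF linear_hcomp V.M.abelian_group_axioms V.M.abelian_group_axioms]

lemma homog_induct [consumes 1, case_names zero add]:
  assumes "a \<in> carrier A" "P \<zero>"
    and "\<And>n a b. \<lbrakk>a \<in> homog A n; b \<in> carrier A; P b\<rbrakk> \<Longrightarrow> P (a \<oplus> b)"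
  shows "P a"
proof -
  have "P (\<Oplus>n\<in>S. hcomp A a n)" if "finite S" for S
    using that
  proof induction
    case (insert n S)
    then show ?case
      using assms(1) hcomp_homog by (subst finsum_insert) (auto intro!: assms(3) finsum_closed)
  qed (use assms(2) in simp)
  then show ?thesis
    using hcomp_sum[OF assms(1)] hcomp_finite[OF assms(1)] by metis
qed

text \<open>The device that carries identities with degree-dependent signs from homogeneous elements
  to the whole carrier; for bilinear identities it is applied once per argument.\<close>

lemma linear_eq_on_homog:
  assumes "linear_map K A M f" "linear_map K A M g" "abelian_group M"
    and "\<And>n a. a \<in> homog A n \<Longrightarrow> f a = g a"
    and "a \<in> carrier A"
  shows "f a = g a"
  using assms(5)
proof (induction a rule: homog_induct)
  case zero
  then show ?case using assms(4)[OF homog_zero] .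
next
  case (add n a b)
  then show ?case
    using linear_map_add[OF assms(1)] linear_map_add[OF assms(2)] assms(4) homog_closed by metis
qed

lemma hcomp_mult_left:
  assumes "b \<in> homog A q" "a \<in> carrier A"
  shows "hcomp A (b \<otimes> a) n = b \<otimes> hcomp A a (n - q)"
  using assms(2)
proof (induction a rule: homog_induct)
  case zero
  then show ?case using assms homog_closed by simp
next
  case (add p a c)
  have "hcomp A (b \<otimes> a) n = b \<otimes> hcomp A a (n - q)"
    using hcomp_of_homog[OF mult_homog[OF assms(1) add(1)]] hcomp_of_homog[OF add(1)] assms(1)
    by (auto simp: homog_closed)
  then show ?case
    using add assms by (simp add: homog_closed r_distr hcomp_add)
qed

lemma hcomp_mult_right:
  assumes "b \<in> homog A q" "a \<in> carrier A"
  shows "hcomp A (a \<otimes> b) n = hcomp A a (n - q) \<otimes> b"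
  using assms(2)
proof (induction a rule: homog_induct)
  case zero
  then show ?case using assms homog_closed by simp
next
  case (add p a c)
  have "hcomp A (a \<otimes> b) n = hcomp A a (n - q) \<otimes> b"
    using hcomp_of_homog[OF mult_homog[OF add(1) assms(1)]] hcomp_of_homog[OF add(1)] assms(1)
    by (auto simp: homog_closed)
  then show ?case
    using add assms by (simp add: homog_closed l_distr hcomp_add)
qed

text \<open>Glues a family of maps given on the homogeneous parts into one linear map; the companion
  fact below identifies its restriction to degree n with \<open>t n\<close>.\<close>

lemma hcomp_sum_linear:
  assumes "module K N" "\<And>n. linear_map K (A\<lparr>carrier := homog A n\<rparr>) N (t n)"
  shows "linear_map K A N (\<lambda>a. \<Oplus>\<^bsub>N\<^esub>n\<in>{n. hcomp A a n \<noteq> \<zero>}. t n (hcomp A a n))"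
  using linear_map_supp_sum[OF V.module_axioms V.module_axioms assms(1), of UNIV
      "\<lambda>n a. hcomp A a n" "homog A" t] assms(2)
  by (simp add: linear_hcomp hcomp_homog hcomp_finite)

lemma hcomp_sum_homog:
  assumes "abelian_group N" "linear_map K (A\<lparr>carrier := homog A n\<rparr>) N (t n)" "a \<in> homog A n"
  shows "(\<Oplus>\<^bsub>N\<^esub>m\<in>{m. hcomp A a m \<noteq> \<zero>}. t m (hcomp A a m)) = t n a"
proof -
  interpret N: abelian_group N by fact
  note t = linear_map_closed[OF assms(2)]
  show ?thesis
  \<comment> \<open>For zero the index set is empty, so the claim becomes
    \<open>t n \<zero> = \<zero>\<close> in the target; otherwise the index set is exactly
    {n}.\<close>
  proof (cases "a = \<zero>")
    case True
    have "t n \<zero> = t n \<zero> \<oplus>\<^bsub>N\<^esub> t n \<zero>"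
      using linear_map_add[OF assms(2), of "\<zero>" "\<zero>"] by (simp add: homog_zero)
    then have "t n \<zero> = \<zero>\<^bsub>N\<^esub>"
      using t[of "\<zero>"] homog_zero N.add.r_cancel_one[of "t n \<zero>" "t n \<zero>"] by simp
    then show ?thesis using True by simp
  next
    case False
    then have "{m. hcomp A a m \<noteq> \<zero>} = {n}"
      using hcomp_of_homog[OF assms(3)] by auto
    then show ?thesis using hcomp_of_homog[OF assms(3)] t assms(3) by simp
  qed
qed

lemma linear_koszul_homog: "linear_map K (A\<lparr>carrier := homog A n\<rparr>) A (koszul A k)"
proof (rule linear_mapI)
  fix c a assume "c \<in> carrier K" "a \<in> carrier (A\<lparr>carrier := homog A n\<rparr>)"
  then show "koszul A k (c \<odot>\<^bsub>A\<lparr>carrier := homog A n\<rparr>\<^esub> a) = c \<odot> koszul A k a"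
    by (simp add: koszul_def homog_closed V.smult_r_minus)
qed (auto simp: koszul_add homog_closed)

lemma sgn_aut_homog: "a \<in> homog A n \<Longrightarrow> sgn_aut A k a = koszul A (k * n) a"
  unfolding sgn_aut_def
  by (rule hcomp_sum_homog[OF _ linear_koszul_homog]) (auto intro: V.M.abelian_group_axioms)

lemma linear_sgn_aut: "linear_map K A A (sgn_aut A k)"
  unfolding sgn_aut_def
  using hcomp_sum_linear[OF V.module_axioms, of "\<lambda>n. koszul A (k * n)"] linear_koszul_homog
  by simp

lemma alg_hom_sgn_aut: "alg_hom K A A (sgn_aut A k)"
proof (rule alg_homI)
  show "linear_map K A A (sgn_aut A k)" by (rule linear_sgn_aut)
  note closed [simp] = linear_map_closed[OF linear_sgn_aut]
  note ag = V.M.abelian_group_axioms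
  show "sgn_aut A k \<one> = \<one>"
    using sgn_aut_homog[OF one_homog] by simp
  \<comment> \<open>For homogeneous factors the exponents k p and k q add up to k (p + q). The right
    factor is freed first, then the left one.\<close>
  have 1: "sgn_aut A k (a \<otimes> b) = sgn_aut A k a \<otimes> sgn_aut A k b"
    if a: "a \<in> homog A p" and b: "b \<in> carrier A" for a b p
  proof (rule linear_eq_on_homog[OF _ _ ag _ b])
    show "linear_map K A A (\<lambda>b. sgn_aut A k (a \<otimes> b))"
      using a by (intro linear_map_comp[OF linear_lmult linear_sgn_aut]) (rule homog_closed)
    show "linear_map K A A (\<lambda>b. sgn_aut A k a \<otimes> sgn_aut A k b)"
      using a by (intro linear_map_comp[OF linear_sgn_aut linear_lmult]) (simp add: homog_closed)
    fix q c assume c: "c \<in> homog A q"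
    show "sgn_aut A k (a \<otimes> c) = sgn_aut A k a \<otimes> sgn_aut A k c"
      using sgn_aut_homog[OF mult_homog[OF a c]] sgn_aut_homog[OF a] sgn_aut_homog[OF c]
        homog_closed[OF a] homog_closed[OF c]
      by (simp add: koszul_simps algebra_simps)
  qed
  fix a b assume a: "a \<in> carrier A" and b: "b \<in> carrier A"
  show "sgn_aut A k (a \<otimes> b) = sgn_aut A k a \<otimes> sgn_aut A k b"
  proof (rule linear_eq_on_homog[OF _ _ ag _ a])
    show "linear_map K A A (\<lambda>a. sgn_aut A k (a \<otimes> b))"
      using b by (intro linear_map_comp[OF linear_rmult linear_sgn_aut])
    show "linear_map K A A (\<lambda>a. sgn_aut A k a \<otimes> sgn_aut A k b)"
      using b by (intro linear_map_comp[OF linear_sgn_aut linear_rmult]) simp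
  qed (use 1 b in auto)
qed

text \<open>The elements whose components all lie in the generated ideal form an ideal
  \<open>H\<close> containing \<open>S\<close>, so minimality applies. Multiplication by a
  homogeneous element merely shifts components, which shows \<open>H\<close> closed under
  homogeneous factors; sums of these give all factors.\<close>

lemma genideal_hcomp:
  assumes S: "S \<subseteq> carrier A" and hS: "\<And>s n. s \<in> S \<Longrightarrow> hcomp A s n \<in> Idl\<^bsub>A\<^esub> S"
    and a: "a \<in> Idl\<^bsub>A\<^esub> S"
  shows "hcomp A a n \<in> Idl\<^bsub>A\<^esub> S"
proof -
  interpret J: ideal "Idl\<^bsub>A\<^esub> S" A by (rule genideal_ideal[OF S])
  define H where "H = {a \<in> carrier A. \<forall>n. hcomp A a n \<in> Idl\<^bsub>A\<^esub> S}"
  have H_add: "a \<oplus> b \<in> H" if "a \<in> H" "b \<in> H" for a b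
    using that by (auto simp: H_def hcomp_add J.a_closed)
  have left: "b \<otimes> a \<in> H" if "a \<in> H" "b \<in> carrier A" for a b
    using that(2)
  proof (induction b rule: homog_induct)
    case (add q b c)
    have "b \<otimes> a \<in> H"
      using that add hcomp_mult_left[OF add(1)] by (auto simp: H_def homog_closed J.I_l_closed)
    then show ?case using that add H_add by (simp add: l_distr homog_closed H_def)
  qed (use that in \<open>auto simp: H_def\<close>)
  have right: "a \<otimes> b \<in> H" if "a \<in> H" "b \<in> carrier A" for a b
    using that(2)
  proof (induction b rule: homog_induct)
    case (add q b c)
    have "a \<otimes> b \<in> H"
      using that add hcomp_mult_right[OF add(1)] by (auto simp: H_def homog_closed J.I_r_closed)
    then show ?case using that add H_add by (simp add: r_distr homog_closed H_def)
  qed (use that in \<open>auto simp: H_def\<close>)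
  have "subgroup H (add_monoid A)"
  proof (rule add.subgroupI)
    show "H \<noteq> {}" using J.zero_closed by (auto simp: H_def intro!: exI[of _ \<zero>])
    show "a \<oplus> b \<in> H" if "a \<in> H" "b \<in> H" for a b using that by (rule H_add)
    show "\<ominus> a \<in> H" if "a \<in> H" for a
      using that by (auto simp: H_def hcomp_minus J.a_inv_closed)
  qed (auto simp: H_def)
  then have "ideal H A"
    using left right by (intro idealI) (auto intro: A.ring_axioms)
  moreover have "S \<subseteq> H" using S hS by (auto simp: H_def)
  ultimately have "Idl\<^bsub>A\<^esub> S \<subseteq> H" by (rule genideal_minimal)
  then show ?thesis using a by (auto simp: H_def)
qed

end

lemma graded_linear_hcomp:
  assumes "graded_algebra K A" "graded_algebra K B" "linear_map K A B f"
    and "\<And>n a. a \<in> homog A n \<Longrightarrow> f a \<in> homog B n" and "a \<in> carrier A"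
  shows "hcomp B (f a) n = f (hcomp A a n)"
proof -
  interpret A: graded_algebra K A by fact
  interpret B: graded_algebra K B by fact
  have z: "f \<zero>\<^bsub>A\<^esub> = \<zero>\<^bsub>B\<^esub>"
    using linear_map_zero[OF assms(3)] A.V.M.abelian_group_axioms B.V.M.abelian_group_axioms by auto
  show ?thesis
    using assms(5)
  proof (rule A.linear_eq_on_homog[rotated -1])
    show "linear_map K A B (\<lambda>a. hcomp B (f a) n)"
      using linear_map_comp[OF assms(3) B.linear_hcomp] .
    show "linear_map K A B (\<lambda>a. f (hcomp A a n))"
      using linear_map_comp[OF A.linear_hcomp assms(3)] .
    show "abelian_group B" by (rule B.V.M.abelian_group_axioms)
    fix m a assume "a \<in> homog A m"
    then show "hcomp B (f a) n = f (hcomp A a n)"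
      using A.hcomp_of_homog[of a m] B.hcomp_of_homog[OF assms(4)[of a m]] z by auto
  qed
qed

section \<open>Generation by homogeneous elements\<close>

text \<open>Generation with the degree recorded: only elements of equal degree are added, so a
  predicate proved by induction may mention the degree, as Koszul signs require. Products grow by
  one generator on the left, the form in which Leibniz rules are applied.\<close>

inductive hgen ::
  "('k, 'm) ring_scheme \<Rightarrow> ('k, 'a, 'n) module_scheme \<Rightarrow> 'x set \<Rightarrow> ('x \<Rightarrow> 'a) \<Rightarrow> ('x \<Rightarrow> int)
    \<Rightarrow> int \<Rightarrow> 'a \<Rightarrow> bool"
  for K A X v deg where
    one: "hgen K A X v deg 0 \<one>\<^bsub>A\<^esub>"
  | zero: "hgen K A X v deg n \<zero>\<^bsub>A\<^esub>"
  | mult: "\<lbrakk>\<alpha> \<in> X; hgen K A X v deg n a\<rbrakk> \<Longrightarrow> hgen K A X v deg (deg \<alpha> + n) (v \<alpha> \<otimes>\<^bsub>A\<^esub> a)"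
  | add: "\<lbrakk>hgen K A X v deg n a; hgen K A X v deg n b\<rbrakk> \<Longrightarrow> hgen K A X v deg n (a \<oplus>\<^bsub>A\<^esub> b)"
  | smult: "\<lbrakk>c \<in> carrier K; hgen K A X v deg n a\<rbrakk> \<Longrightarrow> hgen K A X v deg n (c \<odot>\<^bsub>A\<^esub> a)"

definition graded_generated ::
  "('k, 'm) ring_scheme \<Rightarrow> ('k, 'a, 'n) galg_scheme \<Rightarrow> 'x set \<Rightarrow> ('x \<Rightarrow> 'a) \<Rightarrow> ('x \<Rightarrow> int)
    \<Rightarrow> bool" where
  "graded_generated K A X v deg \<longleftrightarrow>
     (\<forall>\<alpha>\<in>X. v \<alpha> \<in> homog A (deg \<alpha>)) \<and> (\<forall>n. \<forall>a\<in>homog A n. hgen K A X v deg n a)"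

lemma graded_generated_homog:
  "graded_generated K A X v deg \<Longrightarrow> \<alpha> \<in> X \<Longrightarrow> v \<alpha> \<in> homog A (deg \<alpha>)"
  by (simp add: graded_generated_def)

lemma graded_generated_induct [consumes 3, case_names one zero mult add smult]:
  assumes "graded_algebra K A" "graded_generated K A X v deg" "a \<in> homog A n"
    and "P 0 \<one>\<^bsub>A\<^esub>" "\<And>n. P n \<zero>\<^bsub>A\<^esub>"
    and "\<And>\<alpha> n a. \<lbrakk>\<alpha> \<in> X; v \<alpha> \<in> homog A (deg \<alpha>); a \<in> homog A n; P n a\<rbrakk> \<Longrightarrow>
      P (deg \<alpha> + n) (v \<alpha> \<otimes>\<^bsub>A\<^esub> a)"
    and "\<And>n a b. \<lbrakk>a \<in> homog A n; b \<in> homog A n; P n a; P n b\<rbrakk> \<Longrightarrow> P n (a \<oplus>\<^bsub>A\<^esub> b)"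
    and "\<And>n c a. \<lbrakk>c \<in> carrier K; a \<in> homog A n; P n a\<rbrakk> \<Longrightarrow> P n (c \<odot>\<^bsub>A\<^esub> a)"
  shows "P n a"
proof -
  interpret graded_algebra K A by fact
  have "hgen K A X v deg n a" and v: "\<And>\<alpha>. \<alpha> \<in> X \<Longrightarrow> v \<alpha> \<in> homog A (deg \<alpha>)"
    using assms(2,3) by (auto simp: graded_generated_def)
  from this(1) have "a \<in> homog A n \<and> P n a"
    by induction
      (auto intro: assms(4-) v one_homog homog_zero mult_homog homog_add homog_smult)
  then show ?thesis ..
qed

text \<open>The maps form families indexed by the degree because a commutator with an element of
  degree p has sign exponent p * n on degree n; no single linear map without grading would express
  it.\<close>

lemma graded_generated_linear_eq:
  assumes A: "graded_algebra K A" "graded_generated K A X v deg" and "abelian_group B"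
    and f: "\<And>n. linear_map K A B (f n)" and g: "\<And>n. linear_map K A B (g n)"
    and one: "f 0 \<one>\<^bsub>A\<^esub> = g 0 \<one>\<^bsub>A\<^esub>"
    and mult: "\<And>\<alpha> n a. \<lbrakk>\<alpha> \<in> X; v \<alpha> \<in> homog A (deg \<alpha>); a \<in> homog A n; f n a = g n a\<rbrakk> \<Longrightarrow>
      f (deg \<alpha> + n) (v \<alpha> \<otimes>\<^bsub>A\<^esub> a) = g (deg \<alpha> + n) (v \<alpha> \<otimes>\<^bsub>A\<^esub> a)"
    and a: "a \<in> homog A n"
  shows "f n a = g n a"
proof -
  interpret A: graded_algebra K A by fact
  note ag = A.V.M.abelian_group_axioms assms(3)
  from A a show ?thesis
  proof (induction rule: graded_generated_induct)
    case (zero n)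
    then show ?case by (simp add: linear_map_zero[OF f ag] linear_map_zero[OF g ag])
  next
    case (add n a b)
    then show ?case by (simp add: linear_map_add[OF f] linear_map_add[OF g] A.homog_closed)
  next
    case (smult n c a)
    then show ?case by (simp add: linear_map_smult[OF f] linear_map_smult[OF g] A.homog_closed)
  qed (fact one mult)+
qed

lemma hgen_record_cong:
  assumes "hgen K A X v deg n a"
    and "\<zero>\<^bsub>B\<^esub> = \<zero>\<^bsub>A\<^esub>" "add B = add A" "monoid.mult B = monoid.mult A" "\<one>\<^bsub>B\<^esub> = \<one>\<^bsub>A\<^esub>" "smult B = smult A"
  shows "hgen K B X v deg n a"
  using assms(1)
proof induction
  case one
  then show ?case using hgen.one[where A = B and K = K and X = X and v = v and deg = deg] assms(2-) by simp
next
  case (zero n)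
  then show ?case using hgen.zero[where A = B and K = K and X = X and v = v and deg = deg] assms(2-) by simp
next
  case (mult \<alpha> n a)
  then show ?case using hgen.mult[where A = B and K = K and X = X and v = v and deg = deg] assms(2-) by simp
next
  case (add n a b)
  then show ?case using hgen.add[where A = B and K = K and X = X and v = v and deg = deg] assms(2-) by simp
next
  case (smult c n a)
  then show ?case using hgen.smult[where A = B and K = K and X = X and v = v and deg = deg] assms(2-) by simp
qed

lemma graded_generated_record_cong:
  assumes "graded_generated K A X v deg"
    and "\<zero>\<^bsub>B\<^esub> = \<zero>\<^bsub>A\<^esub>" "add B = add A" "monoid.mult B = monoid.mult A" "\<one>\<^bsub>B\<^esub> = \<one>\<^bsub>A\<^esub>" "smult B = smult A"
    and "homog B = homog A"
  shows "graded_generated K B X v deg"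
  using assms(1,7) hgen_record_cong[OF _ assms(2-6), of K X v deg]
  by (auto simp: graded_generated_def)

lemma alg_hom_eq_on_generators:
  assumes "graded_algebra K A" "graded_generated K A X v deg" "k_algebra K B"
    and "alg_hom K A B f" "alg_hom K A B g"
    and "\<And>\<alpha>. \<alpha> \<in> X \<Longrightarrow> f (v \<alpha>) = g (v \<alpha>)" and "a \<in> carrier A"
  shows "f a = g a"
proof -
  interpret A: graded_algebra K A by fact
  interpret B: k_algebra K B by fact
  note ag = A.V.M.abelian_group_axioms B.V.M.abelian_group_axioms
  note f = alg_hom_linear[OF assms(4)] and g = alg_hom_linear[OF assms(5)]
  show ?thesis
  proof (rule A.linear_eq_on_homog[OF f g ag(2) _ assms(7)])
    show "f a = g a" if "a \<in> homog A n" for n a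
    proof (rule graded_generated_linear_eq[OF assms(1,2) ag(2) f g _ _ that], goal_cases one mult)
      case one
      then show ?case by (simp add: alg_hom_one[OF assms(4)] alg_hom_one[OF assms(5)])
    next
      case (mult \<alpha> n a)
      then show ?case
        by (simp add: alg_hom_mult[OF assms(4)] alg_hom_mult[OF assms(5)] A.homog_closed assms(6))
    qed
  qed
qed

lemma graded_generated_image:
  assumes "graded_algebra K A" "graded_generated K A X v deg" "alg_hom K A B f" "k_algebra K B"
    and "\<And>n. homog B n = f ` homog A n"
  shows "graded_generated K B X (\<lambda>\<alpha>. f (v \<alpha>)) deg"
proof -
  interpret A: graded_algebra K A by fact
  interpret B: k_algebra K B by fact
  note f = alg_hom_linear[OF assms(3)]
  note f0 = linear_map_zero[OF f A.V.M.abelian_group_axioms B.V.M.abelian_group_axioms]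
  have "hgen K B X (\<lambda>\<alpha>. f (v \<alpha>)) deg n (f a)" if "a \<in> homog A n" for n a
    using assms(1,2) that
  proof (induction rule: graded_generated_induct)
    case one
    then show ?case by (simp add: alg_hom_one[OF assms(3)] hgen.one)
  next
    case (zero n)
    then show ?case by (simp add: f0 hgen.zero)
  next
    case (mult \<alpha> n a)
    then show ?case
      using hgen.mult[where v = "\<lambda>\<alpha>. f (v \<alpha>)"]
      by (simp add: alg_hom_mult[OF assms(3)] A.homog_closed)
  next
    case (add n a b)
    then show ?case by (simp add: linear_map_add[OF f] A.homog_closed hgen.add)
  next
    case (smult n c a)
    then show ?case by (simp add: linear_map_smult[OF f] A.homog_closed hgen.smult)
  qed
  then show ?thesis
    using assms(2,5) by (auto simp: graded_generated_def)
qed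

section \<open>Quotients of graded algebras\<close>

lemma quot_galg_simps [simp]:
  "carrier (quot_galg A I) = a_rcosets\<^bsub>A\<^esub> I"
  "monoid.mult (quot_galg A I) = rcoset_mult A I"
  "\<one>\<^bsub>quot_galg A I\<^esub> = I +>\<^bsub>A\<^esub> \<one>\<^bsub>A\<^esub>"
  "\<zero>\<^bsub>quot_galg A I\<^esub> = I"
  "add (quot_galg A I) = set_add A"
  "smult (quot_galg A I) = (\<lambda>c. induced_map A I (\<lambda>a. c \<odot>\<^bsub>A\<^esub> a))"
  "homog (quot_galg A I) = (\<lambda>n. (\<lambda>a. I +>\<^bsub>A\<^esub> a) ` homog A n)"
  by (simp_all add: quot_galg_def FactRing_def)

lemma rcosets_image: "a_rcosets\<^bsub>A\<^esub> I = (\<lambda>a. I +>\<^bsub>A\<^esub> a) ` carrier A"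
  by (auto simp: A_RCOSETS_def RCOSETS_def a_r_coset_def)

lemma (in ring) minus_eq_zero_iff:
  "\<lbrakk>a \<in> carrier R; b \<in> carrier R\<rbrakk> \<Longrightarrow> a \<ominus> b = \<zero> \<longleftrightarrow> a = b"
  by (metis a_minus_def minus_equality minus_minus r_neg a_inv_closed)

context ideal
begin

lemma coset_eq_iff: "\<lbrakk>a \<in> carrier R; b \<in> carrier R\<rbrakk> \<Longrightarrow> I +> a = I +> b \<longleftrightarrow> a \<ominus> b \<in> I"
  using quotient_eq_iff_same_a_r_cos[OF is_ideal] by metis

lemma coset_zero: "I +> \<zero> = I"
  using a_rcos_const[OF additive_subgroup.zero_closed[OF is_additive_subgroup]] .

lemma coset_eq_zero_iff: "a \<in> carrier R \<Longrightarrow> I +> a = I \<longleftrightarrow> a \<in> I"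
  using coset_eq_iff[of a \<zero>] by (simp add: coset_zero a_minus_def)

lemma mem_coset_iff: "\<lbrakk>a \<in> carrier R\<rbrakk> \<Longrightarrow> b \<in> I +> a \<longleftrightarrow> b \<in> carrier R \<and> b \<ominus> a \<in> I"
  using a_rcos_module_minus[OF ring_axioms, of a b] a_elemrcos_carrier[of a b] by blast

end

text \<open>All representatives of the class are sent to the same coset, and there is at least one,
  so the union in \<open>induced_map\<close> collapses.\<close>

lemma induced_map_coset:
  assumes "ideal I A" "ideal J B" "linear_map K A B g" "\<And>a. a \<in> I \<Longrightarrow> g a \<in> J" "a \<in> carrier A"
  shows "induced_map B J g (I +>\<^bsub>A\<^esub> a) = J +>\<^bsub>B\<^esub> g a"
proof -
  interpret I: ideal I A by fact
  interpret J: ideal J B by fact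
  note ag = I.is_abelian_group J.is_abelian_group
  have "J +>\<^bsub>B\<^esub> g b = J +>\<^bsub>B\<^esub> g a" if "b \<in> I +>\<^bsub>A\<^esub> a" for b
  proof -
    have b: "b \<in> carrier A" "b \<ominus>\<^bsub>A\<^esub> a \<in> I"
      using that assms(5) by (auto simp: I.mem_coset_iff)
    have "g (b \<ominus>\<^bsub>A\<^esub> a) = g b \<ominus>\<^bsub>B\<^esub> g a"
      using b(1) assms(5) linear_map_minus[OF assms(3) ag] linear_map_add[OF assms(3)]
      by (simp add: a_minus_def)
    then show ?thesis
      using assms(4)[OF b(2)] b(1) assms(5) linear_map_closed[OF assms(3)]
      by (simp add: J.coset_eq_iff)
  qed
  then have "(\<Union>b\<in>I +>\<^bsub>A\<^esub> a. J +>\<^bsub>B\<^esub> g b) = (\<Union>b\<in>I +>\<^bsub>A\<^esub> a. J +>\<^bsub>B\<^esub> g a)"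
    by (rule SUP_cong[OF refl])
  moreover have "I +>\<^bsub>A\<^esub> a \<noteq> {}" using I.a_rcos_self[OF assms(5)] by blast
  ultimately show ?thesis by (simp add: induced_map_def)
qed

text \<open>Since c a = (c 1) a, ring ideals of an algebra are subspaces.\<close>

lemma ideal_smult:
  assumes "k_algebra K A" "ideal I A" "c \<in> carrier K" "a \<in> I"
  shows "c \<odot>\<^bsub>A\<^esub> a \<in> I"
proof -
  interpret A: k_algebra K A by fact
  interpret I: ideal I A by fact
  have "c \<odot>\<^bsub>A\<^esub> a = (c \<odot>\<^bsub>A\<^esub> \<one>\<^bsub>A\<^esub>) \<otimes>\<^bsub>A\<^esub> a"
    using assms(3,4) I.Icarr by (simp add: A.smult_mult_left)
  then show ?thesis using assms(3,4) I.I_l_closed by simp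
qed

lemma quot_smult:
  assumes "k_algebra K A" "ideal I A" "c \<in> carrier K" "a \<in> carrier A"
  shows "induced_map A I (\<lambda>a. c \<odot>\<^bsub>A\<^esub> a) (I +>\<^bsub>A\<^esub> a) = I +>\<^bsub>A\<^esub> (c \<odot>\<^bsub>A\<^esub> a)"
proof -
  interpret A: k_algebra K A by fact
  show ?thesis
  proof (rule induced_map_coset[OF assms(2,2)])
    show "linear_map K A A (\<lambda>a. c \<odot>\<^bsub>A\<^esub> a)"
      using assms(3)
      by (intro linear_mapI) (auto simp: A.V.smult_r_distr A.V.R.m_comm simp flip: A.V.smult_assoc1)
  qed (use assms ideal_smult[OF assms(1-3)] in auto)
qed

lemma quot_k_algebra:
  assumes "k_algebra K A" "ideal I A"
  shows "k_algebra K (quot_galg A I)" and "alg_hom K A (quot_galg A I) (\<lambda>a. I +>\<^bsub>A\<^esub> a)"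
proof -
  interpret A: k_algebra K A by fact
  interpret I: ideal I A by fact
  interpret Q: ring "A Quot I" by (rule I.quotient_is_ring)
  have Qsimps: "carrier (A Quot I) = a_rcosets\<^bsub>A\<^esub> I" "add (A Quot I) = set_add A"
    "monoid.mult (A Quot I) = rcoset_mult A I" "\<one>\<^bsub>A Quot I\<^esub> = I +>\<^bsub>A\<^esub> \<one>\<^bsub>A\<^esub>" "\<zero>\<^bsub>A Quot I\<^esub> = I"
    by (simp_all add: FactRing_def)
  have ag: "abelian_group (quot_galg A I)"
    by (rule abelian_group_record_cong[OF Q.is_abelian_group]) (simp_all add: Qsimps)
  have "monoid (quot_galg A I)"
    using Q.m_closed[unfolded Qsimps] Q.one_closed[unfolded Qsimps]
    by (intro monoidI)
      (simp_all add: Q.m_assoc[unfolded Qsimps] Q.l_one[unfolded Qsimps] Q.r_one[unfolded Qsimps])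
  then have rg: "ring (quot_galg A I)"
    using ag
    by (intro ringI) (simp_all add: Q.l_distr[unfolded Qsimps] Q.r_distr[unfolded Qsimps])
  note sm = quot_smult[OF assms]
  have md: "module K (quot_galg A I)"
    using A.V.R.cring_axioms ag
    by (intro moduleI)
      (auto simp: rcosets_image sm I.a_rcos_sum A.V.smult_l_distr A.V.smult_r_distr A.V.smult_assoc1)
  show "k_algebra K (quot_galg A I)"
    using rg md
    by (intro k_algebra.intro k_algebra_axioms.intro)
      (auto simp: rcosets_image sm I.rcoset_mult_add A.smult_mult_left A.smult_mult_right)
  show "alg_hom K A (quot_galg A I) (\<lambda>a. I +>\<^bsub>A\<^esub> a)"
    by (intro alg_homI linear_mapI)
      (auto simp: rcosets_image sm I.rcoset_mult_add I.a_rcos_sum)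
qed

text \<open>Homogeneity of the ideal makes the decomposition in the quotient unique: a decomposition
  of the class of \<open>a\<close> lifts to one of some \<open>c\<close> in the same class, and the
  components of c - a lie in I.\<close>

lemma quot_graded_algebra:
  assumes "graded_algebra K A" "ideal I A" and hI: "\<And>a n. a \<in> I \<Longrightarrow> hcomp A a n \<in> I"
  shows "graded_algebra K (quot_galg A I)"
proof -
  interpret A: graded_algebra K A by fact
  interpret I: ideal I A by fact
  let ?Q = "quot_galg A I"
  interpret Q: k_algebra K ?Q
    by (rule quot_k_algebra(1)[OF A.k_algebra_axioms assms(2)])
  note hom = quot_k_algebra(2)[OF A.k_algebra_axioms assms(2)]
  note lin = alg_hom_linear[OF hom]
  note ag = A.V.M.abelian_group_axioms Q.V.M.abelian_group_axioms
  have zero: "I +>\<^bsub>A\<^esub> \<zero>\<^bsub>A\<^esub> = I" by (rule I.coset_zero)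
  have sub: "submodule (homog ?Q n) K ?Q" for n
  proof (rule Q.V.submoduleI)
    show "homog ?Q n \<subseteq> carrier ?Q"
      by (auto simp: rcosets_image A.homog_closed)
    show "\<zero>\<^bsub>?Q\<^esub> \<in> homog ?Q n"
      using A.homog_zero[of n] by (auto simp: zero intro!: image_eqI[where x = "\<zero>\<^bsub>A\<^esub>"])
    fix a assume a: "a \<in> homog ?Q n"
    then obtain a' where a': "a' \<in> homog A n" "a = I +>\<^bsub>A\<^esub> a'" by auto
    show "\<ominus>\<^bsub>?Q\<^esub> a \<in> homog ?Q n"
      using linear_map_minus[OF lin ag, of a'] a' A.homog_minus[of a' n]
      by (auto simp: A.homog_closed intro!: image_eqI[where x = "\<ominus>\<^bsub>A\<^esub> a'"])
    show "c \<odot>\<^bsub>?Q\<^esub> a \<in> homog ?Q n" if "c \<in> carrier K" for c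
      using linear_map_smult[OF lin that, of a'] a' A.homog_smult[OF that, of a' n]
      by (auto simp: A.homog_closed intro!: image_eqI[where x = "c \<odot>\<^bsub>A\<^esub> a'"])
    fix b assume b: "b \<in> homog ?Q n"
    then obtain b' where b': "b' \<in> homog A n" "b = I +>\<^bsub>A\<^esub> b'" by auto
    show "a \<oplus>\<^bsub>?Q\<^esub> b \<in> homog ?Q n"
      using linear_map_add[OF lin, of a' b'] a' b' A.homog_add[of a' n b']
      by (auto simp: A.homog_closed intro!: image_eqI[where x = "a' \<oplus>\<^bsub>A\<^esub> b'"])
  qed
  have decomp: "homog_decomp ?Q (I +>\<^bsub>A\<^esub> a) (\<lambda>n. I +>\<^bsub>A\<^esub> hcomp A a n)" if a: "a \<in> carrier A" for a
  proof -
    have sub: "{n. I +>\<^bsub>A\<^esub> hcomp A a n \<noteq> I} \<subseteq> {n. hcomp A a n \<noteq> \<zero>\<^bsub>A\<^esub>}"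
      by (auto simp: zero)
    have "I +>\<^bsub>A\<^esub> a = I +>\<^bsub>A\<^esub> (\<Oplus>\<^bsub>A\<^esub>n\<in>{n. hcomp A a n \<noteq> \<zero>\<^bsub>A\<^esub>}. hcomp A a n)"
      using A.hcomp_sum[OF a] by simp
    also have "\<dots> = (\<Oplus>\<^bsub>?Q\<^esub>n\<in>{n. hcomp A a n \<noteq> \<zero>\<^bsub>A\<^esub>}. I +>\<^bsub>A\<^esub> hcomp A a n)"
      using a by (intro linear_map_finsum[OF lin ag]) auto
    also have "\<dots> = (\<Oplus>\<^bsub>?Q\<^esub>n\<in>{n. I +>\<^bsub>A\<^esub> hcomp A a n \<noteq> I}. I +>\<^bsub>A\<^esub> hcomp A a n)"
      using a sub A.hcomp_finite[OF a]
      by (intro Q.V.M.add.finprod_mono_neutral_cong_right) (auto simp: rcosets_image)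
    finally show ?thesis
      using a finite_subset[OF sub A.hcomp_finite[OF a]]
      by (auto simp: homog_decomp_def A.hcomp_homog)
  qed
  have ds: "\<exists>!f. homog_decomp ?Q b f" if "b \<in> carrier ?Q" for b
  proof -
    obtain a where a: "a \<in> carrier A" "b = I +>\<^bsub>A\<^esub> a"
      using \<open>b \<in> carrier ?Q\<close> by (auto simp: rcosets_image)
    have "f = (\<lambda>n. I +>\<^bsub>A\<^esub> hcomp A a n)" if f: "homog_decomp ?Q b f" for f
    proof
      fix m
      \<comment> \<open>The zero class is lifted to zero itself, so the lifted family has the same
        finite support as \<open>f\<close>.\<close>
      have "\<exists>c. c \<in> homog A n \<and> f n = I +>\<^bsub>A\<^esub> c \<and> (f n = I \<longrightarrow> c = \<zero>\<^bsub>A\<^esub>)" for n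
      proof (cases "f n = I")
        case True
        then show ?thesis using A.homog_zero[of n] by (intro exI[of _ "\<zero>\<^bsub>A\<^esub>"]) (simp add: zero)
      next
        case False
        moreover have "f n \<in> homog ?Q n" using f by (simp add: homog_decomp_def)
        ultimately show ?thesis by auto
      qed
      then obtain g where g: "\<And>n. g n \<in> homog A n" "\<And>n. f n = I +>\<^bsub>A\<^esub> g n"
        "\<And>n. f n = I \<Longrightarrow> g n = \<zero>\<^bsub>A\<^esub>" by metis
      have supp: "{n. f n \<noteq> I} = {n. g n \<noteq> \<zero>\<^bsub>A\<^esub>}"
      proof (rule Collect_cong)
        show "f n \<noteq> I \<longleftrightarrow> g n \<noteq> \<zero>\<^bsub>A\<^esub>" for n
          using g(2)[of n] g(3)[of n] by (cases "g n = \<zero>\<^bsub>A\<^esub>") (auto simp: zero)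
      qed
      define c where "c = (\<Oplus>\<^bsub>A\<^esub>n\<in>{n. g n \<noteq> \<zero>\<^bsub>A\<^esub>}. g n)"
      have c: "c \<in> carrier A"
        unfolding c_def using g A.homog_closed by (intro A.finsum_closed) blast
      have "homog_decomp A c g"
        using g(1) f supp by (simp add: homog_decomp_def c_def)
      then have gc: "hcomp A c = g" by (rule A.hcomp_eqI[OF c])
      have "I +>\<^bsub>A\<^esub> c = (\<Oplus>\<^bsub>?Q\<^esub>n\<in>{n. g n \<noteq> \<zero>\<^bsub>A\<^esub>}. I +>\<^bsub>A\<^esub> g n)"
        unfolding c_def using g(1) A.homog_closed by (intro linear_map_finsum[OF lin ag]) blast
      also have "\<dots> = I +>\<^bsub>A\<^esub> a"
        using f a(2) supp by (simp add: homog_decomp_def flip: g(2))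
      finally have "c \<ominus>\<^bsub>A\<^esub> a \<in> I" using a(1) c by (simp add: I.coset_eq_iff)
      then have "hcomp A (c \<ominus>\<^bsub>A\<^esub> a) m \<in> I" by (rule hI)
      then have "g m \<ominus>\<^bsub>A\<^esub> hcomp A a m \<in> I"
        using a(1) c gc by (simp add: a_minus_def A.hcomp_add A.hcomp_minus)
      then show "f m = I +>\<^bsub>A\<^esub> hcomp A a m"
        using g(1)[of m] a(1) by (simp add: g(2) I.coset_eq_iff A.homog_closed)
    qed
    then show ?thesis using decomp[OF a(1)] a(2) by blast
  qed
  have one: "\<one>\<^bsub>?Q\<^esub> \<in> homog ?Q 0" using A.one_homog by simp
  have mult: "a \<otimes>\<^bsub>?Q\<^esub> b \<in> homog ?Q (p + q)"
    if "a \<in> homog ?Q p" "b \<in> homog ?Q q" for a b p q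
    using that by (auto simp: I.rcoset_mult_add A.homog_closed A.mult_homog)
  show ?thesis
    by (intro graded_algebra.intro Q.k_algebra_axioms graded_algebra_axioms.intro)
      (fact sub ds one mult)+
qed

lemma quot_graded_generated:
  assumes "graded_algebra K A" "ideal I A" "graded_generated K A X v deg"
  shows "graded_generated K (quot_galg A I) X (\<lambda>\<alpha>. I +>\<^bsub>A\<^esub> v \<alpha>) deg"
proof -
  interpret A: graded_algebra K A by fact
  show ?thesis
    using graded_generated_image[OF assms(1,3) quot_k_algebra(2,1)[OF A.k_algebra_axioms assms(2)]]
    by simp
qed

lemma quot_lift:
  assumes "k_algebra K A" "k_algebra K B" "ideal I A" "alg_hom K A B f"
    and "\<And>a. a \<in> I \<Longrightarrow> f a = \<zero>\<^bsub>B\<^esub>"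
  obtains g where "alg_hom K (quot_galg A I) B g" "\<And>a. a \<in> carrier A \<Longrightarrow> g (I +>\<^bsub>A\<^esub> a) = f a"
proof -
  interpret A: k_algebra K A by fact
  interpret B: k_algebra K B by fact
  interpret I: ideal I A by fact
  note lin = alg_hom_linear[OF assms(4)]
  note ag = A.V.M.abelian_group_axioms B.V.M.abelian_group_axioms
  \<comment> \<open>Any representative will do: two of them differ by an element of I, which
    \<open>f\<close> kills.\<close>
  define g where "g X = f (SOME b. b \<in> X)" for X
  have g: "g (I +>\<^bsub>A\<^esub> a) = f a" if a: "a \<in> carrier A" for a
  proof -
    define b where "b = (SOME b. b \<in> I +>\<^bsub>A\<^esub> a)"
    have "b \<in> I +>\<^bsub>A\<^esub> a" unfolding b_def using I.a_rcos_self[OF a] by (rule someI)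
    then have b: "b \<in> carrier A" "b \<ominus>\<^bsub>A\<^esub> a \<in> I" using a by (auto simp: I.mem_coset_iff)
    have "f b \<ominus>\<^bsub>B\<^esub> f a = \<zero>\<^bsub>B\<^esub>"
      using assms(5)[OF b(2)] a b(1) linear_map_minus[OF lin ag] linear_map_add[OF lin]
      by (simp add: a_minus_def)
    then show ?thesis
      using a b(1) linear_map_closed[OF lin] B.minus_eq_zero_iff by (simp add: g_def flip: b_def)
  qed
  have "alg_hom K (quot_galg A I) B g"
    using linear_map_closed[OF lin] alg_hom_add[OF assms(4)] alg_hom_smult[OF assms(4)]
      alg_hom_mult[OF assms(4)] alg_hom_one[OF assms(4)]
    by (intro alg_homI linear_mapI)
      (auto simp: rcosets_image g I.a_rcos_sum I.rcoset_mult_add quot_smult[OF assms(1,3)])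
  then show ?thesis using g that by blast
qed

text \<open>The kernel is an ideal containing \<open>S\<close>, hence contains the ideal generated
  by \<open>S\<close>.\<close>

lemma alg_hom_genideal:
  assumes "k_algebra K A" "k_algebra K B" "alg_hom K A B f" "S \<subseteq> carrier A"
    and "\<And>s. s \<in> S \<Longrightarrow> f s = \<zero>\<^bsub>B\<^esub>" and "a \<in> Idl\<^bsub>A\<^esub> S"
  shows "f a = \<zero>\<^bsub>B\<^esub>"
proof -
  interpret A: k_algebra K A by fact
  interpret B: k_algebra K B by fact
  interpret f: ring_hom_ring A B f
    using assms(3) by (intro ring_hom_ringI2 A.A.ring_axioms B.A.ring_axioms) (simp add: alg_hom_def)
  have "Idl\<^bsub>A\<^esub> S \<subseteq> a_kernel A B f"
    using assms(4,5) by (intro A.genideal_minimal f.kernel_is_ideal) (unfold a_kernel_def', blast)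
  then have "a \<in> a_kernel A B f" using assms(6) by blast
  then show ?thesis unfolding a_kernel_def' by blast
qed

section \<open>The free graded algebra\<close>

definition mon :: "('k, 'm) ring_scheme \<Rightarrow> 'x list \<Rightarrow> 'x list \<Rightarrow> 'k" where
  "mon K w = (\<lambda>u. if u = w then \<one>\<^bsub>K\<^esub> else \<zero>\<^bsub>K\<^esub>)"

text \<open>The product of \<open>free_galg\<close> as a sum over all cuts of a word, detached from
  the generating set and the degrees so that identities about it can be stated once.\<close>

definition conv ::
  "('k, 'm) ring_scheme \<Rightarrow> ('x list \<Rightarrow> 'k) \<Rightarrow> ('x list \<Rightarrow> 'k) \<Rightarrow> 'x list \<Rightarrow> 'k" where
  "conv K f g w = (\<Oplus>\<^bsub>K\<^esub>i\<in>{..length w}. f (take i w) \<otimes>\<^bsub>K\<^esub> g (drop i w))"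

text \<open>One notion for both the carrier (W all words over X) and the graded parts (W the words
  of a given degree).\<close>

definition fsupp :: "('k, 'm) ring_scheme \<Rightarrow> 'x list set \<Rightarrow> ('x list \<Rightarrow> 'k) set" where
  "fsupp K W = {f. (\<forall>w. f w \<in> carrier K) \<and> finite {w. f w \<noteq> \<zero>\<^bsub>K\<^esub>} \<and>
     (\<forall>w. f w \<noteq> \<zero>\<^bsub>K\<^esub> \<longrightarrow> w \<in> W)}"

definition words :: "'x set \<Rightarrow> ('x \<Rightarrow> int) \<Rightarrow> int \<Rightarrow> 'x list set" where
  "words X deg n = {w \<in> lists X. sum_list (map deg w) = n}"

lemma free_galg_simps:
  "carrier (free_galg K X deg) = fsupp K (lists X)"
  "monoid.mult (free_galg K X deg) = conv K"
  "\<one>\<^bsub>free_galg K X deg\<^esub> = mon K []"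
  "\<zero>\<^bsub>free_galg K X deg\<^esub> = (\<lambda>w. \<zero>\<^bsub>K\<^esub>)"
  "add (free_galg K X deg) = (\<lambda>f g w. f w \<oplus>\<^bsub>K\<^esub> g w)"
  "smult (free_galg K X deg) = (\<lambda>c f w. c \<otimes>\<^bsub>K\<^esub> f w)"
  "homog (free_galg K X deg) = (\<lambda>n. fsupp K (words X deg n))"
  by (auto simp: free_galg_def Let_def fsupp_def conv_def mon_def words_def fun_eq_iff)

lemma free_gen_mon: "free_gen K x = mon K [x]"
  by (simp add: free_gen_def mon_def)

text \<open>K as a module over itself, which makes evaluation at a word a \<open>linear_map\<close>
  and coefficients admissible in \<open>linear_map_supp_sum\<close>.\<close>

definition self_module :: "('k, 'm) ring_scheme \<Rightarrow> ('k, 'k) module" where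
  "self_module K = \<lparr>carrier = carrier K, monoid.mult = monoid.mult K, one = \<one>\<^bsub>K\<^esub>,
     zero = \<zero>\<^bsub>K\<^esub>, add = add K, smult = monoid.mult K\<rparr>"

lemma self_module_simps [simp]:
  "carrier (self_module K) = carrier K" "\<zero>\<^bsub>self_module K\<^esub> = \<zero>\<^bsub>K\<^esub>"
  "add (self_module K) = add K" "smult (self_module K) = monoid.mult K"
  by (simp_all add: self_module_def)

lemma (in cring) self_module: "module R (self_module R)"
  using abelian_group_record_cong[OF is_abelian_group, of "self_module R"]
  by (intro moduleI) (auto simp: l_distr r_distr m_assoc is_cring)

context cring
begin

lemma fsupp_mono: "W \<subseteq> W' \<Longrightarrow> f \<in> fsupp R W \<Longrightarrow> f \<in> fsupp R W'"
  by (auto simp: fsupp_def)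

lemma fsuppD: "f \<in> fsupp R W \<Longrightarrow> f w \<in> carrier R" "f \<in> fsupp R W \<Longrightarrow> finite {w. f w \<noteq> \<zero>}"
  "f \<in> fsupp R W \<Longrightarrow> f w \<noteq> \<zero> \<Longrightarrow> w \<in> W"
  by (auto simp: fsupp_def)

lemma fsupp_zero: "(\<lambda>w. \<zero>) \<in> fsupp R W"
  by (simp add: fsupp_def)

lemma fsupp_add:
  assumes "f \<in> fsupp R W" "g \<in> fsupp R W"
  shows "(\<lambda>w. f w \<oplus> g w) \<in> fsupp R W"
proof -
  have "{w. f w \<oplus> g w \<noteq> \<zero>} \<subseteq> {w. f w \<noteq> \<zero>} \<union> {w. g w \<noteq> \<zero>}"
    using fsuppD(1)[OF assms(1)] by auto
  then have "finite {w. f w \<oplus> g w \<noteq> \<zero>}"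
    using fsuppD(2)[OF assms(1)] fsuppD(2)[OF assms(2)] finite_subset by blast
  moreover have "w \<in> W" if "f w \<oplus> g w \<noteq> \<zero>" for w
    using that fsuppD(3)[OF assms(1), of w] fsuppD(3)[OF assms(2), of w] fsuppD(1)[OF assms(2), of w]
    by (cases "f w = \<zero>") auto
  ultimately show ?thesis
    using fsuppD(1)[OF assms(1)] fsuppD(1)[OF assms(2)] by (auto simp: fsupp_def)
qed

lemma fsupp_minus: "f \<in> fsupp R W \<Longrightarrow> (\<lambda>w. \<ominus> f w) \<in> fsupp R W"
proof -
  assume f: "f \<in> fsupp R W"
  then have "\<ominus> f w = \<zero> \<longleftrightarrow> f w = \<zero>" for w
    using fsuppD(1)[OF f, of w] by (metis minus_minus minus_zero)
  then show ?thesis using f by (simp add: fsupp_def)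
qed

lemma fsupp_smult: "c \<in> carrier R \<Longrightarrow> f \<in> fsupp R W \<Longrightarrow> (\<lambda>w. c \<otimes> f w) \<in> fsupp R W"
proof -
  assume c: "c \<in> carrier R" and f: "f \<in> fsupp R W"
  have sub: "{w. c \<otimes> f w \<noteq> \<zero>} \<subseteq> {w. f w \<noteq> \<zero>}" using c by auto
  then have "finite {w. c \<otimes> f w \<noteq> \<zero>}"
    using fsuppD(2)[OF f] finite_subset by blast
  then show ?thesis using c f sub by (auto simp: fsupp_def)
qed

lemma mon_fsupp: "w \<in> W \<Longrightarrow> mon R w \<in> fsupp R W"
  by (auto simp: fsupp_def mon_def intro: finite_subset[of _ "{w}"])

text \<open>A word in the support of the product splits into words from the two supports. Keeping
  three word sets apart yields closure of the carrier and additivity of degrees from the same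
  argument.\<close>

lemma conv_fsupp:
  assumes f: "f \<in> fsupp R W" and g: "g \<in> fsupp R W'"
    and W: "\<And>u v. u \<in> W \<Longrightarrow> v \<in> W' \<Longrightarrow> u @ v \<in> W''"
  shows "conv R f g \<in> fsupp R W''"
proof -
  note [simp] = fsuppD(1)[OF f] fsuppD(1)[OF g]
  have sub: "\<exists>u v. w = u @ v \<and> f u \<noteq> \<zero> \<and> g v \<noteq> \<zero>" if w: "conv R f g w \<noteq> \<zero>" for w
  proof (rule ccontr)
    assume "\<not> ?thesis"
    then have "f (take i w) = \<zero> \<or> g (drop i w) = \<zero>" for i
      by (metis append_take_drop_id)
    then have "f (take i w) \<otimes> g (drop i w) = \<zero>" for i
      using fsuppD(1)[OF f] fsuppD(1)[OF g] l_null r_null by metis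
    then show False using w by (simp add: conv_def)
  qed
  have "{w. conv R f g w \<noteq> \<zero>} \<subseteq> (\<lambda>(u, v). u @ v) ` ({w. f w \<noteq> \<zero>} \<times> {w. g w \<noteq> \<zero>})"
    using sub by force
  moreover have "finite ({w. f w \<noteq> \<zero>} \<times> {w. g w \<noteq> \<zero>})"
    using fsuppD(2)[OF f] fsuppD(2)[OF g] by simp
  ultimately have "finite {w. conv R f g w \<noteq> \<zero>}"
    using finite_surj by blast
  moreover have "w \<in> W''" if "conv R f g w \<noteq> \<zero>" for w
    using sub[OF that] W fsuppD(3)[OF f] fsuppD(3)[OF g] by blast
  ultimately show ?thesis by (simp add: fsupp_def conv_def)
qed

lemma conv_lists:
  "\<lbrakk>f \<in> fsupp R (lists X); g \<in> fsupp R (lists X)\<rbrakk> \<Longrightarrow> conv R f g \<in> fsupp R (lists X)"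
  by (rule conv_fsupp) auto

text \<open>Of all cuts of a word only the one after \<open>length u\<close> letters can contribute,
  and only for the word \<open>u @ v\<close>.\<close>

lemma conv_mon: "conv R (mon R u) (mon R v) = mon R (u @ v)"
proof
  fix w
  have eq: "take i w = u \<and> drop i w = v \<longleftrightarrow> i = length u \<and> w = u @ v" if "i \<le> length w" for i
    using that by (auto simp: min_def)
  have "conv R (mon R u) (mon R v) w =
      (\<Oplus>i\<in>{..length w}. if length u = i then (if w = u @ v then \<one> else \<zero>) else \<zero>)"
    unfolding conv_def
  proof (rule finsum_cong')
    fix i assume "i \<in> {..length w}"
    then show "mon R u (take i w) \<otimes> mon R v (drop i w) =
        (if length u = i then (if w = u @ v then \<one> else \<zero>) else \<zero>)"
      using eq[of i] by (auto simp: mon_def)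
  qed auto
  also have "\<dots> = mon R (u @ v) w"
  proof (cases "w = u @ v")
    case True
    then show ?thesis
      using finsum_singleton[of "length u" "{..length w}" "\<lambda>_. \<one>"] by (simp add: mon_def)
  next
    case False
    then have "(\<lambda>i. if length u = i then (if w = u @ v then \<one> else \<zero>) else \<zero>) = (\<lambda>i::nat. \<zero>)"
      by auto
    then show ?thesis using False by (simp add: mon_def)
  qed
  finally show "conv R (mon R u) (mon R v) w = mon R (u @ v) w" .
qed

lemma conv_add_left:
  assumes "f \<in> fsupp R W" "g \<in> fsupp R W" "h \<in> fsupp R W"
  shows "conv R (\<lambda>w. f w \<oplus> g w) h = (\<lambda>w. conv R f h w \<oplus> conv R g h w)"
proof
  fix w
  note [simp] = fsuppD(1)[OF assms(1)] fsuppD(1)[OF assms(2)] fsuppD(1)[OF assms(3)]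
  show "conv R (\<lambda>w. f w \<oplus> g w) h w = conv R f h w \<oplus> conv R g h w"
    by (simp add: conv_def l_distr finsum_addf)
qed

lemma conv_add_right:
  assumes "f \<in> fsupp R W" "g \<in> fsupp R W" "h \<in> fsupp R W"
  shows "conv R h (\<lambda>w. f w \<oplus> g w) = (\<lambda>w. conv R h f w \<oplus> conv R h g w)"
proof
  fix w
  note [simp] = fsuppD(1)[OF assms(1)] fsuppD(1)[OF assms(2)] fsuppD(1)[OF assms(3)]
  show "conv R h (\<lambda>w. f w \<oplus> g w) w = conv R h f w \<oplus> conv R h g w"
    by (simp add: conv_def r_distr finsum_addf)
qed

lemma conv_smult_left:
  assumes "c \<in> carrier R" "f \<in> fsupp R W" "h \<in> fsupp R W"
  shows "conv R (\<lambda>w. c \<otimes> f w) h = (\<lambda>w. c \<otimes> conv R f h w)"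
proof
  fix w
  note [simp] = fsuppD(1)[OF assms(2)] fsuppD(1)[OF assms(3)]
  show "conv R (\<lambda>w. c \<otimes> f w) h w = c \<otimes> conv R f h w"
    using assms(1) by (simp add: conv_def m_assoc finsum_rdistr)
qed

lemma conv_smult_right:
  assumes "c \<in> carrier R" "f \<in> fsupp R W" "h \<in> fsupp R W"
  shows "conv R h (\<lambda>w. c \<otimes> f w) = (\<lambda>w. c \<otimes> conv R h f w)"
proof
  fix w
  note [simp] = fsuppD(1)[OF assms(2)] fsuppD(1)[OF assms(3)]
  show "conv R h (\<lambda>w. c \<otimes> f w) w = c \<otimes> conv R h f w"
    using assms(1) by (simp add: conv_def m_lcomm finsum_rdistr)
qed

lemma fsupp_induct [consumes 1, case_names zero add]:
  assumes "f \<in> fsupp R W" "P (\<lambda>w. \<zero>)"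
    and "\<And>c w g. \<lbrakk>c \<in> carrier R; w \<in> W; g \<in> fsupp R W; P g\<rbrakk> \<Longrightarrow>
      P (\<lambda>u. c \<otimes> mon R w u \<oplus> g u)"
  shows "P f"
proof -
  define S where "S = {w. f w \<noteq> \<zero>}"
  have "finite S" using fsuppD(2)[OF assms(1)] by (simp add: S_def)
  then have "f \<in> fsupp R W \<Longrightarrow> S = {w. f w \<noteq> \<zero>} \<Longrightarrow> P f"
  proof (induction S arbitrary: f)
    case empty
    then have "f = (\<lambda>w. \<zero>)" by auto
    then show ?case using assms(2) by simp
  next
    case (insert w S)
    define g where "g = f(w := \<zero>)"
    have supp: "S = {w. g w \<noteq> \<zero>}" using insert by (auto simp: g_def)
    then have g: "g \<in> fsupp R W"
      using insert.prems insert.hyps by (auto simp: fsupp_def g_def)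
    have "f = (\<lambda>u. f w \<otimes> mon R w u \<oplus> g u)"
      using fsuppD(1)[OF insert.prems(1)] by (auto simp: g_def mon_def)
    moreover have "w \<in> W" using insert.prems fsuppD(3)[OF insert.prems(1), of w] by auto
    ultimately show ?case
      using assms(3)[of "f w" w g] g insert.IH[OF g supp] fsuppD(1)[OF insert.prems(1), of w] by simp
  qed
  then show ?thesis using assms(1) by (simp add: S_def)
qed

lemma free_module: "module R (free_galg R X deg)"
proof (intro moduleI abelian_groupI)
  fix f assume "f \<in> carrier (free_galg R X deg)"
  then show "\<exists>g\<in>carrier (free_galg R X deg). g \<oplus>\<^bsub>free_galg R X deg\<^esub> f = \<zero>\<^bsub>free_galg R X deg\<^esub>"
    by (intro bexI[of _ "\<lambda>w. \<ominus> f w"]) (auto simp: free_galg_simps fsuppD fsupp_minus l_neg)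
qed (auto simp: free_galg_simps fsuppD(1) fsupp_add fsupp_zero fsupp_smult a_ac l_distr r_distr
    m_assoc is_cring)

lemma free_linear_eq:
  assumes "linear_map R (free_galg R X deg) N F" "linear_map R (free_galg R X deg) N G"
    and "abelian_group N" "\<And>w. w \<in> lists X \<Longrightarrow> F (mon R w) = G (mon R w)"
    and "f \<in> fsupp R (lists X)"
  shows "F f = G f"
proof -
  interpret T: module R "free_galg R X deg" by (rule free_module)
  note ag = T.M.abelian_group_axioms assms(3)
  note add = linear_map_add[OF assms(1)] linear_map_add[OF assms(2)]
  note sm = linear_map_smult[OF assms(1)] linear_map_smult[OF assms(2)]
  from assms(5) show ?thesis
  proof (induction rule: fsupp_induct)
    case zero
    then show ?case
      using linear_map_zero[OF assms(1) ag] linear_map_zero[OF assms(2) ag]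
      by (simp add: free_galg_simps)
  next
    case (add c w g)
    then show ?case
      using linear_map_add[OF assms(1), of "\<lambda>u. c \<otimes> mon R w u" g]
        linear_map_add[OF assms(2), of "\<lambda>u. c \<otimes> mon R w u" g]
        linear_map_smult[OF assms(1), of c "mon R w"] linear_map_smult[OF assms(2), of c "mon R w"]
        assms(4)[of w]
      by (simp add: free_galg_simps mon_fsupp fsupp_smult)
  qed
qed

lemma free_linear_left:
  assumes "h \<in> fsupp R (lists X)"
  shows "linear_map R (free_galg R X deg) (free_galg R X deg) (\<lambda>f. conv R f h)"
  using assms
  by (intro linear_mapI)
    (auto simp: free_galg_simps conv_add_left conv_smult_left intro: conv_lists)

lemma free_linear_right:
  assumes "h \<in> fsupp R (lists X)"
  shows "linear_map R (free_galg R X deg) (free_galg R X deg) (conv R h)"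
  using assms
  by (intro linear_mapI)
    (auto simp: free_galg_simps conv_add_right conv_smult_right intro: conv_lists)

text \<open>Both sides are trilinear and on words they reduce to associativity of append. The
  arguments are freed one at a time, starting with the rightmost.\<close>

lemma conv_assoc:
  fixes f :: "'x list \<Rightarrow> 'a"
  assumes f: "f \<in> fsupp R (lists X)" and g: "g \<in> fsupp R (lists X)" and h: "h \<in> fsupp R (lists X)"
  shows "conv R (conv R f g) h = conv R f (conv R g h)"
proof -
  \<comment> \<open>Degrees do not enter the operations; the constant 0 is a placeholder that makes
    the linear structure available.\<close>
  define T where "T = free_galg R X (\<lambda>_::'x. 0)"
  interpret T: module R T unfolding T_def by (rule free_module)
  note left = free_linear_left[where X = X and deg = "\<lambda>_. 0", folded T_def]
    and right = free_linear_right[where X = X and deg = "\<lambda>_. 0", folded T_def]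
    and eq = free_linear_eq[where X = X and deg = "\<lambda>_. 0", folded T_def, OF _ _ T.M.abelian_group_axioms]
  have m: "mon R w \<in> fsupp R (lists X)" if "w \<in> lists X" for w :: "'x list"
    using that by (rule mon_fsupp)
  have 1: "conv R (conv R (mon R u) (mon R v)) c = conv R (mon R u) (conv R (mon R v) c)"
    if "u \<in> lists X" "v \<in> lists X" "c \<in> fsupp R (lists X)" for u v c
  proof (rule eq[OF _ _ _ that(3)])
    show "linear_map R T T (\<lambda>c. conv R (conv R (mon R u) (mon R v)) c)"
      using that by (intro right conv_lists m)
    show "linear_map R T T (\<lambda>c. conv R (mon R u) (conv R (mon R v) c))"
      using that by (intro linear_map_comp[OF right right] m)
  qed (simp add: conv_mon)
  have 2: "conv R (conv R (mon R u) b) c = conv R (mon R u) (conv R b c)"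
    if "u \<in> lists X" "b \<in> fsupp R (lists X)" "c \<in> fsupp R (lists X)" for u b c
  proof (rule eq[OF _ _ _ that(2)])
    show "linear_map R T T (\<lambda>b. conv R (conv R (mon R u) b) c)"
      using that by (intro linear_map_comp[OF right left] m)
    show "linear_map R T T (\<lambda>b. conv R (mon R u) (conv R b c))"
      using that by (intro linear_map_comp[OF left right] m)
  qed (use 1 that in simp)
  show ?thesis
  proof (rule eq[OF _ _ _ f])
    show "linear_map R T T (\<lambda>a. conv R (conv R a g) h)"
      using g h by (intro linear_map_comp[OF left left])
    show "linear_map R T T (\<lambda>a. conv R a (conv R g h))"
      using g h by (intro left conv_lists)
  qed (use 2 g h in simp)
qed

lemma conv_one:
  assumes "f \<in> fsupp R (lists X)"
  shows "conv R (mon R []) f = f" "conv R f (mon R []) = f"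
proof -
  define T where "T = free_galg R X (\<lambda>_. 0)"
  interpret T: module R T unfolding T_def by (rule free_module)
  note left = free_linear_left[where X = X and deg = "\<lambda>_. 0", folded T_def]
    and right = free_linear_right[where X = X and deg = "\<lambda>_. 0", folded T_def]
    and eq = free_linear_eq[where X = X and deg = "\<lambda>_. 0", folded T_def, OF _ _ T.M.abelian_group_axioms]
  show "conv R (mon R []) f = f"
    by (rule eq[OF right linear_map_id _ assms]) (auto simp: conv_mon mon_fsupp)
  show "conv R f (mon R []) = f"
    by (rule eq[OF left linear_map_id _ assms]) (auto simp: conv_mon mon_fsupp)
qed

lemma free_k_algebra: "k_algebra R (free_galg R X deg)"
proof -
  interpret T: module R "free_galg R X deg" by (rule free_module)
  have "ring (free_galg R X deg)"
    by (intro ringI monoidI T.M.abelian_group_axioms)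
      (auto simp: free_galg_simps conv_lists conv_assoc[where X = X] conv_one[where X = X]
        conv_add_left[where W = "lists X"] conv_add_right[where W = "lists X"] mon_fsupp)
  then show ?thesis
    by (intro k_algebra.intro k_algebra_axioms.intro T.module_axioms)
      (auto simp: free_galg_simps conv_smult_left[where W = "lists X"]
        conv_smult_right[where W = "lists X"])
qed

lemma free_linear_eval: "linear_map R (free_galg R X deg) (self_module R) (\<lambda>f. f w)"
  by (rule linear_mapI) (auto simp: free_galg_simps fsuppD(1))

text \<open>The component of degree n is the restriction of the function to the words of degree n;
  uniqueness is tested by evaluation at each word.\<close>

lemma free_graded_algebra: "graded_algebra R (free_galg R X deg)"
proof -
  let ?T = "free_galg R X deg"
  let ?deg = "\<lambda>w. sum_list (map deg w)"
  interpret T: k_algebra R ?T by (rule free_k_algebra)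
  interpret S: module R "self_module R" by (rule self_module)
  have inv: "\<ominus>\<^bsub>?T\<^esub> f = (\<lambda>w. \<ominus> f w)" if "f \<in> fsupp R (lists X)" for f
    using that fsupp_minus[OF that] fsuppD(1)[OF that]
    by (intro T.minus_equality) (auto simp: free_galg_simps l_neg)
  have sub: "words X deg n \<subseteq> lists X" for n by (auto simp: words_def)
  have submod: "submodule (homog ?T n) R ?T" for n
    by (rule T.V.submoduleI)
      (auto simp: free_galg_simps inv fsupp_mono[OF sub] fsupp_zero fsupp_add fsupp_smult fsupp_minus)
  \<comment> \<open>Evaluation at a word is linear, hence sums in the function space are computed
    pointwise.\<close>
  have eval: "finsum ?T g S w = (\<Oplus>n\<in>S. g n w)" if "\<And>n. g n \<in> fsupp R (lists X)" for g w and S :: "int set"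
  proof -
    have "finsum ?T g S w = finsum (self_module R) (\<lambda>n. g n w) S"
      using that
      by (intro linear_map_finsum[OF free_linear_eval T.V.M.abelian_group_axioms S.M.abelian_group_axioms])
        (auto simp: free_galg_simps)
    then show ?thesis by (simp add: finsum_record_cong[of "self_module R" R])
  qed
  \<comment> \<open>At \<open>w\<close> only the summand of degree \<open>?deg w\<close> can be
    nonzero, so it must carry the whole value \<open>f w\<close>.\<close>
  have uniq: "g n w = (if ?deg w = n then f w else \<zero>)" if g: "homog_decomp ?T f g" for f g n w
  proof -
    have gh: "g m \<in> fsupp R (words X deg m)" for m using g by (auto simp: homog_decomp_def free_galg_simps)
    then have gn: "g m \<in> fsupp R (lists X)" for m using fsupp_mono[OF sub] by blast
    have gz: "g m w = \<zero>" if "m \<noteq> ?deg w" for m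
      using fsuppD(3)[OF gh[of m], of w] that by (auto simp: words_def)
    let ?S = "{m. g m \<noteq> \<zero>\<^bsub>?T\<^esub>}"
    have "f w = (\<Oplus>m\<in>?S. g m w)"
      using g eval[OF gn] by (simp add: homog_decomp_def)
    also have "\<dots> = (\<Oplus>m\<in>?S. if ?deg w = m then g m w else \<zero>)"
      using gz fsuppD(1)[OF gn] by (intro finsum_cong') auto
    also have "\<dots> = g (?deg w) w"
    proof (cases "?deg w \<in> ?S")
      case True
      then show ?thesis
        using g fsuppD(1)[OF gn] by (intro finsum_singleton) (auto simp: homog_decomp_def)
    next
      case False
      then have "(\<Oplus>m\<in>?S. if ?deg w = m then g m w else \<zero>) = (\<Oplus>m\<in>?S. \<zero>)"
        by (intro finsum_cong') auto
      then show ?thesis using False by (simp add: free_galg_simps)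
    qed
    finally show ?thesis using gz[of n] by auto
  qed
  have ex: "homog_decomp ?T f (\<lambda>n w. if ?deg w = n then f w else \<zero>)" (is "homog_decomp ?T f ?g")
    if f: "f \<in> carrier ?T" for f
  proof -
    have fc: "f \<in> fsupp R (lists X)" using f by (simp add: free_galg_simps)
    have supp: "{n. ?g n \<noteq> \<zero>\<^bsub>?T\<^esub>} = ?deg ` {w. f w \<noteq> \<zero>}"
      by (auto simp: free_galg_simps fun_eq_iff)
    have fin: "finite {n. ?g n \<noteq> \<zero>\<^bsub>?T\<^esub>}" unfolding supp using fsuppD(2)[OF fc] by simp
    have gh: "?g n \<in> fsupp R (words X deg n)" for n
    proof -
      have "finite {w. ?g n w \<noteq> \<zero>}"
        by (rule finite_subset[OF _ fsuppD(2)[OF fc]]) auto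
      then show ?thesis
        using fsuppD(1)[OF fc] fsuppD(3)[OF fc] by (auto simp: fsupp_def words_def)
    qed
    have gn: "?g n \<in> fsupp R (lists X)" for n using gh fsupp_mono[OF sub] by blast
    have "f = finsum ?T ?g {n. ?g n \<noteq> \<zero>\<^bsub>?T\<^esub>}"
    proof
      fix w
      have "finsum ?T ?g {n. ?g n \<noteq> \<zero>\<^bsub>?T\<^esub>} w =
          (\<Oplus>n\<in>?deg ` {w. f w \<noteq> \<zero>}. if ?deg w = n then f w else \<zero>)"
        unfolding supp by (rule eval[OF gn])
      also have "\<dots> = f w"
      proof (cases "f w = \<zero>")
        case False
        then show ?thesis
          using fsuppD[OF fc] finsum_singleton[of "?deg w" "?deg ` {w. f w \<noteq> \<zero>}" "\<lambda>_. f w"] by auto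
      qed (simp cong: if_cong)
      finally show "f w = finsum ?T ?g {n. ?g n \<noteq> \<zero>\<^bsub>?T\<^esub>} w" by simp
    qed
    then show ?thesis using gh fin by (simp add: homog_decomp_def free_galg_simps)
  qed
  have ds: "\<exists>!g. homog_decomp ?T f g" if "f \<in> carrier ?T" for f
  proof (rule ex1I)
    show "homog_decomp ?T f (\<lambda>n w. if ?deg w = n then f w else \<zero>)"
      using that by (rule ex)
    fix g assume "homog_decomp ?T f g"
    then show "g = (\<lambda>n w. if ?deg w = n then f w else \<zero>)"
      using uniq by (intro ext) blast
  qed
  have one: "\<one>\<^bsub>?T\<^esub> \<in> homog ?T 0"
    by (auto simp: free_galg_simps words_def intro: mon_fsupp)
  have mult: "f \<otimes>\<^bsub>?T\<^esub> g \<in> homog ?T (p + q)" if "f \<in> homog ?T p" "g \<in> homog ?T q" for f g p q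
    using that unfolding free_galg_simps by (rule conv_fsupp) (auto simp: words_def)
  show ?thesis
    by (intro graded_algebra.intro T.k_algebra_axioms graded_algebra_axioms.intro)
      (fact submod ds one mult)+
qed

lemma free_graded_generated: "graded_generated R (free_galg R X deg) X (free_gen R) deg"
proof -
  let ?T = "free_galg R X deg"
  let ?h = "hgen R ?T X (free_gen R) deg"
  have mon: "?h (sum_list (map deg w)) (mon R w)" if "w \<in> lists X" for w
    using that
  proof induction
    case Nil
    show ?case using hgen.one[of R ?T X "free_gen R" deg] by (simp add: free_galg_simps)
  next
    case (Cons x w)
    then show ?case
      using hgen.mult[of x X R ?T "free_gen R" deg "sum_list (map deg w)" "mon R w"]
      by (simp add: free_galg_simps free_gen_mon[of R x] conv_mon)
  qed
  have "?h n f" if "f \<in> fsupp R (words X deg n)" for f n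
    using that
  proof (induction rule: fsupp_induct)
    case zero
    show ?case using hgen.zero[of R ?T X "free_gen R" deg n] by (simp add: free_galg_simps)
  next
    case (add c w g)
    then have "?h n (c \<odot>\<^bsub>?T\<^esub> mon R w)"
      using mon[of w] hgen.smult[of c R ?T X "free_gen R" deg n "mon R w"] by (auto simp: words_def)
    from hgen.add[OF this add(4)] show ?case by (simp add: free_galg_simps)
  qed
  then show ?thesis
    by (auto simp: graded_generated_def free_galg_simps free_gen_mon words_def intro!: mon_fsupp)
qed

text \<open>A word goes to the product of the images of its letters, extended linearly.
  Multiplicativity is bilinear and so needs checking on words only.\<close>

lemma free_lift:
  assumes "k_algebra R B" and v: "\<And>x. x \<in> X \<Longrightarrow> v x \<in> carrier B"
  obtains F where "alg_hom R (free_galg R X deg) B F" "\<And>x. x \<in> X \<Longrightarrow> F (free_gen R x) = v x"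
proof -
  let ?T = "free_galg R X deg"
  interpret T: k_algebra R ?T by (rule free_k_algebra)
  interpret B: k_algebra R B by fact
  interpret S: module R "self_module R" by (rule self_module)
  define ev where "ev w = foldr (\<lambda>x b. v x \<otimes>\<^bsub>B\<^esub> b) w \<one>\<^bsub>B\<^esub>" for w
  have ev: "ev w \<in> carrier B" if "w \<in> lists X" for w
    using that by induction (auto simp: ev_def v)
  have ev_append: "ev (u @ w) = ev u \<otimes>\<^bsub>B\<^esub> ev w" if "u \<in> lists X" "w \<in> lists X" for u w
    using that by induction (use ev v in \<open>auto simp: ev_def B.m_assoc\<close>)
  define F where "F f = (\<Oplus>\<^bsub>B\<^esub>w\<in>{w \<in> lists X. f w \<noteq> \<zero>}. f w \<odot>\<^bsub>B\<^esub> ev w)" for f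
  have "linear_map R ?T B
    (\<lambda>f. \<Oplus>\<^bsub>B\<^esub>w\<in>{w \<in> lists X. f w \<noteq> \<zero>\<^bsub>self_module R\<^esub>}. f w \<odot>\<^bsub>B\<^esub> ev w)"
  proof (rule linear_map_supp_sum[where C = "\<lambda>_. carrier R" and c = "\<lambda>w f. f w"
        and t = "\<lambda>w c. c \<odot>\<^bsub>B\<^esub> ev w"])
    show "module R ?T" "module R B" "module R (self_module R)"
      by (rule free_module B.V.module_axioms self_module)+
    show "linear_map R ?T (self_module R) (\<lambda>f. f w)" for w by (rule free_linear_eval)
    show "f w \<in> carrier R" if "f \<in> carrier ?T" for f w
      using that by (simp add: free_galg_simps fsuppD(1))
    show "linear_map R (self_module R\<lparr>carrier := carrier R\<rparr>) B (\<lambda>c. c \<odot>\<^bsub>B\<^esub> ev w)"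
      if "w \<in> lists X" for w
      using ev[OF that] by (intro linear_mapI) (auto simp: B.V.smult_l_distr B.V.smult_assoc1)
    show "finite {w \<in> lists X. f w \<noteq> \<zero>\<^bsub>self_module R\<^esub>}" if "f \<in> carrier ?T" for f
      by (rule finite_subset[OF _ fsuppD(2)[of f "lists X"]]) (use that in \<open>auto simp: free_galg_simps\<close>)
  qed
  then have lin: "linear_map R ?T B F" by (simp add: F_def[abs_def])
  have F_mon: "F (mon R w) = ev w" if w: "w \<in> lists X" for w
  \<comment> \<open>Over the zero ring the support of \<open>mon R w\<close> is empty instead of
    {w}; then \<open>ev w\<close> vanishes too, because 1 = 0 acts on it both as identity and as
    zero.\<close>
  proof (cases "\<one> = \<zero>")
    case True
    then have "ev w = \<zero>\<^bsub>B\<^esub>" using B.V.smult_one[OF ev[OF w]] B.V.smult_l_null[OF ev[OF w]] by simp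
    moreover have "mon R w = (\<lambda>w. \<zero>)" using True by (auto simp: mon_def)
    ultimately show ?thesis by (simp add: F_def)
  next
    case False
    then have "{u \<in> lists X. mon R w u \<noteq> \<zero>} = {w}" using w by (auto simp: mon_def)
    then show ?thesis using ev[OF w] by (simp add: F_def mon_def)
  qed
  have Fcl: "F f \<in> carrier B" if "f \<in> fsupp R (lists X)" for f
    using linear_map_closed[OF lin] that by (simp add: free_galg_simps)
  note eq = free_linear_eq[of X deg B, OF _ _ B.V.M.abelian_group_axioms]
  have m: "mon R w \<in> fsupp R (lists X)" if "w \<in> lists X" for w
    using that by (rule mon_fsupp)
  have 1: "F (conv R (mon R u) g) = F (mon R u) \<otimes>\<^bsub>B\<^esub> F g"
    if u: "u \<in> lists X" and g: "g \<in> fsupp R (lists X)" for u g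
  proof (rule eq[OF _ _ _ g])
    show "linear_map R ?T B (\<lambda>g. F (conv R (mon R u) g))"
      using u by (intro linear_map_comp[OF free_linear_right lin] m)
    show "linear_map R ?T B (\<lambda>g. F (mon R u) \<otimes>\<^bsub>B\<^esub> F g)"
      using u by (intro linear_map_comp[OF lin B.linear_lmult] Fcl m)
    show "F (conv R (mon R u) (mon R w)) = F (mon R u) \<otimes>\<^bsub>B\<^esub> F (mon R w)" if "w \<in> lists X" for w
      using u that F_mon[of "u @ w"] by (simp add: conv_mon F_mon ev_append)
  qed
  have 2: "F (conv R f g) = F f \<otimes>\<^bsub>B\<^esub> F g"
    if f: "f \<in> fsupp R (lists X)" and g: "g \<in> fsupp R (lists X)" for f g
  proof (rule eq[OF _ _ _ f])
    show "linear_map R ?T B (\<lambda>f. F (conv R f g))"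
      using g by (intro linear_map_comp[OF free_linear_left lin])
    show "linear_map R ?T B (\<lambda>f. F f \<otimes>\<^bsub>B\<^esub> F g)"
      using g by (intro linear_map_comp[OF lin B.linear_rmult] Fcl)
  qed (use 1 g in auto)
  have "alg_hom R ?T B F"
    using 2 F_mon[of "[]"] by (intro alg_homI lin) (simp_all add: free_galg_simps ev_def)
  moreover have "F (free_gen R x) = v x" if "x \<in> X" for x
    using F_mon[of "[x]"] v that by (simp add: free_gen_mon ev_def)
  ultimately show ?thesis using that by blast
qed

end

lemma alg_hom_record_cong:
  assumes "alg_hom K A B f" "carrier A' = carrier A" "add A' = add A"
    "monoid.mult A' = monoid.mult A" "\<one>\<^bsub>A'\<^esub> = \<one>\<^bsub>A\<^esub>" "smult A' = smult A"
  shows "alg_hom K A' B f"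
  using assms by (simp add: alg_hom_def ring_hom_def linear_map_def)

context graded_algebra
begin

lemma alg_hom_on_homogI:
  assumes "k_algebra K B" and lin: "linear_map K A B f" and "f \<one> = \<one>\<^bsub>B\<^esub>"
    and mult: "\<And>p q a b. \<lbrakk>a \<in> homog A p; b \<in> homog A q\<rbrakk> \<Longrightarrow> f (a \<otimes> b) = f a \<otimes>\<^bsub>B\<^esub> f b"
  shows "alg_hom K A B f"
proof (rule alg_homI[OF lin _ assms(3)])
  interpret B: k_algebra K B by fact
  note ag = B.V.M.abelian_group_axioms
  note cl = linear_map_closed[OF lin]
  have 1: "f (a \<otimes> b) = f a \<otimes>\<^bsub>B\<^esub> f b" if a: "a \<in> homog A p" and b: "b \<in> carrier A" for a b p
    by (rule linear_eq_on_homog[OF linear_map_comp[OF linear_lmult lin]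
          linear_map_comp[OF lin B.linear_lmult] ag mult[OF a] b])
      (use a cl homog_closed in auto)
  fix a b assume a: "a \<in> carrier A" and b: "b \<in> carrier A"
  show "f (a \<otimes> b) = f a \<otimes>\<^bsub>B\<^esub> f b"
    by (rule linear_eq_on_homog[OF linear_map_comp[OF linear_rmult lin]
          linear_map_comp[OF lin B.linear_rmult] ag 1 a])
      (use b cl in auto)
qed

lemma genideal_homog:
  assumes "\<And>s. s \<in> S \<Longrightarrow> \<exists>n. s \<in> homog A n" and "a \<in> Idl\<^bsub>A\<^esub> S"
  shows "hcomp A a n \<in> Idl\<^bsub>A\<^esub> S"
proof (rule genideal_hcomp[OF _ _ assms(2)])
  show S: "S \<subseteq> carrier A" using assms(1) homog_closed by blast
  fix s n assume s: "s \<in> S"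
  then obtain m where "s \<in> homog A m" using assms(1) by blast
  moreover have "s \<in> Idl\<^bsub>A\<^esub> S" using genideal_self[OF S] s by blast
  moreover have "\<zero> \<in> Idl\<^bsub>A\<^esub> S"
    using genideal_ideal[OF S] by (simp add: ideal_def additive_subgroup.zero_closed)
  ultimately show "hcomp A s n \<in> Idl\<^bsub>A\<^esub> S" by (simp add: hcomp_of_homog)
qed

end

section \<open>Skew derivations as homomorphisms into dual numbers\<close>

text \<open>Homomorphisms into this algebra are the pairs \<open>(f, D)\<close> of a homomorphism \<open>f\<close> and a linear
  map \<open>D\<close> with \<open>D (a b) = \<sigma> (f a) D b + D a \<tau> (f b)\<close>, so skew derivations can be constructed from
  universal properties of algebras.\<close>

definition dual_alg ::
  "('k, 'b, 'n) module_scheme \<Rightarrow> ('b \<Rightarrow> 'b) \<Rightarrow> ('b \<Rightarrow> 'b) \<Rightarrow> ('k, 'b \<times> 'b) module" where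
  "dual_alg B \<sigma> \<tau> =
    \<lparr>carrier = carrier B \<times> carrier B,
     monoid.mult = \<lambda>(a, a') (b, b'). (a \<otimes>\<^bsub>B\<^esub> b, \<sigma> a \<otimes>\<^bsub>B\<^esub> b' \<oplus>\<^bsub>B\<^esub> a' \<otimes>\<^bsub>B\<^esub> \<tau> b),
     one = (\<one>\<^bsub>B\<^esub>, \<zero>\<^bsub>B\<^esub>), zero = (\<zero>\<^bsub>B\<^esub>, \<zero>\<^bsub>B\<^esub>),
     add = \<lambda>(a, a') (b, b'). (a \<oplus>\<^bsub>B\<^esub> b, a' \<oplus>\<^bsub>B\<^esub> b'),
     smult = \<lambda>c (a, a'). (c \<odot>\<^bsub>B\<^esub> a, c \<odot>\<^bsub>B\<^esub> a')\<rparr>"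

lemma dual_alg_simps [simp]:
  "carrier (dual_alg B \<sigma> \<tau>) = carrier B \<times> carrier B"
  "(a, a') \<otimes>\<^bsub>dual_alg B \<sigma> \<tau>\<^esub> (b, b') = (a \<otimes>\<^bsub>B\<^esub> b, \<sigma> a \<otimes>\<^bsub>B\<^esub> b' \<oplus>\<^bsub>B\<^esub> a' \<otimes>\<^bsub>B\<^esub> \<tau> b)"
  "\<one>\<^bsub>dual_alg B \<sigma> \<tau>\<^esub> = (\<one>\<^bsub>B\<^esub>, \<zero>\<^bsub>B\<^esub>)"
  "\<zero>\<^bsub>dual_alg B \<sigma> \<tau>\<^esub> = (\<zero>\<^bsub>B\<^esub>, \<zero>\<^bsub>B\<^esub>)"
  "(a, a') \<oplus>\<^bsub>dual_alg B \<sigma> \<tau>\<^esub> (b, b') = (a \<oplus>\<^bsub>B\<^esub> b, a' \<oplus>\<^bsub>B\<^esub> b')"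
  "c \<odot>\<^bsub>dual_alg B \<sigma> \<tau>\<^esub> (a, a') = (c \<odot>\<^bsub>B\<^esub> a, c \<odot>\<^bsub>B\<^esub> a')"
  by (simp_all add: dual_alg_def)

text \<open>Associativity in the second coordinate: both bracketings of (a,a'), (b,b'), (c,c') give
  \<sigma>(a)\<sigma>(b)c' + \<sigma>(a)b'\<tau>(c) + a'\<tau>(b)\<tau>(c), by multiplicativity of
  the two twists.\<close>

lemma dual_k_algebra:
  assumes "k_algebra K B" and s: "alg_hom K B B \<sigma>" and t: "alg_hom K B B \<tau>"
  shows "k_algebra K (dual_alg B \<sigma> \<tau>)"
proof -
  interpret B: k_algebra K B by fact
  note [simp] = alg_hom_closed[OF s] alg_hom_closed[OF t] alg_hom_add[OF s] alg_hom_add[OF t]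
    alg_hom_mult[OF s] alg_hom_mult[OF t] alg_hom_one[OF s] alg_hom_one[OF t]
    alg_hom_smult[OF s] alg_hom_smult[OF t]
  let ?D = "dual_alg B \<sigma> \<tau>"
  have ag: "abelian_group ?D"
  proof (rule abelian_groupI)
    fix u assume "u \<in> carrier ?D"
    then show "\<exists>v\<in>carrier ?D. v \<oplus>\<^bsub>?D\<^esub> u = \<zero>\<^bsub>?D\<^esub>"
      by (intro bexI[of _ "(\<ominus>\<^bsub>B\<^esub> fst u, \<ominus>\<^bsub>B\<^esub> snd u)"]) (auto simp: B.l_neg)
  qed (auto simp: B.a_ac)
  have "monoid ?D"
    by (rule monoidI) (auto simp: B.m_assoc B.l_distr B.r_distr B.a_ac)
  then have "ring ?D"
    using ag by (intro ringI) (auto simp: B.l_distr B.r_distr B.a_ac)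
  moreover have "module K ?D"
    using ag B.V.R.cring_axioms
    by (intro moduleI) (auto simp: B.V.smult_l_distr B.V.smult_r_distr B.V.smult_assoc1)
  ultimately show ?thesis
    by (intro k_algebra.intro k_algebra_axioms.intro)
      (auto simp: B.smult_mult_left B.smult_mult_right B.V.smult_r_distr)
qed

lemma dual_minus:
  assumes "k_algebra K B" "alg_hom K B B \<sigma>" "alg_hom K B B \<tau>" "a \<in> carrier B" "b \<in> carrier B"
  shows "\<ominus>\<^bsub>dual_alg B \<sigma> \<tau>\<^esub> (a, b) = (\<ominus>\<^bsub>B\<^esub> a, \<ominus>\<^bsub>B\<^esub> b)"
proof -
  interpret B: k_algebra K B by fact
  interpret D: k_algebra K "dual_alg B \<sigma> \<tau>" by (rule dual_k_algebra[OF assms(1-3)])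
  show ?thesis using assms(4,5) by (intro D.minus_equality) (auto simp: B.l_neg)
qed

lemma dual_koszul:
  assumes "k_algebra K B" "alg_hom K B B \<sigma>" "alg_hom K B B \<tau>" "a \<in> carrier B" "b \<in> carrier B"
  shows "koszul (dual_alg B \<sigma> \<tau>) n (a, b) = (koszul B n a, koszul B n b)"
  using dual_minus[OF assms] by (simp add: koszul_def)

lemma dual_fst: "alg_hom K (dual_alg B \<sigma> \<tau>) B fst"
  by (intro alg_homI linear_mapI) auto

lemma dual_snd: "linear_map K (dual_alg B \<sigma> \<tau>) B snd"
  by (intro linear_mapI) auto

lemma dual_snd_mult:
  "snd (u \<otimes>\<^bsub>dual_alg B \<sigma> \<tau>\<^esub> v) = \<sigma> (fst u) \<otimes>\<^bsub>B\<^esub> snd v \<oplus>\<^bsub>B\<^esub> snd u \<otimes>\<^bsub>B\<^esub> \<tau> (fst v)"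
  by (cases u; cases v) simp

section \<open>Partial derivatives on the free graded commutative algebra\<close>

lemma sym_ideal_ideal:
  assumes "cring K"
  shows "ideal (sym_ideal K \<Lambda> deg) (free_galg K \<Lambda> deg)"
    and "\<And>a n. a \<in> sym_ideal K \<Lambda> deg \<Longrightarrow> hcomp (free_galg K \<Lambda> deg) a n \<in> sym_ideal K \<Lambda> deg"
proof -
  interpret cring K by fact
  let ?T = "free_galg K \<Lambda> deg"
  interpret T: graded_algebra K ?T by (rule free_graded_algebra)
  note gen = graded_generated_homog[OF free_graded_generated]
  define S where "S = {signed_comm ?T (deg \<alpha> * deg \<beta>) (free_gen K \<alpha>) (free_gen K \<beta>) | \<alpha> \<beta>. \<alpha> \<in> \<Lambda> \<and> \<beta> \<in> \<Lambda>}"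
  have S: "sym_ideal K \<Lambda> deg = Idl\<^bsub>?T\<^esub> S" by (simp add: sym_ideal_def S_def signed_comm_def Let_def)
  have h: "\<exists>n. s \<in> homog ?T n" if s: "s \<in> S" for s
  proof -
    obtain \<alpha> \<beta> where "\<alpha> \<in> \<Lambda>" "\<beta> \<in> \<Lambda>"
      "s = signed_comm ?T (deg \<alpha> * deg \<beta>) (free_gen K \<alpha>) (free_gen K \<beta>)" using s by (auto simp: S_def)
    then show ?thesis using T.signed_comm_homog[OF gen gen] by metis
  qed
  then show "ideal (sym_ideal K \<Lambda> deg) ?T"
    unfolding S using T.homog_closed by (intro T.genideal_ideal subsetI) blast
  show "hcomp ?T a n \<in> sym_ideal K \<Lambda> deg" if "a \<in> sym_ideal K \<Lambda> deg" for a n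
    using T.genideal_homog[OF h, where a = a] that unfolding S by simp
qed

lemma sym_graded_generated:
  "cring K \<Longrightarrow> graded_generated K (sym_galg K \<Lambda> deg) \<Lambda> (sym_var K \<Lambda> deg) deg"
  using quot_graded_generated[OF cring.free_graded_algebra sym_ideal_ideal(1) cring.free_graded_generated]
  unfolding sym_galg_def sym_var_def by blast

text \<open>A homomorphism from the tensor algebra to dual numbers over R sends each generator to
  itself paired with its prescribed derivative. It kills the commutation relations, so it descends
  to R, and its second coordinate is the required map.\<close>

lemma sym_partial_derivative:
  fixes R :: "('k, ('i list \<Rightarrow> 'k) set, 'n) galg_scheme"
  assumes "graded_algebra K R"
    and eqs: "carrier R = carrier (sym_galg K \<Lambda> deg)" "add R = add (sym_galg K \<Lambda> deg)"
      "\<zero>\<^bsub>R\<^esub> = \<zero>\<^bsub>sym_galg K \<Lambda> deg\<^esub>"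
      "monoid.mult R = monoid.mult (sym_galg K \<Lambda> deg)" "\<one>\<^bsub>R\<^esub> = \<one>\<^bsub>sym_galg K \<Lambda> deg\<^esub>"
      "smult R = smult (sym_galg K \<Lambda> deg)" "homog R = homog (sym_galg K \<Lambda> deg)"
    and comm: "\<And>a b p q. \<lbrakk>a \<in> homog R p; b \<in> homog R q\<rbrakk> \<Longrightarrow> a \<otimes>\<^bsub>R\<^esub> b = koszul R (p * q) (b \<otimes>\<^bsub>R\<^esub> a)"
  shows "\<exists>D. linear_map K R R D \<and>
    (\<forall>\<beta>\<in>\<Lambda>. D (sym_var K \<Lambda> deg \<beta>) = (if \<alpha> = \<beta> then \<one>\<^bsub>R\<^esub> else \<zero>\<^bsub>R\<^esub>)) \<and>
    (\<forall>p q. \<forall>a\<in>homog R p. \<forall>b\<in>homog R q.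
       D (a \<otimes>\<^bsub>R\<^esub> b) = a \<otimes>\<^bsub>R\<^esub> D b \<oplus>\<^bsub>R\<^esub> koszul R (p * q) (b \<otimes>\<^bsub>R\<^esub> D a))"
proof -
  interpret R: graded_algebra K R by fact
  let ?T = "free_galg K \<Lambda> deg" and ?x = "sym_var K \<Lambda> deg"
  interpret T: graded_algebra K ?T by (rule R.V.R.free_graded_algebra)
  have K: "cring K" by (rule R.V.R.cring_axioms)
  note J = sym_ideal_ideal(1)[OF K, of \<Lambda> deg]
  have gen: "graded_generated K R \<Lambda> ?x deg"
    using sym_graded_generated[OF K] eqs(3,2,4-) by (rule graded_generated_record_cong)
  note xh = graded_generated_homog[OF gen]
  \<comment> \<open>With identity on the left and \<sigma> on the right the rule becomes D(ab) = a
    D(b) + D(a) \<sigma>(b). The exponent \<open>deg \<alpha>\<close> compensates for D lowering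
    degrees by \<open>deg \<alpha>\<close>.\<close>
  define \<sigma> where "\<sigma> = sgn_aut R (deg \<alpha>)"
  have \<sigma>: "alg_hom K R R \<sigma>" unfolding \<sigma>_def by (rule R.alg_hom_sgn_aut)
  have \<sigma>h: "\<sigma> a = koszul R (deg \<alpha> * n) a" if "a \<in> homog R n" for a n
    unfolding \<sigma>_def using that by (rule R.sgn_aut_homog)
  let ?B = "dual_alg R (\<lambda>a. a) \<sigma>"
  note B = R.k_algebra_axioms alg_hom_id \<sigma>
  interpret B: k_algebra K ?B by (rule dual_k_algebra[OF B])
  define v where "v \<beta> = (?x \<beta>, if \<alpha> = \<beta> then \<one>\<^bsub>R\<^esub> else \<zero>\<^bsub>R\<^esub>)" for \<beta>
  have v: "v \<beta> \<in> carrier ?B" if "\<beta> \<in> \<Lambda>" for \<beta>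
    using xh[OF that] by (simp add: v_def R.homog_closed)
  obtain F where F: "alg_hom K ?T ?B F" "\<And>\<beta>. \<beta> \<in> \<Lambda> \<Longrightarrow> F (free_gen K \<beta>) = v \<beta>"
    using R.V.R.free_lift[OF B.k_algebra_axioms v] by metis
  define S where "S = {signed_comm ?T (deg \<beta> * deg \<gamma>) (free_gen K \<beta>) (free_gen K \<gamma>) | \<beta> \<gamma>. \<beta> \<in> \<Lambda> \<and> \<gamma> \<in> \<Lambda>}"
  have S: "sym_ideal K \<Lambda> deg = Idl\<^bsub>?T\<^esub> S" by (simp add: sym_ideal_def S_def signed_comm_def Let_def)
  have fg: "free_gen K \<beta> \<in> carrier ?T" if "\<beta> \<in> \<Lambda>" for \<beta>
    using graded_generated_homog[OF R.V.R.free_graded_generated that] T.homog_closed by blast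
  have F0: "F a = \<zero>\<^bsub>?B\<^esub>" if "a \<in> sym_ideal K \<Lambda> deg" for a
  proof (rule alg_hom_genideal[OF T.k_algebra_axioms B.k_algebra_axioms F(1)])
    show "S \<subseteq> carrier ?T" using fg by (auto simp: S_def)
    show "a \<in> Idl\<^bsub>?T\<^esub> S" using that S by simp
    fix s assume "s \<in> S"
    then obtain \<beta> \<gamma> where \<beta>: "\<beta> \<in> \<Lambda>" and \<gamma>: "\<gamma> \<in> \<Lambda>"
      and s: "s = signed_comm ?T (deg \<beta> * deg \<gamma>) (free_gen K \<beta>) (free_gen K \<gamma>)" by (auto simp: S_def)
    note xc = R.homog_closed[OF xh[OF \<beta>]] R.homog_closed[OF xh[OF \<gamma>]]
    \<comment> \<open>In the second coordinate, if \<alpha> = \<gamma> the left side contributes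
      x_\<beta> and the right side contributes \<sigma>(x_\<beta>) with the sign of deg \<beta> *
      deg \<gamma>; since \<sigma> supplies the same sign, the two cancel out. The case \<alpha> =
      \<beta> is symmetric.\<close>
    have "v \<beta> \<otimes>\<^bsub>?B\<^esub> v \<gamma> = koszul ?B (deg \<beta> * deg \<gamma>) (v \<gamma> \<otimes>\<^bsub>?B\<^esub> v \<beta>)"
      using comm[OF xh[OF \<beta>] xh[OF \<gamma>]] xc alg_hom_closed[OF \<sigma>] \<sigma>h[OF xh[OF \<beta>]] \<sigma>h[OF xh[OF \<gamma>]]
      by (auto simp: v_def dual_minus[OF B] R.ring_nf koszul_def)
    then have "signed_comm ?B (deg \<beta> * deg \<gamma>) (v \<beta>) (v \<gamma>) = \<zero>\<^bsub>?B\<^esub>"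
      using v[OF \<beta>] v[OF \<gamma>] by (rule B.signed_comm_eq_zero[rotated 2])
    then show "F s = \<zero>\<^bsub>?B\<^esub>"
      using alg_hom_signed_comm[OF F(1) T.A.ring_axioms B.A.ring_axioms fg[OF \<beta>] fg[OF \<gamma>]]
        F(2)[OF \<beta>] F(2)[OF \<gamma>] by (simp add: s)
  qed
  obtain G' where G': "alg_hom K (sym_galg K \<Lambda> deg) ?B G'"
    and G'v: "\<And>a. a \<in> carrier ?T \<Longrightarrow> G' (sym_ideal K \<Lambda> deg +>\<^bsub>?T\<^esub> a) = F a"
    using quot_lift[OF T.k_algebra_axioms B.k_algebra_axioms J F(1) F0] unfolding sym_galg_def by metis
  have G: "alg_hom K R ?B G'" using G' eqs(1,2,4-6) by (rule alg_hom_record_cong)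
  have Gx: "G' (?x \<beta>) = v \<beta>" if "\<beta> \<in> \<Lambda>" for \<beta>
    using G'v[OF fg[OF that]] F(2)[OF that] by (simp add: sym_var_def)
  \<comment> \<open>The first coordinate is an algebra map fixing the generators, hence the
    identity; this makes the second coordinate a derivation over R itself.\<close>
  have fstG: "fst (G' a) = a" if "a \<in> carrier R" for a
    by (rule alg_hom_eq_on_generators[OF assms(1) gen R.k_algebra_axioms
          alg_hom_comp[OF G dual_fst] alg_hom_id _ that]) (simp add: Gx v_def)
  define D where "D a = snd (G' a)" for a
  have D: "linear_map K R R D"
    unfolding D_def[abs_def] by (rule linear_map_comp[OF alg_hom_linear[OF G] dual_snd])
  have Dm: "D (a \<otimes>\<^bsub>R\<^esub> b) = a \<otimes>\<^bsub>R\<^esub> D b \<oplus>\<^bsub>R\<^esub> D a \<otimes>\<^bsub>R\<^esub> \<sigma> b"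
    if "a \<in> carrier R" "b \<in> carrier R" for a b
    using that by (simp add: D_def alg_hom_mult[OF G] dual_snd_mult fstG)
  have Dx: "D (?x \<beta>) = (if \<alpha> = \<beta> then \<one>\<^bsub>R\<^esub> else \<zero>\<^bsub>R\<^esub>)" if "\<beta> \<in> \<Lambda>" for \<beta>
    using Gx[OF that] by (simp add: D_def v_def)
  note ag = R.V.M.abelian_group_axioms
  \<comment> \<open>The degree of D a is what determines the sign when D a is moved past b
    below.\<close>
  have Dh: "D a \<in> homog R (n - deg \<alpha>)" if "a \<in> homog R n" for a n
    using assms(1) gen that
  proof (induction rule: graded_generated_induct)
    case one
    then show ?case using alg_hom_one[OF G] by (simp add: D_def R.homog_zero)
  next
    case (zero n)
    then show ?case using linear_map_zero[OF D ag ag] by (simp add: R.homog_zero)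
  next
    case (mult \<beta> n a)
    have "?x \<beta> \<otimes>\<^bsub>R\<^esub> D a \<in> homog R (deg \<beta> + n - deg \<alpha>)"
      using R.mult_homog[OF mult(2,4)] by (simp add: algebra_simps)
    moreover have "D (?x \<beta>) \<otimes>\<^bsub>R\<^esub> \<sigma> a \<in> homog R (deg \<beta> + n - deg \<alpha>)"
      using mult alg_hom_closed[OF \<sigma>] \<sigma>h[OF mult(3)]
      by (auto simp: Dx R.homog_zero R.homog_closed R.homog_koszul)
    ultimately show ?case
      using mult by (simp add: Dm R.homog_closed R.homog_add)
  next
    case (add n a b)
    then show ?case by (simp add: linear_map_add[OF D] R.homog_closed R.homog_add)
  next
    case (smult n c a)
    then show ?case by (simp add: linear_map_smult[OF D] R.homog_closed R.homog_smult)
  qed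
  have "D (a \<otimes>\<^bsub>R\<^esub> b) = a \<otimes>\<^bsub>R\<^esub> D b \<oplus>\<^bsub>R\<^esub> koszul R (p * q) (b \<otimes>\<^bsub>R\<^esub> D a)"
    if a: "a \<in> homog R p" and b: "b \<in> homog R q" for a b p q
  proof -
    note cl = R.homog_closed[OF a] R.homog_closed[OF b] linear_map_closed[OF D R.homog_closed[OF a]]
    \<comment> \<open>The twist contributes exponent deg \<alpha> * q and commuting D a with b
      contributes (p - deg \<alpha>) * q; together they have the parity of p * q.\<close>
    have "D a \<otimes>\<^bsub>R\<^esub> \<sigma> b = koszul R (deg \<alpha> * q) (D a \<otimes>\<^bsub>R\<^esub> b)"
      using cl by (simp add: \<sigma>h[OF b] R.koszul_mult_right)
    also have "\<dots> = koszul R (p * q) (b \<otimes>\<^bsub>R\<^esub> D a)"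
      using cl by (simp add: comm[OF Dh[OF a] b] R.koszul_koszul) (simp add: koszul_def)
    finally show ?thesis using cl by (simp add: Dm)
  qed
  then show ?thesis using D Dx by blast
qed

section \<open>The free extension \<open>F(R)\<close>\<close>

definition ext_gens :: "('k, 'r, 'n) galg_scheme \<Rightarrow> 'i set \<Rightarrow> ('i, 'r) ext_gen set" where
  "ext_gens R \<Lambda> = {Inl (n, r) | n r. r \<in> homog R n} \<union> Inr ` \<Lambda>"

locale free_extension = graded_algebra K R
  for K :: "('k, 'm) ring_scheme" and R :: "('k, 'r, 'n) galg_scheme" (structure) +
  fixes \<Lambda> :: "'i set" and deg :: "'i \<Rightarrow> int"
begin

abbreviation "E \<equiv> ext_free K R \<Lambda> deg"
abbreviation "N \<equiv> ext_ideal K R \<Lambda> deg"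
abbreviation "F \<equiv> free_ext K R \<Lambda> deg"
abbreviation "i \<equiv> ext_incl K R \<Lambda> deg"
abbreviation "y \<equiv> ext_var K R \<Lambda> deg"
abbreviation "gdeg \<equiv> case_sum fst deg"

definition e :: "int \<Rightarrow> 'r \<Rightarrow> ('i, 'r) ext_gen list \<Rightarrow> 'k" where
  "e n r = free_gen K (Inl (n, r))"

lemma E_def: "E = free_galg K (ext_gens R \<Lambda>) gdeg"
  by (simp add: ext_free_def ext_gens_def)

sublocale E: graded_algebra K E
  unfolding E_def by (rule V.R.free_graded_algebra)

lemma E_generated: "graded_generated K E (ext_gens R \<Lambda>) (free_gen K) gdeg"
  unfolding E_def by (rule V.R.free_graded_generated)

lemma e_homog: "r \<in> homog R n \<Longrightarrow> e n r \<in> homog E n"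
  using graded_generated_homog[OF E_generated, of "Inl (n, r)"] by (simp add: ext_gens_def e_def)

lemmas e_closed = E.homog_closed[OF e_homog]

definition rels :: "(('i, 'r) ext_gen list \<Rightarrow> 'k) set" where
  "rels =
    {e n (r \<oplus> s) \<ominus>\<^bsub>E\<^esub> (e n r \<oplus>\<^bsub>E\<^esub> e n s) | n r s. r \<in> homog R n \<and> s \<in> homog R n} \<union>
    {e n (c \<odot> r) \<ominus>\<^bsub>E\<^esub> c \<odot>\<^bsub>E\<^esub> e n r | n c r. c \<in> carrier K \<and> r \<in> homog R n} \<union>
    {e (p + q) (r \<otimes> s) \<ominus>\<^bsub>E\<^esub> e p r \<otimes>\<^bsub>E\<^esub> e q s | p q r s. r \<in> homog R p \<and> s \<in> homog R q} \<union>
    {e 0 \<one> \<ominus>\<^bsub>E\<^esub> \<one>\<^bsub>E\<^esub>}"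

lemma N_def: "N = Idl\<^bsub>E\<^esub> rels"
  by (simp add: ext_ideal_def rels_def e_def Let_def)

lemma rels_homog: "s \<in> rels \<Longrightarrow> \<exists>n. s \<in> homog E n"
  unfolding rels_def
  by (elim UnE CollectE exE conjE singletonE)
    (blast intro: E.homog_diff E.homog_add E.homog_smult E.mult_homog E.one_homog e_homog
      homog_add homog_smult mult_homog one_homog)+

lemma rels_closed: "rels \<subseteq> carrier E"
  using rels_homog E.homog_closed by blast

sublocale N: ideal N E
  unfolding N_def using rels_closed by (rule E.genideal_ideal)

lemma rels_N: "s \<in> rels \<Longrightarrow> s \<in> N"
  unfolding N_def using E.genideal_self[OF rels_closed] by blast

sublocale F: graded_algebra K F
  unfolding free_ext_def
  using quot_graded_algebra[OF E.graded_algebra_axioms N.is_ideal] E.genideal_homog[OF rels_homog]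
  by (simp add: N_def)

lemma F_generated:
  "graded_generated K F (ext_gens R \<Lambda>) (\<lambda>g. N +>\<^bsub>E\<^esub> free_gen K g) gdeg"
  unfolding free_ext_def
  by (rule quot_graded_generated[OF E.graded_algebra_axioms N.is_ideal E_generated])

lemma proj: "alg_hom K E F (\<lambda>a. N +>\<^bsub>E\<^esub> a)"
  unfolding free_ext_def by (rule quot_k_algebra(2)[OF E.k_algebra_axioms N.is_ideal])

lemma coset_eqI: "\<lbrakk>a \<ominus>\<^bsub>E\<^esub> b \<in> rels; a \<in> carrier E; b \<in> carrier E\<rbrakk> \<Longrightarrow> N +>\<^bsub>E\<^esub> a = N +>\<^bsub>E\<^esub> b"
  using N.coset_eq_iff rels_N by blast

lemma coset_add:
  assumes "r \<in> homog R n" "s \<in> homog R n"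
  shows "N +>\<^bsub>E\<^esub> e n (r \<oplus> s) = N +>\<^bsub>E\<^esub> (e n r \<oplus>\<^bsub>E\<^esub> e n s)"
proof (rule coset_eqI)
  show "e n (r \<oplus> s) \<ominus>\<^bsub>E\<^esub> (e n r \<oplus>\<^bsub>E\<^esub> e n s) \<in> rels"
    unfolding rels_def using assms by blast
qed (use e_closed[OF homog_add[OF assms]] e_closed[OF assms(1)] e_closed[OF assms(2)] in simp_all)

lemma coset_smult:
  assumes "c \<in> carrier K" "r \<in> homog R n"
  shows "N +>\<^bsub>E\<^esub> e n (c \<odot> r) = N +>\<^bsub>E\<^esub> (c \<odot>\<^bsub>E\<^esub> e n r)"
proof (rule coset_eqI)
  show "e n (c \<odot> r) \<ominus>\<^bsub>E\<^esub> c \<odot>\<^bsub>E\<^esub> e n r \<in> rels"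
    unfolding rels_def using assms by blast
qed (use assms e_closed[OF homog_smult[OF assms]] e_closed[OF assms(2)] in simp_all)

lemma coset_mult:
  assumes "r \<in> homog R p" "s \<in> homog R q"
  shows "N +>\<^bsub>E\<^esub> e (p + q) (r \<otimes> s) = N +>\<^bsub>E\<^esub> (e p r \<otimes>\<^bsub>E\<^esub> e q s)"
proof (rule coset_eqI)
  show "e (p + q) (r \<otimes> s) \<ominus>\<^bsub>E\<^esub> e p r \<otimes>\<^bsub>E\<^esub> e q s \<in> rels"
    unfolding rels_def using assms by blast
qed (use e_closed[OF mult_homog[OF assms]] e_closed[OF assms(1)] e_closed[OF assms(2)] in simp_all)

lemma coset_one: "N +>\<^bsub>E\<^esub> e 0 \<one> = N +>\<^bsub>E\<^esub> \<one>\<^bsub>E\<^esub>"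
proof (rule coset_eqI)
  show "e 0 \<one> \<ominus>\<^bsub>E\<^esub> \<one>\<^bsub>E\<^esub> \<in> rels" unfolding rels_def by blast
qed (use e_closed[OF one_homog] in simp_all)

text \<open>The first two families of relations say precisely this. Because of the degree tags it
  holds one degree at a time; \<open>incl_linear\<close> glues the pieces.\<close>

lemma incl_linear_homog:
  "linear_map K (R\<lparr>carrier := homog R n\<rparr>) F (\<lambda>r. N +>\<^bsub>E\<^esub> e n r)"
proof (rule linear_mapI)
  fix r assume "r \<in> carrier (R\<lparr>carrier := homog R n\<rparr>)"
  then have r: "r \<in> homog R n" by simp
  show "N +>\<^bsub>E\<^esub> e n r \<in> carrier F"
    by (rule alg_hom_closed[OF proj e_closed[OF r]])
  show "N +>\<^bsub>E\<^esub> e n (c \<odot>\<^bsub>R\<lparr>carrier := homog R n\<rparr>\<^esub> r) = c \<odot>\<^bsub>F\<^esub> (N +>\<^bsub>E\<^esub> e n r)"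
    if c: "c \<in> carrier K" for c
    using coset_smult[OF c r] alg_hom_smult[OF proj c e_closed[OF r]] by simp
  fix s assume "s \<in> carrier (R\<lparr>carrier := homog R n\<rparr>)"
  then have s: "s \<in> homog R n" by simp
  show "N +>\<^bsub>E\<^esub> e n (r \<oplus>\<^bsub>R\<lparr>carrier := homog R n\<rparr>\<^esub> s) =
      (N +>\<^bsub>E\<^esub> e n r) \<oplus>\<^bsub>F\<^esub> (N +>\<^bsub>E\<^esub> e n s)"
    using coset_add[OF r s] alg_hom_add[OF proj e_closed[OF r] e_closed[OF s]] by simp
qed

lemma incl_homog:
  assumes "r \<in> homog R n"
  shows "i r = N +>\<^bsub>E\<^esub> e n r"
  unfolding ext_incl_def e_def
  by (rule hcomp_sum_homog[where t = "\<lambda>n r. N +>\<^bsub>E\<^esub> free_gen K (Inl (n, r))",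
        OF F.V.M.abelian_group_axioms incl_linear_homog[unfolded e_def] assms])

lemma incl_graded:
  assumes "r \<in> homog R n"
  shows "i r \<in> homog F n"
  unfolding incl_homog[OF assms] free_ext_def quot_galg_simps
  using e_homog[OF assms] by (rule imageI)

lemma incl_linear: "linear_map K R F i"
proof -
  have "linear_map K R F (\<lambda>r. \<Oplus>\<^bsub>F\<^esub>n\<in>{n. hcomp R r n \<noteq> \<zero>}. N +>\<^bsub>E\<^esub> e n (hcomp R r n))"
    using incl_linear_homog
    by (rule hcomp_sum_linear[where t = "\<lambda>n r. N +>\<^bsub>E\<^esub> e n r", OF F.V.module_axioms])
  then show ?thesis unfolding ext_incl_def[abs_def] e_def .
qed

lemma incl_alg_hom: "alg_hom K R F i"
proof (rule alg_hom_on_homogI[OF F.k_algebra_axioms incl_linear])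
  show "i \<one> = \<one>\<^bsub>F\<^esub>"
    using coset_one alg_hom_one[OF proj] incl_homog[OF one_homog] by simp
  fix p q r s assume r: "r \<in> homog R p" and s: "s \<in> homog R q"
  show "i (r \<otimes> s) = i r \<otimes>\<^bsub>F\<^esub> i s"
    using coset_mult[OF r s] alg_hom_mult[OF proj e_closed[OF r] e_closed[OF s]]
      incl_homog[OF r] incl_homog[OF s] incl_homog[OF mult_homog[OF r s]] by simp
qed

lemma var_homog: "\<alpha> \<in> \<Lambda> \<Longrightarrow> y \<alpha> \<in> homog F (deg \<alpha>)"
  using graded_generated_homog[OF F_generated, of "Inr \<alpha>"] by (simp add: ext_gens_def ext_var_def)

text \<open>The universal property of the free product, from the presentation: every relation holds
  in \<open>B\<close> because \<open>f\<close> is an algebra map.\<close>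

lemma free_ext_lift:
  assumes "k_algebra K B" "alg_hom K R B f" "\<And>\<alpha>. \<alpha> \<in> \<Lambda> \<Longrightarrow> w \<alpha> \<in> carrier B"
  obtains G where "alg_hom K F B G" "\<And>r. r \<in> carrier R \<Longrightarrow> G (i r) = f r"
    "\<And>\<alpha>. \<alpha> \<in> \<Lambda> \<Longrightarrow> G (y \<alpha>) = w \<alpha>"
proof -
  interpret B: k_algebra K B by fact
  note f = alg_hom_linear[OF assms(2)]
  \<comment> \<open>The degree tag of a generator coming from R is forgotten.\<close>
  define v where "v = case_sum (\<lambda>(n::int, r). f r) w"
  have vc: "v g \<in> carrier B" if "g \<in> ext_gens R \<Lambda>" for g
    using that assms(3) linear_map_closed[OF f] by (auto simp: ext_gens_def v_def homog_closed)
  obtain H where H: "alg_hom K E B H"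
    and Hv: "\<And>g. g \<in> ext_gens R \<Lambda> \<Longrightarrow> H (free_gen K g) = v g"
  proof (rule V.R.free_lift[OF assms(1), of "ext_gens R \<Lambda>" v gdeg, folded E_def])
    show "v g \<in> carrier B" if "g \<in> ext_gens R \<Lambda>" for g by (rule vc[OF that])
  qed (rule that)
  note Hlin = alg_hom_linear[OF H]
  have He: "H (e n r) = f r" if "r \<in> homog R n" for n r
    using Hv[of "Inl (n, r)"] that by (simp add: ext_gens_def e_def v_def)
  have Hdiff: "H (a \<ominus>\<^bsub>E\<^esub> b) = \<zero>\<^bsub>B\<^esub>" if "a \<in> carrier E" "b \<in> carrier E" "H a = H b" for a b
    using that linear_map_add[OF Hlin] linear_map_closed[OF Hlin]
      linear_map_minus[OF Hlin E.V.M.abelian_group_axioms B.V.M.abelian_group_axioms]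
    by (simp add: a_minus_def B.r_neg)
  have "H s = \<zero>\<^bsub>B\<^esub>" if "s \<in> rels" for s
    using that unfolding rels_def
  proof (elim UnE CollectE exE conjE singletonE; hypsubst)
    fix n r s assume r: "r \<in> homog R n" and s: "s \<in> homog R n"
    show "H (e n (r \<oplus> s) \<ominus>\<^bsub>E\<^esub> (e n r \<oplus>\<^bsub>E\<^esub> e n s)) = \<zero>\<^bsub>B\<^esub>"
      using e_closed[OF r] e_closed[OF s]
      by (intro Hdiff e_closed[OF homog_add[OF r s]] E.a_closed)
        (simp_all add: He[OF r] He[OF s] He[OF homog_add[OF r s]] linear_map_add[OF Hlin]
          linear_map_add[OF f homog_closed[OF r] homog_closed[OF s]])
  next
    fix n c r assume c: "c \<in> carrier K" and r: "r \<in> homog R n"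
    show "H (e n (c \<odot> r) \<ominus>\<^bsub>E\<^esub> c \<odot>\<^bsub>E\<^esub> e n r) = \<zero>\<^bsub>B\<^esub>"
      using c e_closed[OF r]
      by (intro Hdiff e_closed[OF homog_smult[OF c r]] E.V.smult_closed)
        (simp_all add: He[OF r] He[OF homog_smult[OF c r]] linear_map_smult[OF Hlin]
          linear_map_smult[OF f c homog_closed[OF r]])
  next
    fix p q r s assume r: "r \<in> homog R p" and s: "s \<in> homog R q"
    show "H (e (p + q) (r \<otimes> s) \<ominus>\<^bsub>E\<^esub> e p r \<otimes>\<^bsub>E\<^esub> e q s) = \<zero>\<^bsub>B\<^esub>"
      using e_closed[OF r] e_closed[OF s]
      by (intro Hdiff e_closed[OF mult_homog[OF r s]] E.m_closed)
        (simp_all add: He[OF r] He[OF s] He[OF mult_homog[OF r s]] alg_hom_mult[OF H]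
          alg_hom_mult[OF assms(2) homog_closed[OF r] homog_closed[OF s]])
  next
    show "H (e 0 \<one> \<ominus>\<^bsub>E\<^esub> \<one>\<^bsub>E\<^esub>) = \<zero>\<^bsub>B\<^esub>"
      using alg_hom_one[OF H] alg_hom_one[OF assms(2)] He[OF one_homog]
      by (intro Hdiff e_closed[OF one_homog] E.one_closed) simp
  qed
  then have "H a = \<zero>\<^bsub>B\<^esub>" if "a \<in> N" for a
    using alg_hom_genideal[OF E.k_algebra_axioms assms(1) H rels_closed, of a] that by (simp add: N_def)
  then obtain G where G: "alg_hom K F B G"
    and Gv: "\<And>a. a \<in> carrier E \<Longrightarrow> G (N +>\<^bsub>E\<^esub> a) = H a"
  using quot_lift[OF E.k_algebra_axioms assms(1) N.is_ideal H, folded free_ext_def] by metis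
  have "G (i r) = f r" if "r \<in> carrier R" for r
  proof (rule linear_eq_on_homog[OF linear_map_comp[OF incl_linear alg_hom_linear[OF G]] f
        B.V.M.abelian_group_axioms _ that])
    show "G (i r) = f r" if "r \<in> homog R n" for n r
      using Gv[OF e_closed[OF that]] He[OF that] by (simp add: incl_homog[OF that])
  qed
  moreover have "G (y \<alpha>) = w \<alpha>" if "\<alpha> \<in> \<Lambda>" for \<alpha>
  proof -
    have g: "Inr \<alpha> \<in> ext_gens R \<Lambda>" using that by (simp add: ext_gens_def)
    then show ?thesis
      using Gv[OF E.homog_closed[OF graded_generated_homog[OF E_generated g]]] Hv[OF g]
      by (simp add: ext_var_def v_def)
  qed
  ultimately show ?thesis using G that by blast
qed

end

section \<open>Extending the relations from generators\<close>

context dg_poisson_algebra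
begin

lemma bracket_closed: "\<lbrakk>a \<in> carrier A; b \<in> carrier A\<rbrakk> \<Longrightarrow> bracket A a b \<in> carrier A"
  using linear_map_closed[OF bracket_linear_right] .

lemma bracket_one_right:
  assumes "a \<in> homog A p"
  shows "bracket A a \<one> = \<zero>"
proof -
  have "bracket A a \<one> = bracket A a \<one> \<oplus> bracket A a \<one>"
    using bracket_mult[OF assms one_homog one_homog] bracket_closed[OF homog_closed[OF assms] one_closed]
    by simp
  then show ?thesis
    using bracket_closed[OF homog_closed[OF assms] one_closed] by (metis add.r_cancel_one')
qed

lemma bracket_one_left:
  assumes "b \<in> homog A q"
  shows "bracket A \<one> b = \<zero>"
  using antisymmetry[OF one_homog assms] bracket_one_right[OF assms] by simp

text \<open>Antisymmetry moves the product to the right argument, where \<open>bracket_mult\<close>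
  applies, and moves the resulting brackets back; graded commutativity then brings b in front of
  {a,c}, which has degree p + r.\<close>

lemma bracket_mult_left:
  assumes a: "a \<in> homog A p" and b: "b \<in> homog A q" and c: "c \<in> homog A r"
  shows "bracket A (a \<otimes> b) c = a \<otimes> bracket A b c \<oplus> koszul A (p * q) (b \<otimes> bracket A a c)"
proof -
  note cl = homog_closed[OF a] homog_closed[OF b] homog_closed[OF c]
    bracket_closed[OF homog_closed[OF a] homog_closed[OF c]]
    bracket_closed[OF homog_closed[OF b] homog_closed[OF c]]
  have "bracket A (a \<otimes> b) c = \<ominus> koszul A ((p + q) * r) (bracket A c (a \<otimes> b))"
    by (rule antisymmetry[OF mult_homog[OF a b] c])
  also have "bracket A c (a \<otimes> b) = (\<ominus> koszul A (r * p) (bracket A a c)) \<otimes> b \<oplus>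
      koszul A (r * p) (a \<otimes> (\<ominus> koszul A (r * q) (bracket A b c)))"
    unfolding bracket_mult[OF c a b] antisymmetry[OF c a] antisymmetry[OF c b] ..
  also have "\<dots> = \<ominus> koszul A (r * p) (koszul A ((p + r) * q) (b \<otimes> bracket A a c)) \<oplus>
      koszul A (r * p) (a \<otimes> (\<ominus> koszul A (r * q) (bracket A b c)))"
    using cl graded_commutative[OF bracket_degree[OF a c] b] by (simp add: l_minus koszul_mult_left)
  finally show ?thesis
    using cl by (cases "even p"; cases "even q"; cases "even r") (simp_all add: koszul_def ring_nf)
qed

lemma dif_closed: "a \<in> carrier A \<Longrightarrow> dif A a \<in> carrier A"
  using linear_map_closed[OF dif_linear] .

end

text \<open>The target is an ungraded algebra, and the bracket relations are assumed for generators
  only. It is instantiated both with the enveloping algebra and with an arbitrary target of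
  \<open>env_lift\<close>, which may be an algebra of dual numbers.\<close>

locale poisson_pair = R: dg_poisson_algebra K R + U: k_algebra K U
  for K :: "('k, 'm) ring_scheme" and R :: "('k, 'r, 'n) dgbalg_scheme"
    and U :: "('k, 'u, 'l) module_scheme" +
  fixes \<Lambda> :: "'i set" and deg :: "'i \<Rightarrow> int" and x :: "'i \<Rightarrow> 'r"
    and m h :: "'r \<Rightarrow> 'u"
  assumes R_gen: "graded_generated K R \<Lambda> x deg"
    and m_hom: "alg_hom K R U m"
    and h_lin: "linear_map K R U h"
    and h_mult: "\<lbrakk>a \<in> homog R p; b \<in> homog R q\<rbrakk> \<Longrightarrow>
      h (a \<otimes>\<^bsub>R\<^esub> b) = m a \<otimes>\<^bsub>U\<^esub> h b \<oplus>\<^bsub>U\<^esub> koszul U (p * q) (m b \<otimes>\<^bsub>U\<^esub> h a)"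
    and rel_m: "\<lbrakk>\<alpha> \<in> \<Lambda>; \<beta> \<in> \<Lambda>\<rbrakk> \<Longrightarrow>
      m (bracket R (x \<alpha>) (x \<beta>)) = signed_comm U (deg \<alpha> * deg \<beta>) (h (x \<alpha>)) (m (x \<beta>))"
    and rel_h: "\<lbrakk>\<alpha> \<in> \<Lambda>; \<beta> \<in> \<Lambda>\<rbrakk> \<Longrightarrow>
      h (bracket R (x \<alpha>) (x \<beta>)) = signed_comm U (deg \<alpha> * deg \<beta>) (h (x \<alpha>)) (h (x \<beta>))"
begin

lemmas m_lin = alg_hom_linear[OF m_hom]
lemmas m_closed = linear_map_closed[OF m_lin]
lemmas h_closed = linear_map_closed[OF h_lin]
lemmas ag = R.V.M.abelian_group_axioms U.V.M.abelian_group_axioms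
lemmas m_koszul = linear_map_koszul[OF m_lin ag]
lemmas h_koszul = linear_map_koszul[OF h_lin ag]
lemmas x_homog = graded_generated_homog[OF R_gen]

lemma h_one: "h \<one>\<^bsub>R\<^esub> = \<zero>\<^bsub>U\<^esub>"
proof -
  have "h \<one>\<^bsub>R\<^esub> = h \<one>\<^bsub>R\<^esub> \<oplus>\<^bsub>U\<^esub> h \<one>\<^bsub>R\<^esub>"
    using h_mult[OF R.one_homog R.one_homog] h_closed by (simp add: alg_hom_one[OF m_hom])
  then show ?thesis using h_closed[of "\<one>\<^bsub>R\<^esub>"] by (metis R.one_closed U.add.r_cancel_one')
qed

lemma m_signed_comm_zero: "\<lbrakk>a \<in> homog R p; b \<in> homog R q\<rbrakk> \<Longrightarrow> signed_comm U (p * q) (m a) (m b) = \<zero>\<^bsub>U\<^esub>"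
proof (rule U.signed_comm_eq_zero)
  assume a: "a \<in> homog R p" and b: "b \<in> homog R q"
  note cl = R.homog_closed[OF a] R.homog_closed[OF b]
  show "m a \<in> carrier U" "m b \<in> carrier U" using cl m_closed by auto
  show "m a \<otimes>\<^bsub>U\<^esub> m b = koszul U (p * q) (m b \<otimes>\<^bsub>U\<^esub> m a)"
    using cl R.graded_commutative[OF a b] m_koszul[of "b \<otimes>\<^bsub>R\<^esub> a" "p * q"]
    by (simp flip: alg_hom_mult[OF m_hom])
qed

text \<open>Composed with the homomorphism m, the derivation {a,-} and the commutator with h a obey
  the same Leibniz rule in b, so agreement on generators is enough.\<close>

lemma m_bracket_right:
  assumes a: "a \<in> homog R p"
    and base: "\<And>\<beta>. \<beta> \<in> \<Lambda> \<Longrightarrow> m (bracket R a (x \<beta>)) = signed_comm U (p * deg \<beta>) (h a) (m (x \<beta>))"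
    and b: "b \<in> homog R q"
  shows "m (bracket R a b) = signed_comm U (p * q) (h a) (m b)"
proof -
  note ac = R.homog_closed[OF a]
  note lin1 = linear_map_comp[OF R.bracket_linear_right[OF ac] m_lin]
  note lin2 = linear_map_comp[OF m_lin U.linear_signed_comm_right[OF h_closed[OF ac]]]
  show ?thesis
  proof (rule graded_generated_linear_eq[where g = "\<lambda>n b. signed_comm U (p * n) (h a) (m b)",
        OF R.graded_algebra_axioms R_gen ag(2) lin1 lin2 _ _ b], goal_cases one mult)
    case one
    then show ?case
      using h_closed[OF ac] linear_map_zero[OF m_lin ag]
      by (simp add: R.bracket_one_right[OF a] alg_hom_one[OF m_hom])
  next
    case (mult \<beta> n b)
    note cl = ac R.homog_closed[OF mult(2)] R.homog_closed[OF mult(3)]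
    note bcl = R.bracket_closed[OF cl(1,2)] R.bracket_closed[OF cl(1,3)]
    have "m (bracket R a (x \<beta> \<otimes>\<^bsub>R\<^esub> b)) =
        m (bracket R a (x \<beta>)) \<otimes>\<^bsub>U\<^esub> m b \<oplus>\<^bsub>U\<^esub> koszul U (p * deg \<beta>) (m (x \<beta>) \<otimes>\<^bsub>U\<^esub> m (bracket R a b))"
      using cl bcl
      by (simp add: R.bracket_mult[OF a mult(2,3)] alg_hom_add[OF m_hom] alg_hom_mult[OF m_hom] m_koszul)
    also have "\<dots> = signed_comm U (p * (deg \<beta> + n)) (h a) (m (x \<beta>) \<otimes>\<^bsub>U\<^esub> m b)"
      using cl m_closed h_closed by (simp add: base[OF mult(1)] mult(4) U.signed_comm_mult_right)
    finally show ?case using cl by (simp add: alg_hom_mult[OF m_hom])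
  qed
qed

text \<open>Induction on the left argument, generator case from \<open>m_bracket_right\<close>. The
  Leibniz rule of {-,b} is matched with the expansion of h of a product.\<close>

lemma m_bracket:
  assumes a: "a \<in> homog R p" and b: "b \<in> homog R q"
  shows "m (bracket R a b) = signed_comm U (p * q) (h a) (m b)"
proof -
  note bc = R.homog_closed[OF b]
  note lin1 = linear_map_comp[OF R.bracket_linear_left[OF bc] m_lin]
  note lin2 = linear_map_comp[OF h_lin U.linear_signed_comm_left[OF m_closed[OF bc]]]
  show ?thesis
  proof (rule graded_generated_linear_eq[where g = "\<lambda>n a. signed_comm U (n * q) (h a) (m b)",
        OF R.graded_algebra_axioms R_gen ag(2) lin1 lin2 _ _ a], goal_cases one mult)
    case one
    then show ?case
      using m_closed[OF bc] linear_map_zero[OF m_lin ag]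
      by (simp add: R.bracket_one_left[OF b] h_one)
  next
    case (mult \<alpha> n a)
    note cl = R.homog_closed[OF mult(2)] R.homog_closed[OF mult(3)] bc
    note bcl = R.bracket_closed[OF cl(1,3)] R.bracket_closed[OF cl(2,3)]
    note ucl = m_closed[OF cl(1)] m_closed[OF cl(2)] m_closed[OF cl(3)] h_closed[OF cl(1)] h_closed[OF cl(2)]
    have base: "m (bracket R (x \<alpha>) b) = signed_comm U (deg \<alpha> * q) (h (x \<alpha>)) (m b)"
      by (rule m_bracket_right[OF mult(2) rel_m[OF mult(1)] b])
    have "m (bracket R (x \<alpha> \<otimes>\<^bsub>R\<^esub> a) b) =
        m (x \<alpha>) \<otimes>\<^bsub>U\<^esub> signed_comm U (n * q) (h a) (m b) \<oplus>\<^bsub>U\<^esub>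
        koszul U (deg \<alpha> * n) (m a \<otimes>\<^bsub>U\<^esub> signed_comm U (deg \<alpha> * q) (h (x \<alpha>)) (m b))"
      using cl bcl
      by (simp add: R.bracket_mult_left[OF mult(2,3) b] alg_hom_add[OF m_hom] alg_hom_mult[OF m_hom]
          m_koszul base mult(4))
    \<comment> \<open>The commutator of m x h a with m b has a further term containing the
      commutator of m x with m b. It vanishes because the image of m is graded commutative; likewise
      for m a h x.\<close>
    also have "\<dots> = signed_comm U ((deg \<alpha> + n) * q) (m (x \<alpha>) \<otimes>\<^bsub>U\<^esub> h a) (m b) \<oplus>\<^bsub>U\<^esub>
        koszul U (deg \<alpha> * n) (signed_comm U ((n + deg \<alpha>) * q) (m a \<otimes>\<^bsub>U\<^esub> h (x \<alpha>)) (m b))"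
      using ucl by (simp add: U.signed_comm_mult_left m_signed_comm_zero[OF mult(2) b] m_signed_comm_zero[OF mult(3) b])
    also have "\<dots> = signed_comm U ((deg \<alpha> + n) * q) (h (x \<alpha> \<otimes>\<^bsub>R\<^esub> a)) (m b)"
      using ucl by (simp add: h_mult[OF mult(2,3)] U.signed_comm_add_left U.signed_comm_koszul_left add.commute)
    finally show ?case .
  qed
qed

text \<open>Here h is not multiplicative: h of {a,x} b and of x {a,b} also involves m of these
  brackets, which \<open>m_bracket\<close> turns into commutators.\<close>

lemma h_bracket_right:
  assumes a: "a \<in> homog R p"
    and base: "\<And>\<beta>. \<beta> \<in> \<Lambda> \<Longrightarrow> h (bracket R a (x \<beta>)) = signed_comm U (p * deg \<beta>) (h a) (h (x \<beta>))"
    and b: "b \<in> homog R q"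
  shows "h (bracket R a b) = signed_comm U (p * q) (h a) (h b)"
proof -
  note ac = R.homog_closed[OF a]
  note lin1 = linear_map_comp[OF R.bracket_linear_right[OF ac] h_lin]
  note lin2 = linear_map_comp[OF h_lin U.linear_signed_comm_right[OF h_closed[OF ac]]]
  show ?thesis
  proof (rule graded_generated_linear_eq[where g = "\<lambda>n b. signed_comm U (p * n) (h a) (h b)",
        OF R.graded_algebra_axioms R_gen ag(2) lin1 lin2 _ _ b], goal_cases one mult)
    case one
    then show ?case
      using h_closed[OF ac] linear_map_zero[OF h_lin ag]
      by (simp add: R.bracket_one_right[OF a] h_one)
  next
    case (mult \<beta> n b)
    note cl = ac R.homog_closed[OF mult(2)] R.homog_closed[OF mult(3)]
    note bcl = R.bracket_closed[OF cl(1,2)] R.bracket_closed[OF cl(1,3)]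
    note ucl = m_closed[OF cl(1)] m_closed[OF cl(2)] m_closed[OF cl(3)]
      h_closed[OF cl(1)] h_closed[OF cl(2)] h_closed[OF cl(3)]
    define s where "s = deg \<beta>"
    define A where "A = signed_comm U (p * s) (h a) (m (x \<beta>)) \<otimes>\<^bsub>U\<^esub> h b"
    \<comment> \<open>\<open>A\<close> and \<open>B\<close> arise from h({a,x} b), \<open>C\<close>
      and \<open>D\<close> from h(x {a,b}). Regrouped, \<open>A\<close> with \<open>C\<close> is the
      Leibniz expansion of the commutator of h a with m x h b, and \<open>D\<close> with
      \<open>B\<close> that of the commutator with m b h x.\<close>
    define B where "B = m b \<otimes>\<^bsub>U\<^esub> signed_comm U (p * s) (h a) (h (x \<beta>))"
    define C where "C = m (x \<beta>) \<otimes>\<^bsub>U\<^esub> signed_comm U (p * n) (h a) (h b)"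
    define D where "D = signed_comm U (p * n) (h a) (m b) \<otimes>\<^bsub>U\<^esub> h (x \<beta>)"
    have ABCD: "A \<in> carrier U" "B \<in> carrier U" "C \<in> carrier U" "D \<in> carrier U"
      using ucl by (simp_all add: A_def B_def C_def D_def)
    have 1: "h (bracket R a (x \<beta>) \<otimes>\<^bsub>R\<^esub> b) = A \<oplus>\<^bsub>U\<^esub> koszul U ((p + s) * n) B"
      using h_mult[OF R.bracket_degree[OF a mult(2)] mult(3)]
      by (simp add: m_bracket[OF a mult(2)] base[OF mult(1)] A_def B_def s_def)
    have 2: "h (x \<beta> \<otimes>\<^bsub>R\<^esub> bracket R a b) = C \<oplus>\<^bsub>U\<^esub> koszul U (s * (p + n)) D"
      using h_mult[OF mult(2) R.bracket_degree[OF a mult(3)]]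
      by (simp add: m_bracket[OF a mult(3)] mult(4) C_def D_def s_def)
    have "h (bracket R a (x \<beta> \<otimes>\<^bsub>R\<^esub> b)) =
        (A \<oplus>\<^bsub>U\<^esub> koszul U ((p + s) * n) B) \<oplus>\<^bsub>U\<^esub> koszul U (p * s) (C \<oplus>\<^bsub>U\<^esub> koszul U (s * (p + n)) D)"
      using cl bcl
      by (simp add: R.bracket_mult[OF a mult(2,3)] linear_map_add[OF h_lin] h_koszul 1 2 s_def)
    also have "\<dots> = (A \<oplus>\<^bsub>U\<^esub> koszul U (p * s) C) \<oplus>\<^bsub>U\<^esub> koszul U (s * n) (D \<oplus>\<^bsub>U\<^esub> koszul U (p * n) B)"
      using ABCD by (cases "even p"; cases "even s"; cases "even n") (simp_all add: koszul_def U.ring_nf)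
    also have "A \<oplus>\<^bsub>U\<^esub> koszul U (p * s) C = signed_comm U (p * (s + n)) (h a) (m (x \<beta>) \<otimes>\<^bsub>U\<^esub> h b)"
      using ucl by (simp add: A_def C_def U.signed_comm_mult_right)
    also have "D \<oplus>\<^bsub>U\<^esub> koszul U (p * n) B = signed_comm U (p * (n + s)) (h a) (m b \<otimes>\<^bsub>U\<^esub> h (x \<beta>))"
      using ucl by (simp add: B_def D_def U.signed_comm_mult_right)
    also have "signed_comm U (p * (s + n)) (h a) (m (x \<beta>) \<otimes>\<^bsub>U\<^esub> h b) \<oplus>\<^bsub>U\<^esub>
        koszul U (s * n) (signed_comm U (p * (n + s)) (h a) (m b \<otimes>\<^bsub>U\<^esub> h (x \<beta>))) =
        signed_comm U (p * (s + n)) (h a) (h (x \<beta> \<otimes>\<^bsub>R\<^esub> b))"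
      using ucl by (simp add: h_mult[OF mult(2,3)] U.signed_comm_add_right U.signed_comm_koszul_right add.commute s_def)
    finally show ?case by (simp add: s_def)
  qed
qed

text \<open>\<open>h_bracket_right\<close> is used twice: with a generator on the left it gives
  {x,a} for every a, antisymmetry turns this into {a,x}, and that is the base case needed for an
  arbitrary left argument.\<close>

lemma h_bracket:
  assumes a: "a \<in> homog R p" and b: "b \<in> homog R q"
  shows "h (bracket R a b) = signed_comm U (p * q) (h a) (h b)"
proof (rule h_bracket_right[OF a _ b])
  fix \<beta> assume \<beta>: "\<beta> \<in> \<Lambda>"
  note cl = R.homog_closed[OF a] R.homog_closed[OF x_homog[OF \<beta>]]
  have "h (bracket R a (x \<beta>)) = \<ominus>\<^bsub>U\<^esub> koszul U (p * deg \<beta>) (h (bracket R (x \<beta>) a))"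
    using cl R.bracket_closed[OF cl(2,1)] linear_map_minus[OF h_lin ag]
    by (simp add: R.antisymmetry[OF a x_homog[OF \<beta>]] h_koszul)
  also have "h (bracket R (x \<beta>) a) = signed_comm U (deg \<beta> * p) (h (x \<beta>)) (h a)"
    by (rule h_bracket_right[OF x_homog[OF \<beta>] rel_h[OF \<beta>] a])
  finally show "h (bracket R a (x \<beta>)) = signed_comm U (p * deg \<beta>) (h a) (h (x \<beta>))"
    using U.signed_comm_antisym[OF h_closed[OF cl(1)] h_closed[OF cl(2)]] by simp
qed

end

section \<open>The bilinear graded commutator\<close>

lemma graded_commutator_record_cong:
  assumes "carrier B = carrier A" "\<zero>\<^bsub>B\<^esub> = \<zero>\<^bsub>A\<^esub>" "add B = add A" "homog B = homog A"
    "monoid.mult B = monoid.mult A"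
  shows "graded_commutator B = graded_commutator A"
  by (intro ext) (simp add: graded_commutator_def a_minus_def finsum_record_cong[OF assms(1-3)]
      hcomp_record_cong[OF assms(1-4)] koszul_record_cong[OF assms(1-3)] a_inv_cong[OF assms(1-3)] assms)

context graded_algebra
begin

lemma linear_restrict_homog: "linear_map K A B f \<Longrightarrow> linear_map K (A\<lparr>carrier := homog A n\<rparr>) B f"
  by (simp add: linear_map_def Pi_iff homog_closed)

text \<open>The sign in \<open>graded_commutator\<close> couples both degrees, so its double sum is
  treated in two stages: the inner sum over components of b with the left degree p fixed, then the
  outer sum over components of a.\<close>

lemma inner_commutator_homog:
  assumes "a \<in> carrier A" "b \<in> homog A q"
  shows "(\<Oplus>n\<in>{n. hcomp A b n \<noteq> \<zero>}. signed_comm A (p * n) a (hcomp A b n)) = signed_comm A (p * q) a b"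
  by (rule hcomp_sum_homog[where t = "\<lambda>n. signed_comm A (p * n) a", OF V.M.abelian_group_axioms
        linear_restrict_homog[OF linear_signed_comm_right[OF assms(1)]] assms(2)])

lemma inner_commutator_linear_right:
  assumes "a \<in> carrier A"
  shows "linear_map K A A (\<lambda>b. \<Oplus>n\<in>{n. hcomp A b n \<noteq> \<zero>}. signed_comm A (p * n) a (hcomp A b n))"
  by (rule hcomp_sum_linear[where t = "\<lambda>n. signed_comm A (p * n) a", OF V.module_axioms
        linear_restrict_homog[OF linear_signed_comm_right[OF assms]]])

text \<open>The index set depends on b alone, so induction over this finite set presents the map as
  a sum of maps linear in a.\<close>

lemma inner_commutator_linear_left:
  assumes b: "b \<in> carrier A"
  shows "linear_map K A A (\<lambda>a. \<Oplus>n\<in>{n. hcomp A b n \<noteq> \<zero>}. signed_comm A (p * n) a (hcomp A b n))"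
proof -
  have "linear_map K A A (\<lambda>a. \<Oplus>n\<in>S. signed_comm A (p * n) a (hcomp A b n))" if "finite S" for S
    using that
  proof induction
    case empty
    show ?case by (rule linear_mapI) auto
  next
    case (insert n S)
    have "linear_map K A A (\<lambda>a. signed_comm A (p * n) a (hcomp A b n) \<oplus> (\<Oplus>n\<in>S. signed_comm A (p * n) a (hcomp A b n)))"
      using insert b by (intro linear_map_plus V.module_axioms linear_signed_comm_left hcomp_closed)
    moreover have "(\<Oplus>n\<in>insert n S. signed_comm A (p * n) a (hcomp A b n)) =
        signed_comm A (p * n) a (hcomp A b n) \<oplus> (\<Oplus>n\<in>S. signed_comm A (p * n) a (hcomp A b n))"
      if "a \<in> carrier A" for a
      using insert b that by (intro finsum_insert) auto
    ultimately show ?case by (simp add: linear_map_def Pi_iff)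
  qed
  then show ?thesis using hcomp_finite[OF b] by blast
qed

lemma graded_commutator_signed_comm:
  "graded_commutator A a b = (\<Oplus>p\<in>{p. hcomp A a p \<noteq> \<zero>}. \<Oplus>q\<in>{q. hcomp A b q \<noteq> \<zero>}.
     signed_comm A (p * q) (hcomp A a p) (hcomp A b q))"
  by (simp add: graded_commutator_def signed_comm_def)

lemma graded_commutator_linear_left:
  assumes "b \<in> carrier A"
  shows "linear_map K A A (\<lambda>a. graded_commutator A a b)"
  unfolding graded_commutator_signed_comm
  by (rule hcomp_sum_linear[where t = "\<lambda>p a. \<Oplus>q\<in>{q. hcomp A b q \<noteq> \<zero>}. signed_comm A (p * q) a (hcomp A b q)",
        OF V.module_axioms linear_restrict_homog[OF inner_commutator_linear_left[OF assms]]])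

lemma graded_commutator_homog_left:
  assumes "a \<in> homog A p" "b \<in> carrier A"
  shows "graded_commutator A a b = (\<Oplus>q\<in>{q. hcomp A b q \<noteq> \<zero>}. signed_comm A (p * q) a (hcomp A b q))"
  unfolding graded_commutator_signed_comm
  by (rule hcomp_sum_homog[where t = "\<lambda>p a. \<Oplus>q\<in>{q. hcomp A b q \<noteq> \<zero>}. signed_comm A (p * q) a (hcomp A b q)",
        OF V.M.abelian_group_axioms
        linear_restrict_homog[OF inner_commutator_linear_left[OF assms(2)]] assms(1)])

lemma graded_commutator_homog:
  assumes "a \<in> homog A p" "b \<in> homog A q"
  shows "graded_commutator A a b = signed_comm A (p * q) a b"
  using graded_commutator_homog_left[OF assms(1) homog_closed[OF assms(2)]]
    inner_commutator_homog[OF homog_closed[OF assms(1)] assms(2), of p] by simp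

lemma linear_map_homog_cong:
  assumes "linear_map K A B f" "\<And>a. a \<in> carrier A \<Longrightarrow> g a = f a"
  shows "linear_map K A B g"
  using assms by (simp add: linear_map_def Pi_iff)

lemma graded_commutator_linear_right:
  assumes "a \<in> homog A p"
  shows "linear_map K A A (graded_commutator A a)"
  by (rule linear_map_homog_cong[OF inner_commutator_linear_right[OF homog_closed[OF assms]]
        graded_commutator_homog_left[OF assms]])

end

lemma (in graded_algebra) homog_finsum:
  assumes "\<And>s. s \<in> S \<Longrightarrow> f s \<in> homog A n"
  shows "finsum A f S \<in> homog A n"
  using assms
proof (induction S rule: infinite_finite_induct)
  case (insert s S)
  then have "f s \<in> homog A n" "finsum A f S \<in> homog A n" by auto
  moreover have "finsum A f (insert s S) = f s \<oplus> finsum A f S"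
    using insert homog_closed by (intro finsum_insert) blast+
  ultimately show ?case by (simp add: homog_add)
qed (simp_all add: homog_zero)

section \<open>The enveloping algebra as a graded algebra\<close>

text \<open>Freeness of R as a graded commutative algebra enters through \<open>R_gen\<close> and
  \<open>partial_derivative\<close>; R is otherwise any DG Poisson algebra.\<close>

locale envelope = dg_poisson_algebra K R
  for K :: "('k, 'm) ring_scheme" and R :: "('k, 'r, 'n) dgbalg_scheme" (structure) +
  fixes \<Lambda> :: "'i set" and deg :: "'i \<Rightarrow> int" and x :: "'i \<Rightarrow> 'r" and I :: "'r set"
  assumes R_gen: "graded_generated K R \<Lambda> x deg"
    and partial_derivative: "\<alpha> \<in> \<Lambda> \<Longrightarrow> \<exists>D. linear_map K R R D \<and>
      (\<forall>\<beta>\<in>\<Lambda>. D (x \<beta>) = (if \<alpha> = \<beta> then \<one> else \<zero>)) \<and>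
      (\<forall>p q. \<forall>a\<in>homog R p. \<forall>b\<in>homog R q.
        D (a \<otimes> b) = a \<otimes> D b \<oplus> koszul R (p * q) (b \<otimes> D a))"
    and poisson_ideal: "dg_poisson_ideal R I"
begin

sublocale free_extension K R \<Lambda> deg ..

section \<open>The partial derivatives and the map \<open>\<psi>\<close>\<close>

abbreviation "\<delta> \<equiv> psi_comp K R \<Lambda> x"
abbreviation "\<psi> \<equiv> psi K R \<Lambda> deg x"
abbreviation "J \<equiv> env_ideal K R \<Lambda> deg x I"
abbreviation "U \<equiv> env_galg K R \<Lambda> deg x I"

lemmas x_homog = graded_generated_homog[OF R_gen]
lemmas x_closed = homog_closed[OF x_homog]
lemmas ag_R = V.M.abelian_group_axioms
lemmas ag_F = F.V.M.abelian_group_axioms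
lemmas i_closed = linear_map_closed[OF incl_linear]
lemmas y_closed = F.homog_closed[OF var_homog]

text \<open>Existence of a map with these properties makes the choice in \<open>psi_comp\<close>
  satisfy them.\<close>

lemma delta:
  assumes "\<alpha> \<in> \<Lambda>"
  shows delta_linear: "linear_map K R R (\<delta> \<alpha>)"
    and delta_gen: "\<And>\<beta>. \<beta> \<in> \<Lambda> \<Longrightarrow> \<delta> \<alpha> (x \<beta>) = (if \<alpha> = \<beta> then \<one> else \<zero>)"
    and delta_mult: "\<And>a b p q. \<lbrakk>a \<in> homog R p; b \<in> homog R q\<rbrakk> \<Longrightarrow>
      \<delta> \<alpha> (a \<otimes> b) = a \<otimes> \<delta> \<alpha> b \<oplus> koszul R (p * q) (b \<otimes> \<delta> \<alpha> a)"
  using someI_ex[OF partial_derivative[OF assms]] unfolding psi_comp_def[symmetric] by blast+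

lemmas delta_closed = linear_map_closed[OF delta_linear]

lemma delta_one: "\<alpha> \<in> \<Lambda> \<Longrightarrow> \<delta> \<alpha> \<one> = \<zero>"
  using delta_mult[OF _ one_homog one_homog, of \<alpha>] delta_closed[of \<alpha> \<one>]
    add.r_cancel_one[of "\<delta> \<alpha> \<one>" "\<delta> \<alpha> \<one>"] by simp

lemma delta_homog:
  assumes \<alpha>: "\<alpha> \<in> \<Lambda>" and a: "a \<in> homog R n"
  shows "\<delta> \<alpha> a \<in> homog R (n - deg \<alpha>)"
  using graded_algebra_axioms R_gen a
proof (induction rule: graded_generated_induct)
  case one
  then show ?case using delta_one[OF \<alpha>] by (simp add: homog_zero)
next
  case (zero n)
  then show ?case by (simp add: linear_map_zero[OF delta_linear[OF \<alpha>] ag_R ag_R] homog_zero)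
next
  case (mult \<beta> n a)
  have 1: "x \<beta> \<otimes> \<delta> \<alpha> a \<in> homog R (deg \<beta> + n - deg \<alpha>)"
    using mult_homog[OF mult(2,4)] by (simp add: algebra_simps)
  \<comment> \<open>The factor is 1 for \<alpha> = \<beta>, when the stated degree is just n, and 0
    otherwise.\<close>
  have 2: "a \<otimes> \<delta> \<alpha> (x \<beta>) \<in> homog R (deg \<beta> + n - deg \<alpha>)"
    using mult(3) homog_closed[OF mult(3)] by (simp add: delta_gen[OF \<alpha> mult(1)] homog_zero)
  show ?case
    unfolding delta_mult[OF \<alpha> mult(2,3)] using 1 2 by (intro homog_add homog_koszul)
next
  case (add n a b)
  then show ?case
    using linear_map_add[OF delta_linear[OF \<alpha>] homog_closed[OF add(1)] homog_closed[OF add(2)]]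
    by (simp add: homog_add)
next
  case (smult n c a)
  then show ?case
    using linear_map_smult[OF delta_linear[OF \<alpha>] smult(1) homog_closed[OF smult(2)]]
    by (simp add: homog_smult)
qed

lemma delta_zero: "\<alpha> \<in> \<Lambda> \<Longrightarrow> \<delta> \<alpha> \<zero> = \<zero>"
  by (rule linear_map_zero[OF delta_linear ag_R ag_R])

lemma delta_finite_add:
  assumes "a \<in> carrier R" "b \<in> carrier R"
    and "finite {\<alpha> \<in> \<Lambda>. \<delta> \<alpha> a \<noteq> \<zero>}" "finite {\<alpha> \<in> \<Lambda>. \<delta> \<alpha> b \<noteq> \<zero>}"
  shows "finite {\<alpha> \<in> \<Lambda>. \<delta> \<alpha> (a \<oplus> b) \<noteq> \<zero>}"
proof (rule finite_subset)
  show "{\<alpha> \<in> \<Lambda>. \<delta> \<alpha> (a \<oplus> b) \<noteq> \<zero>} \<subseteq> {\<alpha> \<in> \<Lambda>. \<delta> \<alpha> a \<noteq> \<zero>} \<union> {\<alpha> \<in> \<Lambda>. \<delta> \<alpha> b \<noteq> \<zero>}"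
    using linear_map_add[OF delta_linear assms(1,2)] by auto
qed (use assms in simp)

lemma delta_finite_homog:
  assumes "a \<in> homog R n"
  shows "finite {\<alpha> \<in> \<Lambda>. \<delta> \<alpha> a \<noteq> \<zero>}"
  using graded_algebra_axioms R_gen assms
proof (induction rule: graded_generated_induct)
  case one
  have "{\<alpha> \<in> \<Lambda>. \<delta> \<alpha> \<one> \<noteq> \<zero>} = {}" using delta_one by blast
  then show ?case by (simp only: finite.emptyI)
next
  case (zero n)
  have "{\<alpha> \<in> \<Lambda>. \<delta> \<alpha> \<zero> \<noteq> \<zero>} = {}" using delta_zero by blast
  then show ?case by (simp only: finite.emptyI)
next
  case (mult \<beta> n a)
  \<comment> \<open>Multiplying by x_\<beta> can make only the derivative along \<beta> newly
    nonzero.\<close>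
  have "{\<alpha> \<in> \<Lambda>. \<delta> \<alpha> (x \<beta> \<otimes> a) \<noteq> \<zero>} \<subseteq> insert \<beta> {\<alpha> \<in> \<Lambda>. \<delta> \<alpha> a \<noteq> \<zero>}"
  proof
    fix \<alpha> assume "\<alpha> \<in> {\<alpha> \<in> \<Lambda>. \<delta> \<alpha> (x \<beta> \<otimes> a) \<noteq> \<zero>}"
    then have \<alpha>: "\<alpha> \<in> \<Lambda>" "\<delta> \<alpha> (x \<beta> \<otimes> a) \<noteq> \<zero>" by auto
    show "\<alpha> \<in> insert \<beta> {\<alpha> \<in> \<Lambda>. \<delta> \<alpha> a \<noteq> \<zero>}"
      using \<alpha>(2) delta_gen[OF \<alpha>(1) mult(1)] homog_closed[OF mult(2)] homog_closed[OF mult(3)] \<alpha>(1)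
      by (cases "\<alpha> = \<beta>"; cases "\<delta> \<alpha> a = \<zero>") (simp_all add: delta_mult[OF \<alpha>(1) mult(2,3)])
  qed
  then show ?case using mult(4) finite_subset by blast
next
  case (add n a b)
  then show ?case by (intro delta_finite_add homog_closed)
next
  case (smult n c a)
  have "{\<alpha> \<in> \<Lambda>. \<delta> \<alpha> (c \<odot> a) \<noteq> \<zero>} \<subseteq> {\<alpha> \<in> \<Lambda>. \<delta> \<alpha> a \<noteq> \<zero>}"
    using linear_map_smult[OF delta_linear smult(1) homog_closed[OF smult(2)]] smult(1) by auto
  then show ?case using smult(3) finite_subset by blast
qed

lemma delta_finite:
  assumes "a \<in> carrier R"
  shows "finite {\<alpha> \<in> \<Lambda>. \<delta> \<alpha> a \<noteq> \<zero>}"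
  using assms
proof (induction a rule: homog_induct)
  case zero
  show ?case by (rule delta_finite_homog[OF homog_zero])
next
  case (add n a b)
  show ?case
    by (rule delta_finite_add[OF homog_closed[OF add(1)] add(2) delta_finite_homog[OF add(1)] add(3)])
qed

lemma psi_term_closed: "\<lbrakk>\<alpha> \<in> \<Lambda>; a \<in> carrier R\<rbrakk> \<Longrightarrow> i (\<delta> \<alpha> a) \<otimes>\<^bsub>F\<^esub> y \<alpha> \<in> carrier F"
  by (intro F.m_closed i_closed delta_closed y_closed)

text \<open>Terms with vanishing derivative are zero, so values of \<open>\<psi>\<close> at several
  arguments can be written over one index set.\<close>

lemma psi_pad:
  assumes "a \<in> carrier R" "finite S" "S \<subseteq> \<Lambda>" "{\<alpha> \<in> \<Lambda>. \<delta> \<alpha> a \<noteq> \<zero>} \<subseteq> S"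
  shows "\<psi> a = (\<Oplus>\<^bsub>F\<^esub>\<alpha>\<in>S. i (\<delta> \<alpha> a) \<otimes>\<^bsub>F\<^esub> y \<alpha>)"
  unfolding psi_def
proof (rule F.add.finprod_mono_neutral_cong_left[OF assms(2,4)])
  show "(\<lambda>\<alpha>. i (\<delta> \<alpha> a) \<otimes>\<^bsub>F\<^esub> y \<alpha>) \<in> S \<rightarrow> carrier F"
    using psi_term_closed assms(1,3) by blast
  fix \<alpha> assume "\<alpha> \<in> S - {\<alpha> \<in> \<Lambda>. \<delta> \<alpha> a \<noteq> \<zero>}"
  then have "\<alpha> \<in> \<Lambda>" "\<delta> \<alpha> a = \<zero>" using assms(3) by auto
  then show "i (\<delta> \<alpha> a) \<otimes>\<^bsub>F\<^esub> y \<alpha> = \<zero>\<^bsub>F\<^esub>"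
    using linear_map_zero[OF incl_linear ag_R ag_F] y_closed by simp
qed simp

lemma psi_linear: "linear_map K R F \<psi>"
proof -
  have lin: "linear_map K R F (\<lambda>r. i r \<otimes>\<^bsub>F\<^esub> y \<alpha>)" if "\<alpha> \<in> \<Lambda>" for \<alpha>
    by (rule linear_map_comp[OF incl_linear F.linear_rmult[OF y_closed[OF that]]])
  show ?thesis
    unfolding psi_def[abs_def]
    by (rule linear_map_supp_sum[where C = "\<lambda>_. carrier R" and c = \<delta> and t = "\<lambda>\<alpha> r. i r \<otimes>\<^bsub>F\<^esub> y \<alpha>"
          and L = R, OF V.module_axioms V.module_axioms F.V.module_axioms delta_linear delta_closed _ delta_finite])
      (use lin in \<open>simp_all add: linear_map_def\<close>)
qed

lemmas psi_closed = linear_map_closed[OF psi_linear]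

text \<open>The rule is inherited from each partial derivative term by term: the variables stand on
  the right, so i a and i b factor out on the left.\<close>

lemma psi_mult:
  assumes a: "a \<in> homog R p" and b: "b \<in> homog R q"
  shows "\<psi> (a \<otimes> b) = i a \<otimes>\<^bsub>F\<^esub> \<psi> b \<oplus>\<^bsub>F\<^esub> koszul F (p * q) (i b \<otimes>\<^bsub>F\<^esub> \<psi> a)"
proof -
  note ac = homog_closed[OF a] and bc = homog_closed[OF b]
  define S where "S = {\<alpha> \<in> \<Lambda>. \<delta> \<alpha> a \<noteq> \<zero>} \<union> {\<alpha> \<in> \<Lambda>. \<delta> \<alpha> b \<noteq> \<zero>} \<union> {\<alpha> \<in> \<Lambda>. \<delta> \<alpha> (a \<otimes> b) \<noteq> \<zero>}"
  have S: "finite S" "S \<subseteq> \<Lambda>"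
    using delta_finite[OF ac] delta_finite[OF bc] delta_finite[OF m_closed[OF ac bc]] by (auto simp: S_def)
  let ?t = "\<lambda>c \<alpha>. i (\<delta> \<alpha> c) \<otimes>\<^bsub>F\<^esub> y \<alpha>"
  have pad: "\<psi> a = finsum F (?t a) S" "\<psi> b = finsum F (?t b) S" "\<psi> (a \<otimes> b) = finsum F (?t (a \<otimes> b)) S"
    using S ac bc by (intro psi_pad; auto simp: S_def)+
  have tc: "?t c \<in> S \<rightarrow> carrier F" if "c \<in> carrier R" for c
    using psi_term_closed[OF _ that] S(2) by blast
  have la: "linear_map K F F (\<lambda>u. i a \<otimes>\<^bsub>F\<^esub> u)" by (rule F.linear_lmult[OF i_closed[OF ac]])
  have lb: "linear_map K F F (\<lambda>u. koszul F (p * q) (i b \<otimes>\<^bsub>F\<^esub> u))"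
    by (rule linear_map_comp[OF F.linear_lmult[OF i_closed[OF bc]] F.linear_koszul])
  have "\<psi> (a \<otimes> b) = (\<Oplus>\<^bsub>F\<^esub>\<alpha>\<in>S. i a \<otimes>\<^bsub>F\<^esub> ?t b \<alpha> \<oplus>\<^bsub>F\<^esub> koszul F (p * q) (i b \<otimes>\<^bsub>F\<^esub> ?t a \<alpha>))"
    unfolding pad
  proof (rule F.finsum_cong')
    show "(\<lambda>\<alpha>. i a \<otimes>\<^bsub>F\<^esub> ?t b \<alpha> \<oplus>\<^bsub>F\<^esub> koszul F (p * q) (i b \<otimes>\<^bsub>F\<^esub> ?t a \<alpha>)) \<in> S \<rightarrow> carrier F"
      using tc[OF ac] tc[OF bc] i_closed[OF ac] i_closed[OF bc] by (simp add: Pi_iff)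
    fix \<alpha> assume "\<alpha> \<in> S"
    then have \<alpha>: "\<alpha> \<in> \<Lambda>" using S by blast
    note d = delta_closed[OF \<alpha> ac] delta_closed[OF \<alpha> bc]
    have "i (\<delta> \<alpha> (a \<otimes> b)) = i a \<otimes>\<^bsub>F\<^esub> i (\<delta> \<alpha> b) \<oplus>\<^bsub>F\<^esub> koszul F (p * q) (i b \<otimes>\<^bsub>F\<^esub> i (\<delta> \<alpha> a))"
      using ac bc d linear_map_koszul[OF incl_linear ag_R ag_F]
      by (simp add: delta_mult[OF \<alpha> a b] alg_hom_add[OF incl_alg_hom] alg_hom_mult[OF incl_alg_hom])
    then show "?t (a \<otimes> b) \<alpha> = i a \<otimes>\<^bsub>F\<^esub> ?t b \<alpha> \<oplus>\<^bsub>F\<^esub> koszul F (p * q) (i b \<otimes>\<^bsub>F\<^esub> ?t a \<alpha>)"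
      using i_closed[OF ac] i_closed[OF bc] i_closed[OF d(1)] i_closed[OF d(2)] y_closed[OF \<alpha>]
      by (simp add: F.l_distr F.koszul_mult_left F.m_assoc)
  qed simp
  also have "\<dots> = (\<Oplus>\<^bsub>F\<^esub>\<alpha>\<in>S. i a \<otimes>\<^bsub>F\<^esub> ?t b \<alpha>) \<oplus>\<^bsub>F\<^esub> (\<Oplus>\<^bsub>F\<^esub>\<alpha>\<in>S. koszul F (p * q) (i b \<otimes>\<^bsub>F\<^esub> ?t a \<alpha>))"
    using tc[OF ac] tc[OF bc] i_closed[OF ac] i_closed[OF bc]
    by (intro F.finsum_addf) (simp_all add: Pi_iff)
  also have "(\<Oplus>\<^bsub>F\<^esub>\<alpha>\<in>S. i a \<otimes>\<^bsub>F\<^esub> ?t b \<alpha>) = i a \<otimes>\<^bsub>F\<^esub> \<psi> b"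
    unfolding pad by (rule linear_map_finsum[OF la ag_F ag_F tc[OF bc], symmetric])
  also have "(\<Oplus>\<^bsub>F\<^esub>\<alpha>\<in>S. koszul F (p * q) (i b \<otimes>\<^bsub>F\<^esub> ?t a \<alpha>)) = koszul F (p * q) (i b \<otimes>\<^bsub>F\<^esub> \<psi> a)"
    unfolding pad by (rule linear_map_finsum[OF lb ag_F ag_F tc[OF ac], symmetric])
  finally show ?thesis .
qed

lemma psi_gen:
  assumes \<beta>: "\<beta> \<in> \<Lambda>"
  shows "\<psi> (x \<beta>) = y \<beta>"
proof -
  have "\<psi> (x \<beta>) = (\<Oplus>\<^bsub>F\<^esub>\<alpha>\<in>{\<beta>}. i (\<delta> \<alpha> (x \<beta>)) \<otimes>\<^bsub>F\<^esub> y \<alpha>)"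
    using delta_gen[OF _ \<beta>] \<beta> by (intro psi_pad x_closed) (auto split: if_splits)
  also have "\<dots> = i \<one> \<otimes>\<^bsub>F\<^esub> y \<beta>"
    using delta_gen[OF \<beta> \<beta>] y_closed[OF \<beta>] i_closed[of \<one>] by simp
  finally show ?thesis using y_closed[OF \<beta>] by (simp add: alg_hom_one[OF incl_alg_hom])
qed

lemma psi_graded:
  assumes "a \<in> homog R n"
  shows "\<psi> a \<in> homog F n"
  unfolding psi_def
proof (rule F.homog_finsum)
  fix \<alpha> assume "\<alpha> \<in> {\<alpha> \<in> \<Lambda>. \<delta> \<alpha> a \<noteq> \<zero>}"
  then have \<alpha>: "\<alpha> \<in> \<Lambda>" by simp
  show "i (\<delta> \<alpha> a) \<otimes>\<^bsub>F\<^esub> y \<alpha> \<in> homog F n"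
    using F.mult_homog[OF incl_graded[OF delta_homog[OF \<alpha> assms]] var_homog[OF \<alpha>]] by simp
qed

section \<open>The ideal \<open>J\<close> and its homogeneity\<close>

definition erels where
  "erels = i ` I \<union> \<psi> ` I \<union>
    {signed_comm F (deg \<alpha> * deg \<beta>) (y \<alpha>) (y \<beta>) \<ominus>\<^bsub>F\<^esub> \<psi> (bracket R (x \<alpha>) (x \<beta>)) | \<alpha> \<beta>. \<alpha> \<in> \<Lambda> \<and> \<beta> \<in> \<Lambda>} \<union>
    {signed_comm F (deg \<alpha> * deg \<beta>) (y \<alpha>) (i (x \<beta>)) \<ominus>\<^bsub>F\<^esub> i (bracket R (x \<alpha>) (x \<beta>)) | \<alpha> \<beta>. \<alpha> \<in> \<Lambda> \<and> \<beta> \<in> \<Lambda>}"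

lemma J_def: "J = Idl\<^bsub>F\<^esub> erels"
  by (simp add: env_ideal_def erels_def signed_comm_def Let_def)

sublocale I: ideal I R
  using poisson_ideal by (simp add: dg_poisson_ideal_def)

lemma I_hcomp: "a \<in> I \<Longrightarrow> hcomp R a n \<in> I"
  and I_dif: "a \<in> I \<Longrightarrow> dif R a \<in> I"
  and I_bracket: "\<lbrakk>a \<in> I; b \<in> carrier R\<rbrakk> \<Longrightarrow> bracket R a b \<in> I"
  using poisson_ideal by (simp_all add: dg_poisson_ideal_def)

lemmas bracket_gens = bracket_degree[OF x_homog x_homog]
lemmas bracket_gens_closed = homog_closed[OF bracket_gens]

lemma rel_h_homog:
  "\<lbrakk>\<alpha> \<in> \<Lambda>; \<beta> \<in> \<Lambda>\<rbrakk> \<Longrightarrow> signed_comm F (deg \<alpha> * deg \<beta>) (y \<alpha>) (y \<beta>) \<ominus>\<^bsub>F\<^esub> \<psi> (bracket R (x \<alpha>) (x \<beta>))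
    \<in> homog F (deg \<alpha> + deg \<beta>)"
  by (intro F.homog_diff F.signed_comm_homog var_homog psi_graded bracket_gens)

lemma rel_m_homog:
  "\<lbrakk>\<alpha> \<in> \<Lambda>; \<beta> \<in> \<Lambda>\<rbrakk> \<Longrightarrow> signed_comm F (deg \<alpha> * deg \<beta>) (y \<alpha>) (i (x \<beta>)) \<ominus>\<^bsub>F\<^esub> i (bracket R (x \<alpha>) (x \<beta>))
    \<in> homog F (deg \<alpha> + deg \<beta>)"
  by (intro F.homog_diff F.signed_comm_homog var_homog incl_graded bracket_gens x_homog)

lemma erels_cases [consumes 1]:
  assumes "s \<in> erels"
  obtains (i) r where "r \<in> I" "s = i r" | (psi) r where "r \<in> I" "s = \<psi> r"
  | (h) \<alpha> \<beta> where "\<alpha> \<in> \<Lambda>" "\<beta> \<in> \<Lambda>"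
      "s = signed_comm F (deg \<alpha> * deg \<beta>) (y \<alpha>) (y \<beta>) \<ominus>\<^bsub>F\<^esub> \<psi> (bracket R (x \<alpha>) (x \<beta>))"
  | (m) \<alpha> \<beta> where "\<alpha> \<in> \<Lambda>" "\<beta> \<in> \<Lambda>"
      "s = signed_comm F (deg \<alpha> * deg \<beta>) (y \<alpha>) (i (x \<beta>)) \<ominus>\<^bsub>F\<^esub> i (bracket R (x \<alpha>) (x \<beta>))"
  using assms unfolding erels_def by blast

lemma erels_closed: "erels \<subseteq> carrier F"
proof
  fix s assume "s \<in> erels"
  then show "s \<in> carrier F"
  proof (cases rule: erels_cases)
    case (i r)
    then show ?thesis using i_closed[OF I.Icarr] by blast
  next
    case (psi r)
    then show ?thesis using psi_closed[OF I.Icarr] by blast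
  next
    case (h \<alpha> \<beta>)
    then show ?thesis using F.homog_closed[OF rel_h_homog] by blast
  next
    case (m \<alpha> \<beta>)
    then show ?thesis using F.homog_closed[OF rel_m_homog] by blast
  qed
qed

sublocale J: ideal J F
  unfolding J_def by (rule F.genideal_ideal[OF erels_closed])

lemma erels_J: "s \<in> erels \<Longrightarrow> s \<in> J"
  unfolding J_def using F.genideal_self[OF erels_closed] by blast

text \<open>The generators coming from I need not be homogeneous, so \<open>genideal_homog\<close>
  does not apply. Their components are again generators, since I is closed under components and i
  and \<open>\<psi>\<close> preserve degrees.\<close>

lemma J_hcomp: "u \<in> J \<Longrightarrow> hcomp F u n \<in> J"
proof -
  have hom: "hcomp F s n \<in> J" if s: "s \<in> homog F k" "s \<in> J" for s n k
    using s(2) J.zero_closed by (simp add: F.hcomp_of_homog[OF s(1)])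
  have "hcomp F s n \<in> Idl\<^bsub>F\<^esub> erels" if s: "s \<in> erels" for s n
    unfolding J_def[symmetric]
    using s
  proof (cases rule: erels_cases)
    case (i r)
    then have "hcomp F s n = i (hcomp R r n)"
      using graded_linear_hcomp[OF graded_algebra_axioms F.graded_algebra_axioms incl_linear incl_graded
          I.Icarr] by blast
    moreover have "i (hcomp R r n) \<in> erels" using I_hcomp[OF i(1)] by (auto simp: erels_def)
    ultimately show "hcomp F s n \<in> J" using erels_J by simp
  next
    case (psi r)
    then have "hcomp F s n = \<psi> (hcomp R r n)"
      using graded_linear_hcomp[OF graded_algebra_axioms F.graded_algebra_axioms psi_linear psi_graded
          I.Icarr] by blast
    moreover have "\<psi> (hcomp R r n) \<in> erels" using I_hcomp[OF psi(1)] by (auto simp: erels_def)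
    ultimately show "hcomp F s n \<in> J" using erels_J by simp
  next
    case (h \<alpha> \<beta>)
    show "hcomp F s n \<in> J" using hom[OF _ erels_J[OF s]] rel_h_homog[OF h(1,2)] h(3) by blast
  next
    case (m \<alpha> \<beta>)
    show "hcomp F s n \<in> J" using hom[OF _ erels_J[OF s]] rel_m_homog[OF m(1,2)] m(3) by blast
  qed
  then show "u \<in> J \<Longrightarrow> hcomp F u n \<in> J"
    unfolding J_def by (rule F.genideal_hcomp[OF erels_closed])
qed

section \<open>The quotient \<open>U\<close> and the maps \<open>m\<close> and \<open>h\<close> from
  R\<close>

sublocale U: graded_algebra K U
  unfolding env_galg_def by (rule quot_graded_algebra[OF F.graded_algebra_axioms J.is_ideal J_hcomp])

lemma Uproj: "alg_hom K F U (\<lambda>a. J +>\<^bsub>F\<^esub> a)"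
  unfolding env_galg_def by (rule quot_k_algebra(2)[OF F.k_algebra_axioms J.is_ideal])

lemma Uproj_graded: "a \<in> homog F n \<Longrightarrow> J +>\<^bsub>F\<^esub> a \<in> homog U n"
  unfolding env_galg_def quot_galg_simps by (rule imageI)

text \<open>Both maps start from R, where derivation arguments on generators are available;
  \<open>em_coset\<close> and \<open>eh_coset\<close> later relate them to the maps on R/I.\<close>

definition m :: "'r \<Rightarrow> (('i, 'r) ext_gen list \<Rightarrow> 'k) set set" where "m r = J +>\<^bsub>F\<^esub> i r"
definition h :: "'r \<Rightarrow> (('i, 'r) ext_gen list \<Rightarrow> 'k) set set" where "h r = J +>\<^bsub>F\<^esub> \<psi> r"

lemma m_hom: "alg_hom K R U m"
  unfolding m_def[abs_def] by (rule alg_hom_comp[OF incl_alg_hom Uproj])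

lemma h_lin: "linear_map K R U h"
  unfolding h_def[abs_def] by (rule linear_map_comp[OF psi_linear alg_hom_linear[OF Uproj]])

lemma m_graded: "a \<in> homog R n \<Longrightarrow> m a \<in> homog U n"
  unfolding m_def by (rule Uproj_graded[OF incl_graded])

lemma h_graded: "a \<in> homog R n \<Longrightarrow> h a \<in> homog U n"
  unfolding h_def by (rule Uproj_graded[OF psi_graded])

lemma h_mult:
  assumes a: "a \<in> homog R p" and b: "b \<in> homog R q"
  shows "h (a \<otimes> b) = m a \<otimes>\<^bsub>U\<^esub> h b \<oplus>\<^bsub>U\<^esub> koszul U (p * q) (m b \<otimes>\<^bsub>U\<^esub> h a)"
proof -
  note cl = i_closed[OF homog_closed[OF a]] i_closed[OF homog_closed[OF b]]
    psi_closed[OF homog_closed[OF a]] psi_closed[OF homog_closed[OF b]]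
  show ?thesis
    using cl linear_map_koszul[OF alg_hom_linear[OF Uproj] ag_F U.V.M.abelian_group_axioms]
    unfolding m_def h_def
    by (simp add: psi_mult[OF a b] alg_hom_add[OF Uproj] alg_hom_mult[OF Uproj])
qed

lemma m_I: "r \<in> I \<Longrightarrow> m r = \<zero>\<^bsub>U\<^esub>"
  using erels_J[of "i r"] J.coset_eq_zero_iff[OF i_closed[OF I.Icarr]]
  by (simp add: m_def env_galg_def erels_def)

lemma h_I: "r \<in> I \<Longrightarrow> h r = \<zero>\<^bsub>U\<^esub>"
  using erels_J[of "\<psi> r"] J.coset_eq_zero_iff[OF psi_closed[OF I.Icarr]]
  by (simp add: h_def env_galg_def erels_def)

lemma h_gen: "\<alpha> \<in> \<Lambda> \<Longrightarrow> h (x \<alpha>) = J +>\<^bsub>F\<^esub> y \<alpha>"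
  by (simp add: h_def psi_gen)

lemma rel_h:
  assumes "\<alpha> \<in> \<Lambda>" "\<beta> \<in> \<Lambda>"
  shows "h (bracket R (x \<alpha>) (x \<beta>)) = signed_comm U (deg \<alpha> * deg \<beta>) (h (x \<alpha>)) (h (x \<beta>))"
proof -
  note cl = y_closed[OF assms(1)] y_closed[OF assms(2)]
  have "signed_comm F (deg \<alpha> * deg \<beta>) (y \<alpha>) (y \<beta>) \<ominus>\<^bsub>F\<^esub> \<psi> (bracket R (x \<alpha>) (x \<beta>)) \<in> erels"
    using assms unfolding erels_def by blast
  then have "J +>\<^bsub>F\<^esub> signed_comm F (deg \<alpha> * deg \<beta>) (y \<alpha>) (y \<beta>) = J +>\<^bsub>F\<^esub> \<psi> (bracket R (x \<alpha>) (x \<beta>))"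
    using J.coset_eq_iff[OF F.signed_comm_closed[OF cl] psi_closed[OF bracket_gens_closed[OF assms]]] erels_J
    by blast
  then show ?thesis
    using alg_hom_signed_comm[OF Uproj F.A.ring_axioms U.A.ring_axioms cl] assms
    by (simp add: h_gen) (simp add: h_def)
qed

lemma rel_m:
  assumes "\<alpha> \<in> \<Lambda>" "\<beta> \<in> \<Lambda>"
  shows "m (bracket R (x \<alpha>) (x \<beta>)) = signed_comm U (deg \<alpha> * deg \<beta>) (h (x \<alpha>)) (m (x \<beta>))"
proof -
  note cl = y_closed[OF assms(1)] i_closed[OF x_closed[OF assms(2)]]
  have "signed_comm F (deg \<alpha> * deg \<beta>) (y \<alpha>) (i (x \<beta>)) \<ominus>\<^bsub>F\<^esub> i (bracket R (x \<alpha>) (x \<beta>)) \<in> erels"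
    using assms unfolding erels_def by blast
  then have "J +>\<^bsub>F\<^esub> signed_comm F (deg \<alpha> * deg \<beta>) (y \<alpha>) (i (x \<beta>)) = J +>\<^bsub>F\<^esub> i (bracket R (x \<alpha>) (x \<beta>))"
    using J.coset_eq_iff[OF F.signed_comm_closed[OF cl] i_closed[OF bracket_gens_closed[OF assms]]] erels_J
    by blast
  then show ?thesis
    using alg_hom_signed_comm[OF Uproj F.A.ring_axioms U.A.ring_axioms cl] assms
    by (simp add: h_gen) (simp add: m_def)
qed

text \<open>Extends the bracket relations, imposed by \<open>J\<close> on generators, to all
  homogeneous elements.\<close>

sublocale P: poisson_pair K R U \<Lambda> deg x m h
  by unfold_locales (fact R_gen m_hom h_lin h_mult rel_m rel_h)+

section \<open>Generators of \<open>U\<close> and homomorphisms out of \<open>U\<close>\<close>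

lemma U_generated:
  "graded_generated K U (ext_gens R \<Lambda>) (\<lambda>g. J +>\<^bsub>F\<^esub> (N +>\<^bsub>E\<^esub> free_gen K g)) gdeg"
  unfolding env_galg_def
  by (rule quot_graded_generated[OF F.graded_algebra_axioms J.is_ideal F_generated])

text \<open>Reads the tagged presentation of F(R) in terms of \<open>m\<close> and \<open>h\<close>,
  so that later inductions no longer see words and cosets.\<close>

lemma U_gen_cases [consumes 1, case_names m h]:
  assumes "g \<in> ext_gens R \<Lambda>"
  obtains n r where "r \<in> homog R n" "gdeg g = n" "J +>\<^bsub>F\<^esub> (N +>\<^bsub>E\<^esub> free_gen K g) = m r"
  | \<alpha> where "\<alpha> \<in> \<Lambda>" "gdeg g = deg \<alpha>" "J +>\<^bsub>F\<^esub> (N +>\<^bsub>E\<^esub> free_gen K g) = h (x \<alpha>)"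
proof -
  consider n r where "g = Inl (n, r)" "r \<in> homog R n" | \<alpha> where "g = Inr \<alpha>" "\<alpha> \<in> \<Lambda>"
    using assms unfolding ext_gens_def by blast
  then show ?thesis
  proof cases
    case 1
    then show ?thesis using that(1)[of r n] incl_homog[OF 1(2)] by (simp add: m_def e_def)
  next
    case 2
    then show ?thesis using that(2)[of \<alpha>] by (simp add: h_gen ext_var_def)
  qed
qed

lemma U_induct [consumes 1, case_names one zero m h add smult]:
  assumes "u \<in> homog U n" "P 0 \<one>\<^bsub>U\<^esub>" "\<And>n. P n \<zero>\<^bsub>U\<^esub>"
    and m: "\<And>p r n u. \<lbrakk>r \<in> homog R p; u \<in> homog U n; P n u\<rbrakk> \<Longrightarrow> P (p + n) (m r \<otimes>\<^bsub>U\<^esub> u)"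
    and h: "\<And>\<alpha> n u. \<lbrakk>\<alpha> \<in> \<Lambda>; u \<in> homog U n; P n u\<rbrakk> \<Longrightarrow> P (deg \<alpha> + n) (h (x \<alpha>) \<otimes>\<^bsub>U\<^esub> u)"
    and add: "\<And>n u v. \<lbrakk>u \<in> homog U n; v \<in> homog U n; P n u; P n v\<rbrakk> \<Longrightarrow> P n (u \<oplus>\<^bsub>U\<^esub> v)"
    and smult: "\<And>n c u. \<lbrakk>c \<in> carrier K; u \<in> homog U n; P n u\<rbrakk> \<Longrightarrow> P n (c \<odot>\<^bsub>U\<^esub> u)"
  shows "P n u"
  using U.graded_algebra_axioms U_generated assms(1)
proof (induction rule: graded_generated_induct)
  case (mult g n u)
  from mult(1) show ?case
  proof (cases rule: U_gen_cases)
    case (m p r)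
    then show ?thesis using assms(4)[OF m(1) mult(3,4)] by simp
  next
    case (h \<alpha>)
    then show ?thesis using assms(5)[OF h(1) mult(3,4)] by simp
  qed
qed (fact assms)+

lemma U_linear_eq [consumes 4, case_names one m h]:
  assumes "abelian_group B" and f: "linear_map K U B f" and g: "linear_map K U B g"
    and u: "u \<in> carrier U" and one: "f \<one>\<^bsub>U\<^esub> = g \<one>\<^bsub>U\<^esub>"
    and m: "\<And>p r n u. \<lbrakk>r \<in> homog R p; u \<in> homog U n; f u = g u\<rbrakk> \<Longrightarrow> f (m r \<otimes>\<^bsub>U\<^esub> u) = g (m r \<otimes>\<^bsub>U\<^esub> u)"
    and h: "\<And>\<alpha> n u. \<lbrakk>\<alpha> \<in> \<Lambda>; u \<in> homog U n; f u = g u\<rbrakk> \<Longrightarrow>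
      f (h (x \<alpha>) \<otimes>\<^bsub>U\<^esub> u) = g (h (x \<alpha>) \<otimes>\<^bsub>U\<^esub> u)"
  shows "f u = g u"
proof (rule U.linear_eq_on_homog[OF f g assms(1) _ u])
  show "f u = g u" if "u \<in> homog U n" for n u
  proof (rule graded_generated_linear_eq[OF U.graded_algebra_axioms U_generated assms(1) f g one _ that])
    fix a n u assume "a \<in> ext_gens R \<Lambda>" and u: "u \<in> homog U n" "f u = g u"
    then show "f ((J +>\<^bsub>F\<^esub> (N +>\<^bsub>E\<^esub> free_gen K a)) \<otimes>\<^bsub>U\<^esub> u) = g ((J +>\<^bsub>F\<^esub> (N +>\<^bsub>E\<^esub> free_gen K a)) \<otimes>\<^bsub>U\<^esub> u)"
    proof (cases rule: U_gen_cases)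
      case (m p r)
      then show ?thesis using assms(6)[OF m(1) u] by simp
    next
      case (h \<alpha>)
      then show ?thesis using assms(7)[OF h(1) u] by simp
    qed
  qed
qed

lemma U_hom_eq:
  assumes "k_algebra K B" "alg_hom K U B f" "alg_hom K U B g"
    and "\<And>r. r \<in> carrier R \<Longrightarrow> f (m r) = g (m r)" "\<And>\<alpha>. \<alpha> \<in> \<Lambda> \<Longrightarrow> f (h (x \<alpha>)) = g (h (x \<alpha>))"
    and "u \<in> carrier U"
  shows "f u = g u"
proof (rule alg_hom_eq_on_generators[OF U.graded_algebra_axioms U_generated assms(1-3) _ assms(6)])
  fix a assume "a \<in> ext_gens R \<Lambda>"
  then show "f (J +>\<^bsub>F\<^esub> (N +>\<^bsub>E\<^esub> free_gen K a)) = g (J +>\<^bsub>F\<^esub> (N +>\<^bsub>E\<^esub> free_gen K a))"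
  proof (cases rule: U_gen_cases)
    case (m n r)
    then show ?thesis using assms(4)[OF homog_closed[OF m(1)]] by simp
  next
    case (h \<alpha>)
    then show ?thesis using assms(5)[OF h(1)] by simp
  qed
qed

text \<open>The homomorphism on F(R) sends y_\<alpha> to g(x_\<alpha>). It kills \<open>J\<close>
  once it is known to carry \<open>\<psi> r\<close> to g r for every r. The bracket conditions are
  required for generators only, which is what makes the result applicable to dual numbers.\<close>

lemma env_lift:
  assumes "k_algebra K B" and f: "alg_hom K R B f" and g: "linear_map K R B g"
    and g_mult: "\<And>a b p q. \<lbrakk>a \<in> homog R p; b \<in> homog R q\<rbrakk> \<Longrightarrow>
      g (a \<otimes> b) = f a \<otimes>\<^bsub>B\<^esub> g b \<oplus>\<^bsub>B\<^esub> koszul B (p * q) (f b \<otimes>\<^bsub>B\<^esub> g a)"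
    and fI: "\<And>r. r \<in> I \<Longrightarrow> f r = \<zero>\<^bsub>B\<^esub>" and gI: "\<And>r. r \<in> I \<Longrightarrow> g r = \<zero>\<^bsub>B\<^esub>"
    and rel_f: "\<And>\<alpha> \<beta>. \<lbrakk>\<alpha> \<in> \<Lambda>; \<beta> \<in> \<Lambda>\<rbrakk> \<Longrightarrow>
      f (bracket R (x \<alpha>) (x \<beta>)) = signed_comm B (deg \<alpha> * deg \<beta>) (g (x \<alpha>)) (f (x \<beta>))"
    and rel_g: "\<And>\<alpha> \<beta>. \<lbrakk>\<alpha> \<in> \<Lambda>; \<beta> \<in> \<Lambda>\<rbrakk> \<Longrightarrow>
      g (bracket R (x \<alpha>) (x \<beta>)) = signed_comm B (deg \<alpha> * deg \<beta>) (g (x \<alpha>)) (g (x \<beta>))"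
  obtains \<Phi> where "alg_hom K U B \<Phi>" "\<And>r. r \<in> carrier R \<Longrightarrow> \<Phi> (m r) = f r"
    "\<And>r. r \<in> carrier R \<Longrightarrow> \<Phi> (h r) = g r"
proof -
  interpret B: k_algebra K B by fact
  note ag_B = B.V.M.abelian_group_axioms
  note gc = linear_map_closed[OF g]
  obtain G where G: "alg_hom K F B G" and Gi: "\<And>r. r \<in> carrier R \<Longrightarrow> G (i r) = f r"
    and Gy: "\<And>\<alpha>. \<alpha> \<in> \<Lambda> \<Longrightarrow> G (y \<alpha>) = g (x \<alpha>)"
  proof (rule free_ext_lift[OF assms(1) f])
    show "g (x \<alpha>) \<in> carrier B" if "\<alpha> \<in> \<Lambda>" for \<alpha> using gc[OF x_closed[OF that]] .
  qed (rule that)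
  note G_lin = alg_hom_linear[OF G]
  note lin = linear_map_comp[OF psi_linear G_lin]
  \<comment> \<open>Supplies the vanishing of g at 1, the base case of the comparison below.\<close>
  interpret P': poisson_pair K R B \<Lambda> deg x f g
    by unfold_locales (fact R_gen f g g_mult rel_f rel_g)+
  have psi_one: "\<psi> \<one> = \<zero>\<^bsub>F\<^esub>"
    unfolding psi_def
  proof (rule F.add.finprod_one_eqI)
    show "i (\<delta> \<alpha> \<one>) \<otimes>\<^bsub>F\<^esub> y \<alpha> = \<zero>\<^bsub>F\<^esub>" if "\<alpha> \<in> {\<alpha> \<in> \<Lambda>. \<delta> \<alpha> \<one> \<noteq> \<zero>}" for \<alpha>
      using that delta_one by blast
  qed
  \<comment> \<open>Both maps obey the same rule for products over f and agree on generators. The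
    relations from \<open>\<psi>\<close> of I and those between the y_\<alpha> depend on
    this.\<close>
  have Gpsi_homog: "G (\<psi> r) = g r" if "r \<in> homog R n" for r n
  proof (rule graded_generated_linear_eq[OF graded_algebra_axioms R_gen ag_B lin g _ _ that],
        goal_cases one mult)
    case one
    then show ?case by (simp add: psi_one P'.h_one linear_map_zero[OF G_lin ag_F ag_B])
  next
    case (mult \<beta> n a)
    note c = x_closed[OF mult(1)] homog_closed[OF mult(3)]
    note c' = i_closed[OF c(1)] i_closed[OF c(2)] psi_closed[OF c(2)] y_closed[OF mult(1)]
    have "G (\<psi> (x \<beta> \<otimes> a)) = f (x \<beta>) \<otimes>\<^bsub>B\<^esub> g a \<oplus>\<^bsub>B\<^esub> koszul B (deg \<beta> * n) (f a \<otimes>\<^bsub>B\<^esub> g (x \<beta>))"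
      using c c' by (simp add: psi_mult[OF mult(2,3)] psi_gen[OF mult(1)] alg_hom_add[OF G]
          alg_hom_mult[OF G] linear_map_koszul[OF G_lin ag_F ag_B] Gi Gy[OF mult(1)] mult(4))
    then show ?case by (simp add: g_mult[OF mult(2,3)])
  qed
  have Gpsi: "G (\<psi> r) = g r" if "r \<in> carrier R" for r
    by (rule linear_eq_on_homog[OF lin g ag_B Gpsi_homog that])
  have Gdiff: "G (a \<ominus>\<^bsub>F\<^esub> b) = \<zero>\<^bsub>B\<^esub>" if "a \<in> carrier F" "b \<in> carrier F" "G a = G b" for a b
    using that linear_map_add[OF G_lin] linear_map_closed[OF G_lin] linear_map_minus[OF G_lin ag_F ag_B]
    by (simp add: a_minus_def B.r_neg)
  have G_rels: "G s = \<zero>\<^bsub>B\<^esub>" if s: "s \<in> erels" for s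
    using s
  proof (cases rule: erels_cases)
    case (i r)
    then show ?thesis using Gi[OF I.Icarr[OF i(1)]] fI by simp
  next
    case (psi r)
    then show ?thesis using Gpsi[OF I.Icarr[OF psi(1)]] gI by simp
  next
    case (h \<alpha> \<beta>)
    note c = y_closed[OF h(1)] y_closed[OF h(2)] bracket_gens_closed[OF h(1,2)]
    show ?thesis unfolding h(3)
      using Gpsi[OF c(3)] rel_g[OF h(1,2)] alg_hom_signed_comm[OF G F.A.ring_axioms B.A.ring_axioms c(1,2)] h(1,2)
      by (intro Gdiff F.signed_comm_closed c(1,2) psi_closed[OF c(3)]) (simp add: Gy)
  next
    case (m \<alpha> \<beta>)
    note c = y_closed[OF m(1)] i_closed[OF x_closed[OF m(2)]] bracket_gens_closed[OF m(1,2)]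
    show ?thesis unfolding m(3)
      using Gi[OF c(3)] Gi[OF x_closed[OF m(2)]] rel_f[OF m(1,2)]
        alg_hom_signed_comm[OF G F.A.ring_axioms B.A.ring_axioms c(1,2)] m(1,2)
      by (intro Gdiff F.signed_comm_closed c(1,2) i_closed[OF c(3)]) (simp add: Gy)
  qed
  have GJ: "G u = \<zero>\<^bsub>B\<^esub>" if "u \<in> J" for u
    using alg_hom_genideal[OF F.k_algebra_axioms assms(1) G erels_closed G_rels] that unfolding J_def by simp
  obtain \<Phi> where \<Phi>: "alg_hom K U B \<Phi>" and \<Phi>v: "\<And>u. u \<in> carrier F \<Longrightarrow> \<Phi> (J +>\<^bsub>F\<^esub> u) = G u"
    using quot_lift[OF F.k_algebra_axioms assms(1) J.is_ideal G GJ, folded env_galg_def] by metis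
  have "\<Phi> (m r) = f r" if "r \<in> carrier R" for r
    unfolding m_def using \<Phi>v[OF i_closed[OF that]] Gi[OF that] by simp
  moreover have "\<Phi> (h r) = g r" if "r \<in> carrier R" for r
    unfolding h_def using \<Phi>v[OF psi_closed[OF that]] Gpsi[OF that] by simp
  ultimately show ?thesis using \<Phi> that by blast
qed

end

lemma add_dif_simps [simp]:
  "carrier (add_dif A d) = carrier A" "monoid.mult (add_dif A d) = monoid.mult A"
  "\<one>\<^bsub>add_dif A d\<^esub> = \<one>\<^bsub>A\<^esub>" "\<zero>\<^bsub>add_dif A d\<^esub> = \<zero>\<^bsub>A\<^esub>" "add (add_dif A d) = add A"
  "smult (add_dif A d) = smult A" "homog (add_dif A d) = homog A" "dif (add_dif A d) = d"
  by (simp_all add: add_dif_def galg.defs dgalg.defs)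

lemma add_bracket_simps [simp]:
  "carrier (add_bracket A b) = carrier A" "monoid.mult (add_bracket A b) = monoid.mult A"
  "\<one>\<^bsub>add_bracket A b\<^esub> = \<one>\<^bsub>A\<^esub>" "\<zero>\<^bsub>add_bracket A b\<^esub> = \<zero>\<^bsub>A\<^esub>" "add (add_bracket A b) = add A"
  "smult (add_bracket A b) = smult A" "homog (add_bracket A b) = homog A"
  "dif (add_bracket A b) = dif A" "bracket (add_bracket A b) = b"
  by (simp_all add: add_bracket_def dgalg.defs dgbalg.defs)

lemma signed_comm_record_cong:
  assumes "carrier B = carrier A" "\<zero>\<^bsub>B\<^esub> = \<zero>\<^bsub>A\<^esub>" "add B = add A" "monoid.mult B = monoid.mult A"
  shows "signed_comm B = signed_comm A"
  by (intro ext) (simp add: signed_comm_def a_minus_def koszul_record_cong[OF assms(1-3)] a_inv_cong[OF assms(1-3)]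
      assms)

text \<open>With a', b' in the role of derivatives of a, b, the second coordinate has exactly the
  shape of \<open>dif_bracket\<close>; this is why the twist of exponent 1 sits on the left
  factor.\<close>

lemma dual_signed_comm:
  assumes "graded_algebra K A" and a: "a \<in> homog A p" and b: "b \<in> homog A q"
    and a': "a' \<in> carrier A" and b': "b' \<in> carrier A"
  shows "signed_comm (dual_alg A (sgn_aut A 1) (\<lambda>a. a)) (p * q) (a, a') (b, b') =
    (signed_comm A (p * q) a b, signed_comm A ((p + 1) * q) a' b \<oplus>\<^bsub>A\<^esub> koszul A p (signed_comm A (p * (q + 1)) a b'))"
proof -
  interpret A: graded_algebra K A by fact
  note B = A.k_algebra_axioms A.alg_hom_sgn_aut[of 1] alg_hom_id
  note cl = A.homog_closed[OF a] A.homog_closed[OF b] a' b'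
  show ?thesis
    using cl A.sgn_aut_homog[OF a, of 1] A.sgn_aut_homog[OF b, of 1]
    by (cases "even p"; cases "even q")
      (simp_all add: signed_comm_def a_minus_def koszul_def dual_minus[OF B] A.ring_nf)
qed

lemma (in dg_algebra) dif_one: "dif A \<one> = \<zero>"
  using leibniz[OF one_homog one_closed] linear_map_closed[OF dif_linear one_closed]
    add.r_cancel_one[of "dif A \<one>" "dif A \<one>"] by simp

section \<open>The differential\<close>

context envelope
begin

lemmas ag_U = U.V.M.abelian_group_axioms
lemmas m_lin = alg_hom_linear[OF m_hom]
lemmas Um_closed = linear_map_closed[OF m_lin]
lemmas Uh_closed = linear_map_closed[OF h_lin]
lemmas m_koszul = linear_map_koszul[OF m_lin ag_R ag_U]
lemmas h_koszul = linear_map_koszul[OF h_lin ag_R ag_U]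

lemma m_dif_mult:
  assumes a: "a \<in> homog R p" and b: "b \<in> carrier R"
  shows "m (dif R (a \<otimes> b)) = m (dif R a) \<otimes>\<^bsub>U\<^esub> m b \<oplus>\<^bsub>U\<^esub> koszul U p (m a \<otimes>\<^bsub>U\<^esub> m (dif R b))"
  using homog_closed[OF a] b dif_closed[OF homog_closed[OF a]] dif_closed[OF b]
  by (simp add: leibniz[OF a b] alg_hom_add[OF m_hom] alg_hom_mult[OF m_hom] m_koszul)

text \<open>The two groups are the second coordinates of f a g b and f b g a in the dual numbers
  used below, for f = (m, m d) and g = (h, h d).\<close>

lemma h_dif_mult:
  assumes a: "a \<in> homog R p" and b: "b \<in> homog R q"
  shows "h (dif R (a \<otimes> b)) =
    (m (dif R a) \<otimes>\<^bsub>U\<^esub> h b \<oplus>\<^bsub>U\<^esub> koszul U p (m a \<otimes>\<^bsub>U\<^esub> h (dif R b))) \<oplus>\<^bsub>U\<^esub>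
    koszul U (p * q) (m (dif R b) \<otimes>\<^bsub>U\<^esub> h a \<oplus>\<^bsub>U\<^esub> koszul U q (m b \<otimes>\<^bsub>U\<^esub> h (dif R a)))"
proof -
  note c = homog_closed[OF a] homog_closed[OF b] dif_closed[OF homog_closed[OF a]]
    dif_closed[OF homog_closed[OF b]]
  note uc = Um_closed[OF c(1)] Um_closed[OF c(2)] Um_closed[OF c(3)] Um_closed[OF c(4)]
    Uh_closed[OF c(1)] Uh_closed[OF c(2)] Uh_closed[OF c(3)] Uh_closed[OF c(4)]
  have "h (dif R (a \<otimes> b)) =
      (m (dif R a) \<otimes>\<^bsub>U\<^esub> h b \<oplus>\<^bsub>U\<^esub> koszul U ((p + 1) * q) (m b \<otimes>\<^bsub>U\<^esub> h (dif R a))) \<oplus>\<^bsub>U\<^esub>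
      koszul U p (m a \<otimes>\<^bsub>U\<^esub> h (dif R b) \<oplus>\<^bsub>U\<^esub> koszul U (p * (q + 1)) (m (dif R b) \<otimes>\<^bsub>U\<^esub> h a))"
    using c by (simp add: leibniz[OF a c(2)] linear_map_add[OF h_lin] h_koszul
        h_mult[OF dif_degree[OF a] b] h_mult[OF a dif_degree[OF b]])
  then show ?thesis
    using uc by (cases "even p"; cases "even q") (simp_all add: koszul_def U.ring_nf)
qed

lemma m_dif_bracket:
  assumes a: "a \<in> homog R p" and b: "b \<in> homog R q"
  shows "m (dif R (bracket R a b)) = signed_comm U ((p + 1) * q) (h (dif R a)) (m b) \<oplus>\<^bsub>U\<^esub>
    koszul U p (signed_comm U (p * (q + 1)) (h a) (m (dif R b)))"
  using homog_closed[OF bracket_degree[OF dif_degree[OF a] b]]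
    homog_closed[OF bracket_degree[OF a dif_degree[OF b]]]
  by (simp add: dif_bracket[OF a b] linear_map_add[OF m_lin] m_koszul
      P.m_bracket[OF dif_degree[OF a] b] P.m_bracket[OF a dif_degree[OF b]])

lemma h_dif_bracket:
  assumes a: "a \<in> homog R p" and b: "b \<in> homog R q"
  shows "h (dif R (bracket R a b)) = signed_comm U ((p + 1) * q) (h (dif R a)) (h b) \<oplus>\<^bsub>U\<^esub>
    koszul U p (signed_comm U (p * (q + 1)) (h a) (h (dif R b)))"
  using homog_closed[OF bracket_degree[OF dif_degree[OF a] b]]
    homog_closed[OF bracket_degree[OF a dif_degree[OF b]]]
  by (simp add: dif_bracket[OF a b] linear_map_add[OF h_lin] h_koszul
      P.h_bracket[OF dif_degree[OF a] b] P.h_bracket[OF a dif_degree[OF b]])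

text \<open>\<open>env_lift\<close> is applied to dual numbers over \<open>U\<close> itself. Its
  conditions translate into the compatibility of d with product and bracket in R and into d(I) lying
  in I.\<close>

lemma env_dif_exists:
  "\<exists>D. linear_map K U U D \<and>
    (\<forall>n. \<forall>a\<in>homog U n. \<forall>b\<in>carrier U.
      D (a \<otimes>\<^bsub>U\<^esub> b) = D a \<otimes>\<^bsub>U\<^esub> b \<oplus>\<^bsub>U\<^esub> koszul U n (a \<otimes>\<^bsub>U\<^esub> D b)) \<and>
    (\<forall>\<alpha>\<in>\<Lambda>. D (m (x \<alpha>)) = m (dif R (x \<alpha>))) \<and> (\<forall>\<alpha>\<in>\<Lambda>. D (h (x \<alpha>)) = h (dif R (x \<alpha>)))"
proof -
  define \<sigma> where "\<sigma> = sgn_aut U 1"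
  have \<sigma>: "alg_hom K U U \<sigma>" unfolding \<sigma>_def by (rule U.alg_hom_sgn_aut)
  have \<sigma>h: "\<sigma> a = koszul U n a" if "a \<in> homog U n" for a n
    using U.sgn_aut_homog[OF that, of 1] by (simp add: \<sigma>_def)
  let ?B = "dual_alg U \<sigma> (\<lambda>a. a)"
  note B = U.k_algebra_axioms \<sigma> alg_hom_id
  interpret B: k_algebra K ?B by (rule dual_k_algebra[OF B])
  \<comment> \<open>The second coordinate prescribes the derivative of m r to be m (d r), on all of
    R and not just on generators; the same is done for h.\<close>
  define f where "f r = (m r, m (dif R r))" for r
  define g where "g r = (h r, h (dif R r))" for r
  have f_lin: "linear_map K R ?B f"
    unfolding f_def
    by (rule linear_mapI) (simp_all add: Um_closed dif_closed linear_map_add[OF dif_linear]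
        linear_map_smult[OF dif_linear] linear_map_add[OF m_lin] linear_map_smult[OF m_lin])
  have g_lin: "linear_map K R ?B g"
    unfolding g_def
    by (rule linear_mapI) (simp_all add: Uh_closed dif_closed linear_map_add[OF dif_linear]
        linear_map_smult[OF dif_linear] linear_map_add[OF h_lin] linear_map_smult[OF h_lin])
  have f: "alg_hom K R ?B f"
  proof (rule alg_hom_on_homogI[OF B.k_algebra_axioms f_lin])
    show "f \<one> = \<one>\<^bsub>?B\<^esub>"
      by (simp add: f_def dif_one alg_hom_one[OF m_hom] linear_map_zero[OF m_lin ag_R ag_U])
    fix p q a b assume a: "a \<in> homog R p" and b: "b \<in> homog R q"
    note c = homog_closed[OF a] homog_closed[OF b]
    show "f (a \<otimes> b) = f a \<otimes>\<^bsub>?B\<^esub> f b"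
      using c Um_closed[OF c(1)] Um_closed[OF c(2)] Um_closed[OF dif_closed[OF c(1)]] Um_closed[OF dif_closed[OF c(2)]]
      by (simp add: f_def m_dif_mult[OF a c(2)] alg_hom_mult[OF m_hom] \<sigma>h[OF m_graded[OF a]]
          U.koszul_mult_left U.a_comm)
  qed
  have dualk: "koszul ?B n (u, v) = (koszul U n u, koszul U n v)" if "u \<in> carrier U" "v \<in> carrier U" for u v n
    by (rule dual_koszul[OF B that])
  obtain \<Phi> where \<Phi>: "alg_hom K U ?B \<Phi>" and \<Phi>m: "\<And>r. r \<in> carrier R \<Longrightarrow> \<Phi> (m r) = f r"
    and \<Phi>h: "\<And>r. r \<in> carrier R \<Longrightarrow> \<Phi> (h r) = g r"
  proof (rule env_lift[OF B.k_algebra_axioms f g_lin])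
    fix a b p q assume a: "a \<in> homog R p" and b: "b \<in> homog R q"
    note c = homog_closed[OF a] homog_closed[OF b] dif_closed[OF homog_closed[OF a]]
      dif_closed[OF homog_closed[OF b]]
    note uc = Um_closed[OF c(1)] Um_closed[OF c(2)] Um_closed[OF c(3)] Um_closed[OF c(4)]
      Uh_closed[OF c(1)] Uh_closed[OF c(2)] Uh_closed[OF c(3)] Uh_closed[OF c(4)]
    show "g (a \<otimes> b) = f a \<otimes>\<^bsub>?B\<^esub> g b \<oplus>\<^bsub>?B\<^esub> koszul ?B (p * q) (f b \<otimes>\<^bsub>?B\<^esub> g a)"
      using uc by (simp add: f_def g_def h_mult[OF a b] h_dif_mult[OF a b] \<sigma>h[OF m_graded[OF a]]
          \<sigma>h[OF m_graded[OF b]] dualk U.koszul_mult_left U.a_comm)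
  next
    fix r assume "r \<in> I"
    then show "f r = \<zero>\<^bsub>?B\<^esub>" "g r = \<zero>\<^bsub>?B\<^esub>"
      using m_I[OF I_dif] h_I[OF I_dif] by (simp_all add: f_def g_def m_I h_I)
  next
    fix \<alpha> \<beta> assume \<alpha>: "\<alpha> \<in> \<Lambda>" and \<beta>: "\<beta> \<in> \<Lambda>"
    note c = dif_closed[OF x_closed[OF \<alpha>]] dif_closed[OF x_closed[OF \<beta>]]
    show "f (bracket R (x \<alpha>) (x \<beta>)) = signed_comm ?B (deg \<alpha> * deg \<beta>) (g (x \<alpha>)) (f (x \<beta>))"
      unfolding f_def g_def rel_m[OF \<alpha> \<beta>] m_dif_bracket[OF x_homog[OF \<alpha>] x_homog[OF \<beta>]] \<sigma>_def
      by (rule dual_signed_comm[OF U.graded_algebra_axioms h_graded[OF x_homog[OF \<alpha>]]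
            m_graded[OF x_homog[OF \<beta>]] Uh_closed[OF c(1)] Um_closed[OF c(2)], symmetric])
    show "g (bracket R (x \<alpha>) (x \<beta>)) = signed_comm ?B (deg \<alpha> * deg \<beta>) (g (x \<alpha>)) (g (x \<beta>))"
      unfolding f_def g_def rel_h[OF \<alpha> \<beta>] h_dif_bracket[OF x_homog[OF \<alpha>] x_homog[OF \<beta>]] \<sigma>_def
      by (rule dual_signed_comm[OF U.graded_algebra_axioms h_graded[OF x_homog[OF \<alpha>]]
            h_graded[OF x_homog[OF \<beta>]] Uh_closed[OF c(1)] Uh_closed[OF c(2)], symmetric])
  qed (rule that)
  \<comment> \<open>The first coordinate is an endomorphism of \<open>U\<close> fixing its
    generators, so the second is a skew derivation of \<open>U\<close>.\<close>
  have fst_eq: "fst (\<Phi> u) = u" if "u \<in> carrier U" for u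
    by (rule U_hom_eq[OF U.k_algebra_axioms alg_hom_comp[OF \<Phi> dual_fst] alg_hom_id _ _ that])
      (simp_all add: \<Phi>m \<Phi>h x_closed f_def g_def)
  define D where "D u = snd (\<Phi> u)" for u
  have "linear_map K U U D"
    unfolding D_def by (rule linear_map_comp[OF alg_hom_linear[OF \<Phi>] dual_snd])
  moreover have "D (a \<otimes>\<^bsub>U\<^esub> b) = D a \<otimes>\<^bsub>U\<^esub> b \<oplus>\<^bsub>U\<^esub> koszul U n (a \<otimes>\<^bsub>U\<^esub> D b)"
    if a: "a \<in> homog U n" and b: "b \<in> carrier U" for a b n
  proof -
    note ac = U.homog_closed[OF a]
    have Dc: "D u \<in> carrier U" if "u \<in> carrier U" for u
      using linear_map_closed[OF \<open>linear_map K U U D\<close> that] .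
    show ?thesis
      using Dc[OF ac] Dc[OF b] ac b unfolding D_def
      by (simp add: alg_hom_mult[OF \<Phi> ac b] dual_snd_mult fst_eq \<sigma>h[OF a] U.koszul_mult_left U.a_comm)
  qed
  moreover have "D (m (x \<alpha>)) = m (dif R (x \<alpha>))" "D (h (x \<alpha>)) = h (dif R (x \<alpha>))" if "\<alpha> \<in> \<Lambda>" for \<alpha>
    using \<Phi>m[OF x_closed[OF that]] \<Phi>h[OF x_closed[OF that]] by (simp_all add: D_def f_def g_def)
  ultimately show ?thesis by blast
qed

section \<open>Properties of the chosen differential\<close>

abbreviation "dU \<equiv> env_dif K R \<Lambda> deg x I"

lemma
  shows dU_linear: "linear_map K U U dU"
    and dU_mult: "\<And>a b n. \<lbrakk>a \<in> homog U n; b \<in> carrier U\<rbrakk> \<Longrightarrow>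
      dU (a \<otimes>\<^bsub>U\<^esub> b) = dU a \<otimes>\<^bsub>U\<^esub> b \<oplus>\<^bsub>U\<^esub> koszul U n (a \<otimes>\<^bsub>U\<^esub> dU b)"
    and dU_m_gen: "\<And>\<alpha>. \<alpha> \<in> \<Lambda> \<Longrightarrow> dU (m (x \<alpha>)) = m (dif R (x \<alpha>))"
    and dU_h_gen: "\<And>\<alpha>. \<alpha> \<in> \<Lambda> \<Longrightarrow> dU (h (x \<alpha>)) = h (dif R (x \<alpha>))"
proof -
  \<comment> \<open>\<open>env_dif\<close> speaks of the classes of y_\<alpha>, whereas existence
    was proved in terms of \<open>h (x \<alpha>)\<close>; \<open>psi_gen\<close> identifies
    them.\<close>
  have h_eq: "(\<forall>\<alpha>\<in>\<Lambda>. D (h (x \<alpha>)) = h (dif R (x \<alpha>))) \<longleftrightarrow>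
      (\<forall>\<alpha>\<in>\<Lambda>. D (J +>\<^bsub>F\<^esub> y \<alpha>) = J +>\<^bsub>F\<^esub> \<psi> (dif R (x \<alpha>)))" for D
    by (rule ball_cong[OF refl]) (simp add: h_gen h_def[of "dif R _"])
  have eq: "dU = (SOME D. linear_map K U U D \<and>
    (\<forall>n. \<forall>a\<in>homog U n. \<forall>b\<in>carrier U.
      D (a \<otimes>\<^bsub>U\<^esub> b) = D a \<otimes>\<^bsub>U\<^esub> b \<oplus>\<^bsub>U\<^esub> koszul U n (a \<otimes>\<^bsub>U\<^esub> D b)) \<and>
    (\<forall>\<alpha>\<in>\<Lambda>. D (m (x \<alpha>)) = m (dif R (x \<alpha>))) \<and> (\<forall>\<alpha>\<in>\<Lambda>. D (h (x \<alpha>)) = h (dif R (x \<alpha>))))"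
    unfolding h_eq unfolding env_dif_def Let_def m_def ..
  show "linear_map K U U dU"
    "\<And>a b n. \<lbrakk>a \<in> homog U n; b \<in> carrier U\<rbrakk> \<Longrightarrow>
      dU (a \<otimes>\<^bsub>U\<^esub> b) = dU a \<otimes>\<^bsub>U\<^esub> b \<oplus>\<^bsub>U\<^esub> koszul U n (a \<otimes>\<^bsub>U\<^esub> dU b)"
    "\<And>\<alpha>. \<alpha> \<in> \<Lambda> \<Longrightarrow> dU (m (x \<alpha>)) = m (dif R (x \<alpha>))"
    "\<And>\<alpha>. \<alpha> \<in> \<Lambda> \<Longrightarrow> dU (h (x \<alpha>)) = h (dif R (x \<alpha>))"
    using someI_ex[OF env_dif_exists] unfolding eq[symmetric] by blast+
qed

lemmas dU_closed = linear_map_closed[OF dU_linear]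

lemma dU_one: "dU \<one>\<^bsub>U\<^esub> = \<zero>\<^bsub>U\<^esub>"
  using dU_mult[OF U.one_homog U.one_closed] dU_closed[OF U.one_closed]
    U.add.r_cancel_one[of "dU \<one>\<^bsub>U\<^esub>" "dU \<one>\<^bsub>U\<^esub>"] by simp

text \<open>Both composites satisfy the same skew Leibniz rule over m, so the prescribed values on
  generators decide. For h the analogous comparison also uses this result.\<close>

lemma dU_m:
  assumes "r \<in> carrier R"
  shows "dU (m r) = m (dif R r)"
proof (rule linear_eq_on_homog[OF linear_map_comp[OF m_lin dU_linear] linear_map_comp[OF dif_linear m_lin]
      ag_U _ assms])
  note lin = linear_map_comp[OF m_lin dU_linear] linear_map_comp[OF dif_linear m_lin]
  fix n a assume "a \<in> homog R n"
  then show "dU (m a) = m (dif R a)"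
  proof (rule graded_generated_linear_eq[OF graded_algebra_axioms R_gen ag_U lin(1) lin(2), rotated -1],
        goal_cases one mult)
    case one
    then show ?case by (simp add: alg_hom_one[OF m_hom] dU_one dif_one linear_map_zero[OF m_lin ag_R ag_U])
  next
    case (mult \<alpha> n a)
    note c = x_closed[OF mult(1)] homog_closed[OF mult(3)]
    show ?case
      by (simp add: alg_hom_mult[OF m_hom c] dU_mult[OF m_graded[OF mult(2)] Um_closed[OF c(2)]]
          dU_m_gen[OF mult(1)] mult(4) m_dif_mult[OF mult(2) c(2)])
  qed
qed

lemma dU_h:
  assumes "r \<in> carrier R"
  shows "dU (h r) = h (dif R r)"
proof (rule linear_eq_on_homog[OF linear_map_comp[OF h_lin dU_linear] linear_map_comp[OF dif_linear h_lin]
      ag_U _ assms])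
  note lin = linear_map_comp[OF h_lin dU_linear] linear_map_comp[OF dif_linear h_lin]
  fix n a assume "a \<in> homog R n"
  then show "dU (h a) = h (dif R a)"
  proof (rule graded_generated_linear_eq[OF graded_algebra_axioms R_gen ag_U lin(1) lin(2), rotated -1],
        goal_cases one mult)
    case one
    then show ?case
      by (simp add: P.h_one dif_one linear_map_zero[OF dU_linear ag_U ag_U] linear_map_zero[OF h_lin ag_R ag_U])
  next
    case (mult \<alpha> n a)
    note c = x_closed[OF mult(1)] homog_closed[OF mult(3)]
    note uc = Um_closed[OF c(1)] Um_closed[OF c(2)] Uh_closed[OF c(1)] Uh_closed[OF c(2)]
    show ?case
      using uc
      by (simp add: h_mult[OF mult(2,3)] linear_map_add[OF dU_linear]
          linear_map_koszul[OF dU_linear ag_U ag_U]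
          dU_mult[OF m_graded[OF mult(2)] uc(4)] dU_mult[OF m_graded[OF mult(3)] uc(3)]
          dU_m[OF c(1)] dU_m[OF c(2)] dU_h_gen[OF mult(1)] mult(4) h_dif_mult[OF mult(2,3)])
  qed
qed

lemma dU_graded_mult:
  assumes v: "v \<in> homog U p" and u: "u \<in> homog U n"
    and "dU v \<in> homog U (p + 1)" "dU u \<in> homog U (n + 1)"
  shows "dU (v \<otimes>\<^bsub>U\<^esub> u) \<in> homog U (p + n + 1)"
  using U.mult_homog[OF assms(3) u] U.mult_homog[OF v assms(4)]
  unfolding dU_mult[OF v U.homog_closed[OF u]]
  by (intro U.homog_add U.homog_koszul) (simp_all add: algebra_simps)

lemma dU_m_graded: "r \<in> homog R p \<Longrightarrow> dU (m r) \<in> homog U (p + 1)"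
  using m_graded[OF dif_degree] by (simp add: dU_m homog_closed)

lemma dU_h_graded: "r \<in> homog R p \<Longrightarrow> dU (h r) \<in> homog U (p + 1)"
  using h_graded[OF dif_degree] by (simp add: dU_h homog_closed)

text \<open>The choice in \<open>env_dif\<close> prescribes no degree; it follows from the degrees
  of m (d r) and h (d x_\<alpha>) on generators of \<open>U\<close>.\<close>

lemma dU_degree: "u \<in> homog U n \<Longrightarrow> dU u \<in> homog U (n + 1)"
proof (induction rule: U_induct)
  case one
  then show ?case using U.homog_zero by (simp add: dU_one)
next
  case (zero n)
  then show ?case using U.homog_zero by (simp add: linear_map_zero[OF dU_linear ag_U ag_U])
next
  case (m p r n u)
  show ?case by (rule dU_graded_mult[OF m_graded[OF m(1)] m(2) dU_m_graded[OF m(1)] m(3)])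
next
  case (h \<alpha> n u)
  show ?case
    by (rule dU_graded_mult[OF h_graded[OF x_homog[OF h(1)]] h(2) dU_h_graded[OF x_homog[OF h(1)]] h(3)])
next
  case (add n u v)
  then show ?case
    using linear_map_add[OF dU_linear U.homog_closed[OF add(1)] U.homog_closed[OF add(2)]]
    by (simp add: U.homog_add)
next
  case (smult n c u)
  then show ?case
    using linear_map_smult[OF dU_linear smult(1) U.homog_closed[OF smult(2)]]
    by (simp add: U.homog_smult)
qed

text \<open>Of the four terms two vanish by assumption, and the mixed ones occur with exponents p +
  1 and p and cancel.\<close>

lemma dU_dU_mult:
  assumes v: "v \<in> homog U p" and u: "u \<in> homog U n"
    and "dU (dU v) = \<zero>\<^bsub>U\<^esub>" "dU (dU u) = \<zero>\<^bsub>U\<^esub>"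
  shows "dU (dU (v \<otimes>\<^bsub>U\<^esub> u)) = \<zero>\<^bsub>U\<^esub>"
proof -
  note c = U.homog_closed[OF v] U.homog_closed[OF u] dU_closed[OF U.homog_closed[OF v]]
    dU_closed[OF U.homog_closed[OF u]]
  have "dU (dU (v \<otimes>\<^bsub>U\<^esub> u)) = koszul U (p + 1) (dU v \<otimes>\<^bsub>U\<^esub> dU u) \<oplus>\<^bsub>U\<^esub> koszul U p (dU v \<otimes>\<^bsub>U\<^esub> dU u)"
    using c by (simp add: dU_mult[OF v c(2)] linear_map_add[OF dU_linear]
        linear_map_koszul[OF dU_linear ag_U ag_U] dU_mult[OF dU_degree[OF v] c(2)] dU_mult[OF v c(4)] assms(3,4))
  then show ?thesis using c by (simp add: koszul_def U.l_neg U.r_neg)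
qed

lemma dU_dU:
  assumes "u \<in> carrier U"
  shows "dU (dU u) = \<zero>\<^bsub>U\<^esub>"
proof -
  note lin = linear_map_comp[OF dU_linear dU_linear]
  have z: "linear_map K U U (\<lambda>_. \<zero>\<^bsub>U\<^esub>)" by (rule linear_mapI) simp_all
  from ag_U lin z assms show ?thesis
  proof (induction rule: U_linear_eq)
    case one
    then show ?case by (simp add: dU_one linear_map_zero[OF dU_linear ag_U ag_U])
  next
    case (m p r n u)
    show ?case
      using homog_closed[OF m(1)] linear_map_zero[OF m_lin ag_R ag_U]
      by (intro dU_dU_mult[OF m_graded[OF m(1)] m(2) _ m(3)]) (simp add: dU_m dif_closed dif_dif)
  next
    case (h \<alpha> n u)
    show ?case
      using x_closed[OF h(1)] linear_map_zero[OF h_lin ag_R ag_U]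
      by (intro dU_dU_mult[OF h_graded[OF x_homog[OF h(1)]] h(2) _ h(3)]) (simp add: dU_h dif_closed dif_dif)
  qed
qed

abbreviation "Ud \<equiv> env_dgalg K R \<Lambda> deg x I"

lemma Ud_simps [simp]:
  "carrier Ud = carrier U" "monoid.mult Ud = monoid.mult U" "\<one>\<^bsub>Ud\<^esub> = \<one>\<^bsub>U\<^esub>" "\<zero>\<^bsub>Ud\<^esub> = \<zero>\<^bsub>U\<^esub>"
  "add Ud = add U" "smult Ud = smult U" "homog Ud = homog U" "dif Ud = dU"
  by (simp_all add: env_dgalg_def)

lemma koszul_Ud: "koszul Ud = koszul U"
  by (rule koszul_record_cong) simp_all

lemma signed_comm_Ud: "signed_comm Ud = signed_comm U"
  by (rule signed_comm_record_cong) simp_all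

lemma Ud_dg_algebra: "dg_algebra K Ud"
proof (intro dg_algebra.intro dg_algebra_axioms.intro)
  show "graded_algebra K Ud"
    by (rule graded_algebra_record_cong[OF U.graded_algebra_axioms]) simp_all
  show "linear_map K Ud Ud (dif Ud)" using dU_linear by (simp add: linear_map_def)
qed (simp_all add: dU_degree dU_dU dU_mult koszul_Ud)

end

lemma (in ideal) finsum_mem:
  assumes "\<And>s. s \<in> S \<Longrightarrow> f s \<in> I"
  shows "finsum R f S \<in> I"
  using assms
proof (induction S rule: infinite_finite_induct)
  case (insert s S)
  then have "f s \<in> I" "finsum R f S \<in> I" by auto
  moreover have "finsum R f (insert s S) = f s \<oplus> finsum R f S"
    using insert Icarr by (intro finsum_insert) blast+
  ultimately show ?case by (simp add: a_closed)
qed (simp_all add: additive_subgroup.zero_closed[OF is_additive_subgroup])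

lemma commutator_lie_simps [simp]:
  "carrier (commutator_lie D) = carrier D" "add (commutator_lie D) = add D"
  "smult (commutator_lie D) = smult D" "homog (commutator_lie D) = homog D"
  "dif (commutator_lie D) = dif D" "bracket (commutator_lie D) = graded_commutator D"
  by (simp_all add: commutator_lie_def)

lemma quot_dgbalg_simps:
  "carrier (quot_dgbalg A I) = carrier (quot_galg A I)"
  "add (quot_dgbalg A I) = add (quot_galg A I)"
  "monoid.mult (quot_dgbalg A I) = monoid.mult (quot_galg A I)"
  "\<one>\<^bsub>quot_dgbalg A I\<^esub> = \<one>\<^bsub>quot_galg A I\<^esub>"
  "smult (quot_dgbalg A I) = smult (quot_galg A I)"
  "homog (quot_dgbalg A I) = homog (quot_galg A I)"
  "dif (quot_dgbalg A I) = induced_map A I (dif A)"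
  "bracket (quot_dgbalg A I) = (\<lambda>X Y. \<Union>a\<in>X. \<Union>b\<in>Y. I +>\<^bsub>A\<^esub> bracket A a b)"
  by (simp_all add: quot_dgbalg_def)

section \<open>The universal property\<close>

context envelope
begin

section \<open>Operations of R/I on cosets\<close>

abbreviation "A \<equiv> quot_dgbalg R I"

text \<open>A DG Poisson ideal absorbs brackets on one side by definition. The sign of antisymmetry
  depends on the degree of b, which need not be homogeneous, so it is absorbed into
  \<open>sgn_aut R p b\<close>; this stays in I because the components of b do.\<close>

lemma bracket_I_right:
  assumes a: "a \<in> carrier R" and b: "b \<in> I"
  shows "bracket R a b \<in> I"
  using a
proof (induction a rule: homog_induct)
  case zero
  have "bracket R \<zero> b = \<zero>"
    by (rule linear_map_zero[OF bracket_linear_left[OF I.Icarr[OF b]] ag_R ag_R])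
  then show ?case using I.zero_closed by simp
next
  case (add p a c)
  note ac = homog_closed[OF add(1)] and bc = I.Icarr[OF b]
  \<comment> \<open>\<open>koszul R 1\<close> is negation, in the form for which linearity is at
    hand.\<close>
  have neg: "linear_map K R R (\<lambda>c. koszul R 1 (bracket R (sgn_aut R p c) a))"
    by (rule linear_map_comp[OF linear_map_comp[OF linear_sgn_aut bracket_linear_left[OF ac]] linear_koszul])
  have "bracket R a b = koszul R 1 (bracket R (sgn_aut R p b) a)"
  proof (rule linear_eq_on_homog[OF bracket_linear_right[OF ac] neg ag_R _ bc])
    fix q c assume c: "c \<in> homog R q"
    show "bracket R a c = koszul R 1 (bracket R (sgn_aut R p c) a)"
      using antisymmetry[OF add(1) c] homog_closed[OF c]
        linear_map_koszul[OF bracket_linear_left[OF ac] ag_R ag_R]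
      by (simp add: sgn_aut_homog[OF c]) (simp add: koszul_def)
  qed
  moreover have "sgn_aut R p b \<in> I"
    unfolding sgn_aut_def
    by (rule I.finsum_mem) (simp add: koszul_def I_hcomp[OF b] I.a_inv_closed)
  then have "koszul R 1 (bracket R (sgn_aut R p b) a) \<in> I"
    using I_bracket[OF _ ac] by (simp add: koszul_def I.a_inv_closed)
  ultimately have "bracket R a b \<in> I" by simp
  then show ?case
    using linear_map_add[OF bracket_linear_left[OF bc] ac add(2)] add(3) by (simp add: I.a_closed)
qed

lemma coset_linear_eq:
  assumes f: "linear_map K R R f" and fI: "\<And>b. b \<in> I \<Longrightarrow> f b \<in> I"
    and a: "a \<in> carrier R" and b: "b \<in> I +> a"
  shows "I +> f b = I +> f a"
proof -
  have bc: "b \<in> carrier R" and ba: "b \<ominus> a \<in> I" using b I.mem_coset_iff[OF a] by auto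
  have "f b \<ominus> f a = f (b \<ominus> a)"
    using a bc linear_map_minus[OF f ag_R ag_R a] linear_map_add[OF f bc, of "\<ominus> a"]
    by (simp add: a_minus_def)
  then show ?thesis
    using fI[OF ba] I.coset_eq_iff[OF linear_map_closed[OF f bc] linear_map_closed[OF f a]] by simp
qed

text \<open>The double union collapses because the two representatives can be changed one after the
  other, using that I absorbs brackets on either side.\<close>

lemma A_bracket:
  assumes a: "a \<in> carrier R" and b: "b \<in> carrier R"
  shows "bracket A (I +> a) (I +> b) = I +> bracket R a b"
proof -
  have "I +> bracket R a' b' = I +> bracket R a b" if a': "a' \<in> I +> a" and b': "b' \<in> I +> b" for a' b'
  proof -
    have bc: "b' \<in> carrier R" using b' I.mem_coset_iff[OF b] by auto
    have "I +> bracket R a' b' = I +> bracket R a b'"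
      by (rule coset_linear_eq[OF bracket_linear_left[OF bc] I_bracket[OF _ bc] a a'])
    also have "\<dots> = I +> bracket R a b"
      by (rule coset_linear_eq[OF bracket_linear_right[OF a] bracket_I_right[OF a] b b'])
    finally show ?thesis .
  qed
  then have "(\<Union>a'\<in>I +> a. \<Union>b'\<in>I +> b. I +> bracket R a' b') =
      (\<Union>a'\<in>I +> a. \<Union>b'\<in>I +> b. I +> bracket R a b)"
    by (intro SUP_cong refl)
  moreover have "I +> a \<noteq> {}" "I +> b \<noteq> {}" using I.a_rcos_self[OF a] I.a_rcos_self[OF b] by blast+
  ultimately show ?thesis unfolding quot_dgbalg_simps by simp
qed

lemma A_dif: "a \<in> carrier R \<Longrightarrow> dif A (I +> a) = I +> dif R a"
  unfolding quot_dgbalg_simps by (rule induced_map_coset[OF I.is_ideal I.is_ideal dif_linear I_dif])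

lemma A_carrier: "carrier A = (\<lambda>a. I +> a) ` carrier R"
  by (simp add: quot_dgbalg_simps rcosets_image)

lemma A_homog: "homog A n = (\<lambda>a. I +> a) ` homog R n"
  by (simp add: quot_dgbalg_simps)

lemma A_ops:
  "\<lbrakk>a \<in> carrier R; b \<in> carrier R\<rbrakk> \<Longrightarrow> (I +> a) \<oplus>\<^bsub>A\<^esub> (I +> b) = I +> (a \<oplus> b)"
  "\<lbrakk>a \<in> carrier R; b \<in> carrier R\<rbrakk> \<Longrightarrow> (I +> a) \<otimes>\<^bsub>A\<^esub> (I +> b) = I +> (a \<otimes> b)"
  "\<lbrakk>c \<in> carrier K; a \<in> carrier R\<rbrakk> \<Longrightarrow> c \<odot>\<^bsub>A\<^esub> (I +> a) = I +> (c \<odot> a)"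
  "\<one>\<^bsub>A\<^esub> = I +> \<one>"
  by (simp_all add: quot_dgbalg_simps I.a_rcos_sum I.rcoset_mult_add
      quot_smult[OF k_algebra_axioms I.is_ideal])

section \<open>The enveloping pair on R/I\<close>

abbreviation "em \<equiv> env_m K R \<Lambda> deg x I"
abbreviation "eh \<equiv> env_h K R \<Lambda> deg x I"

lemma incl_J: "r \<in> I \<Longrightarrow> i r \<in> J"
  by (rule erels_J) (simp add: erels_def)

lemma psi_J: "r \<in> I \<Longrightarrow> \<psi> r \<in> J"
  by (rule erels_J) (simp add: erels_def)

lemma em_coset: "a \<in> carrier R \<Longrightarrow> em (I +> a) = m a"
  unfolding env_m_def m_def
  by (rule induced_map_coset[OF I.is_ideal J.is_ideal incl_linear incl_J])

lemma eh_coset: "a \<in> carrier R \<Longrightarrow> eh (I +> a) = h a"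
  unfolding env_h_def h_def
  by (rule induced_map_coset[OF I.is_ideal J.is_ideal psi_linear psi_J])

lemma graded_commutator_Ud: "graded_commutator Ud = graded_commutator U"
  by (rule graded_commutator_record_cong) simp_all

text \<open>A DG Lie map must preserve brackets of arbitrary elements; the homogeneous formula
  extends because both sides are bilinear.\<close>

lemma h_bracket_all:
  assumes a: "a \<in> carrier R" and b: "b \<in> carrier R"
  shows "h (bracket R a b) = graded_commutator U (h a) (h b)"
proof (rule linear_eq_on_homog[OF linear_map_comp[OF bracket_linear_left[OF b] h_lin]
      linear_map_comp[OF h_lin U.graded_commutator_linear_left[OF Uh_closed[OF b]]] ag_U _ a])
  fix p a assume a: "a \<in> homog R p"
  show "h (bracket R a b) = graded_commutator U (h a) (h b)"
  proof (rule linear_eq_on_homog[OF linear_map_comp[OF bracket_linear_right[OF homog_closed[OF a]] h_lin]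
      linear_map_comp[OF h_lin U.graded_commutator_linear_right[OF h_graded[OF a]]] ag_U _ b])
    fix q b assume b: "b \<in> homog R q"
    show "h (bracket R a b) = graded_commutator U (h a) (h b)"
      by (simp add: P.h_bracket[OF a b] U.graded_commutator_homog[OF h_graded[OF a] h_graded[OF b]])
  qed
qed

lemma A_cases:
  assumes "X \<in> carrier A" obtains a where "a \<in> carrier R" "X = I +> a"
  using assms unfolding A_carrier by blast

lemma A_homog_cases:
  assumes "X \<in> homog A n" obtains a where "a \<in> homog R n" "a \<in> carrier R" "X = I +> a"
  using assms homog_closed unfolding A_homog by blast

lemma em_dg: "dg_algebra_map K A Ud em"
  unfolding dg_algebra_map_def
proof (intro conjI allI ballI)
  show "em \<in> ring_hom A Ud"
  proof (rule ring_hom_memI)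
    fix X assume "X \<in> carrier A"
    then obtain a where a: "a \<in> carrier R" "X = I +> a" by (rule A_cases)
    show "em X \<in> carrier Ud" using a by (simp add: em_coset Um_closed)
    fix Y assume "Y \<in> carrier A"
    then obtain b where b: "b \<in> carrier R" "Y = I +> b" by (rule A_cases)
    show "em (X \<otimes>\<^bsub>A\<^esub> Y) = em X \<otimes>\<^bsub>Ud\<^esub> em Y" "em (X \<oplus>\<^bsub>A\<^esub> Y) = em X \<oplus>\<^bsub>Ud\<^esub> em Y"
      using a b by (simp_all add: em_coset A_ops alg_hom_mult[OF m_hom] alg_hom_add[OF m_hom])
  qed (simp add: A_ops em_coset alg_hom_one[OF m_hom])
  show "linear_map K A Ud em"
  proof (rule linear_mapI)
    fix X assume "X \<in> carrier A"
    then obtain a where a: "a \<in> carrier R" "X = I +> a" by (rule A_cases)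
    show "em X \<in> carrier Ud" using a by (simp add: em_coset Um_closed)
    show "em (c \<odot>\<^bsub>A\<^esub> X) = c \<odot>\<^bsub>Ud\<^esub> em X" if "c \<in> carrier K" for c
      using a that by (simp add: em_coset A_ops alg_hom_smult[OF m_hom])
    fix Y assume "Y \<in> carrier A"
    then obtain b where b: "b \<in> carrier R" "Y = I +> b" by (rule A_cases)
    show "em (X \<oplus>\<^bsub>A\<^esub> Y) = em X \<oplus>\<^bsub>Ud\<^esub> em Y"
      using a b by (simp add: em_coset A_ops alg_hom_add[OF m_hom])
  qed
  show "em ` homog A n \<subseteq> homog Ud n" for n
  proof
    fix Y assume "Y \<in> em ` homog A n"
    then obtain X where X: "X \<in> homog A n" "Y = em X" by blast
    from X(1) obtain a where a: "a \<in> homog R n" "a \<in> carrier R" "X = I +> a" by (rule A_homog_cases)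
    show "Y \<in> homog Ud n" using X(2) a m_graded by (simp add: em_coset)
  qed
  fix X assume "X \<in> carrier A"
  then obtain a where a: "a \<in> carrier R" "X = I +> a" by (rule A_cases)
  show "em (dif A X) = dif Ud (em X)"
    using a by (simp add: em_coset A_dif dif_closed dU_m)
qed

lemma eh_dg: "dg_lie_map K A (commutator_lie Ud) eh"
  unfolding dg_lie_map_def commutator_lie_simps
proof (intro conjI allI ballI)
  show "linear_map K A (commutator_lie Ud) eh"
  proof (rule linear_mapI; unfold commutator_lie_simps)
    fix X assume "X \<in> carrier A"
    then obtain a where a: "a \<in> carrier R" "X = I +> a" by (rule A_cases)
    show "eh X \<in> carrier Ud" using a by (simp add: eh_coset Uh_closed)
    show "eh (c \<odot>\<^bsub>A\<^esub> X) = c \<odot>\<^bsub>Ud\<^esub> eh X" if "c \<in> carrier K" for c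
      using a that by (simp add: eh_coset A_ops linear_map_smult[OF h_lin])
    fix Y assume "Y \<in> carrier A"
    then obtain b where b: "b \<in> carrier R" "Y = I +> b" by (rule A_cases)
    show "eh (X \<oplus>\<^bsub>A\<^esub> Y) = eh X \<oplus>\<^bsub>Ud\<^esub> eh Y"
      using a b by (simp add: eh_coset A_ops linear_map_add[OF h_lin])
  qed
  show "eh ` homog A n \<subseteq> homog Ud n" for n
  proof
    fix Y assume "Y \<in> eh ` homog A n"
    then obtain X where X: "X \<in> homog A n" "Y = eh X" by blast
    from X(1) obtain a where a: "a \<in> homog R n" "a \<in> carrier R" "X = I +> a" by (rule A_homog_cases)
    show "Y \<in> homog Ud n" using X(2) a h_graded by (simp add: eh_coset)
  qed
  fix X assume "X \<in> carrier A"
  then obtain a where a: "a \<in> carrier R" "X = I +> a" by (rule A_cases)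
  show "eh (dif A X) = dif Ud (eh X)"
    using a by (simp add: eh_coset A_dif dif_closed dU_h)
  fix Y assume "Y \<in> carrier A"
  then obtain b where b: "b \<in> carrier R" "Y = I +> b" by (rule A_cases)
  show "eh (bracket A X Y) = graded_commutator Ud (eh X) (eh Y)"
    using a b by (simp add: eh_coset A_bracket bracket_closed h_bracket_all graded_commutator_Ud)
qed

lemma enveloping_pair_U: "enveloping_pair K A Ud em eh"
  unfolding enveloping_pair_def signed_comm_def[symmetric]
proof (intro conjI allI ballI em_dg eh_dg)
  fix p q X Y assume X: "X \<in> homog A p" and Y: "Y \<in> homog A q"
  from X obtain a where a: "a \<in> homog R p" "a \<in> carrier R" "X = I +> a" by (rule A_homog_cases)
  from Y obtain b where b: "b \<in> homog R q" "b \<in> carrier R" "Y = I +> b" by (rule A_homog_cases)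
  show "em (bracket A X Y) = signed_comm Ud (p * q) (eh X) (em Y)"
    using a b by (simp add: em_coset eh_coset A_bracket bracket_closed P.m_bracket signed_comm_Ud)
  show "eh (X \<otimes>\<^bsub>A\<^esub> Y) = em X \<otimes>\<^bsub>Ud\<^esub> eh Y \<oplus>\<^bsub>Ud\<^esub> koszul Ud (p * q) (em Y \<otimes>\<^bsub>Ud\<^esub> eh X)"
    using a b by (simp add: em_coset eh_coset A_ops h_mult koszul_Ud)
qed

section \<open>Universality\<close>

lemma dg_alg_hom_U:
  assumes "dg_algebra_map K Ud D \<phi>"
  shows "alg_hom K U D \<phi>"
proof -
  have "alg_hom K Ud D \<phi>" using assms by (simp add: dg_algebra_map_def alg_hom_def)
  then show ?thesis by (rule alg_hom_record_cong) simp_all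
qed

text \<open>The given pair is pulled back to R, where \<open>env_lift\<close> yields the algebra
  map. Compatibility with degrees and differentials, on which \<open>env_lift\<close> is silent, is
  then verified on the generators of \<open>U\<close>.\<close>

lemma universal:
  fixes D :: "('k, 'd) dgalg"
  assumes D: "dg_algebra K D" and pair: "enveloping_pair K A D f g"
  shows "\<exists>!\<phi>. \<phi> \<in> extensional (carrier Ud) \<and> dg_algebra_map K Ud D \<phi> \<and>
    (\<forall>a\<in>carrier A. \<phi> (em a) = f a) \<and> (\<forall>a\<in>carrier A. \<phi> (eh a) = g a)"
proof -
  interpret D: dg_algebra K D by fact
  note ag_D = D.V.M.abelian_group_axioms
  define f' where "f' r = f (I +> r)" for r
  define g' where "g' r = g (I +> r)" for r
  have fmap: "dg_algebra_map K A D f" and gmap: "dg_lie_map K A (commutator_lie D) g"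
    using pair unfolding enveloping_pair_def by (rule conjunct1, rule conjunct1[OF conjunct2])
  have "\<forall>p q. \<forall>a\<in>homog A p. \<forall>b\<in>homog A q.
      f (bracket A a b) = signed_comm D (p * q) (g a) (f b) \<and>
      g (a \<otimes>\<^bsub>A\<^esub> b) = f a \<otimes>\<^bsub>D\<^esub> g b \<oplus>\<^bsub>D\<^esub> koszul D (p * q) (f b \<otimes>\<^bsub>D\<^esub> g a)"
    using pair unfolding enveloping_pair_def signed_comm_def by (rule conjunct2[OF conjunct2])
  then have rels: "f (bracket A a b) = signed_comm D (p * q) (g a) (f b) \<and>
      g (a \<otimes>\<^bsub>A\<^esub> b) = f a \<otimes>\<^bsub>D\<^esub> g b \<oplus>\<^bsub>D\<^esub> koszul D (p * q) (f b \<otimes>\<^bsub>D\<^esub> g a)"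
    if "a \<in> homog A p" "b \<in> homog A q" for p q a b
    using that by blast
  have Ac: "I +> r \<in> carrier A" if "r \<in> carrier R" for r using that unfolding A_carrier by blast
  have Ah: "I +> r \<in> homog A n" if "r \<in> homog R n" for r n using that unfolding A_homog by blast
  have Aproj: "alg_hom K R A (\<lambda>a. I +> a)"
    by (intro alg_homI linear_mapI) (simp_all add: Ac A_ops)
  have "alg_hom K A D f" using fmap by (simp add: dg_algebra_map_def alg_hom_def)
  then have f'_hom: "alg_hom K R D f'"
    unfolding f'_def by (rule alg_hom_comp[OF Aproj])
  have g_lin: "linear_map K A D g" using gmap by (simp add: dg_lie_map_def linear_map_def)
  then have g'_lin: "linear_map K R D g'"
    unfolding g'_def by (rule linear_map_comp[OF alg_hom_linear[OF Aproj]])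
  have f'_dif: "f' (dif R r) = dif D (f' r)" if "r \<in> carrier R" for r
  proof -
    have "\<forall>a\<in>carrier A. f (dif A a) = dif D (f a)" using fmap by (simp add: dg_algebra_map_def)
    then have "f (dif A (I +> r)) = dif D (f (I +> r))" using Ac[OF that] by (rule bspec)
    then show ?thesis by (simp add: A_dif[OF that] f'_def)
  qed
  have g'_dif: "g' (dif R r) = dif D (g' r)" if "r \<in> carrier R" for r
  proof -
    have "\<forall>a\<in>carrier A. g (dif A a) = dif D (g a)" using gmap by (simp add: dg_lie_map_def)
    then have "g (dif A (I +> r)) = dif D (g (I +> r))" using Ac[OF that] by (rule bspec)
    then show ?thesis by (simp add: A_dif[OF that] g'_def)
  qed
  have f'_graded: "f' r \<in> homog D n" if "r \<in> homog R n" for r n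
  proof -
    have "f ` homog A n \<subseteq> homog D n" using fmap by (simp add: dg_algebra_map_def)
    then show ?thesis unfolding f'_def using imageI[OF Ah[OF that], of f] by (rule subsetD)
  qed
  have g'_graded: "g' r \<in> homog D n" if "r \<in> homog R n" for r n
  proof -
    have "g ` homog A n \<subseteq> homog D n" using gmap by (simp add: dg_lie_map_def)
    then show ?thesis unfolding g'_def using imageI[OF Ah[OF that], of g] by (rule subsetD)
  qed
  have f'_bracket: "f' (bracket R a b) = signed_comm D (p * q) (g' a) (f' b)"
    if a: "a \<in> homog R p" and b: "b \<in> homog R q" for a b p q
    using rels[OF Ah[OF a] Ah[OF b]] A_bracket[OF homog_closed[OF a] homog_closed[OF b]]
    by (simp add: f'_def g'_def)
  \<comment> \<open>Since g preserves degrees, the bilinear commutator is the signed one on images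
    of homogeneous elements.\<close>
  have g'_bracket: "g' (bracket R a b) = signed_comm D (p * q) (g' a) (g' b)"
    if a: "a \<in> homog R p" and b: "b \<in> homog R q" for a b p q
  proof -
    have "\<forall>X\<in>carrier A. \<forall>Y\<in>carrier A. g (bracket A X Y) = graded_commutator D (g X) (g Y)"
      using gmap by (simp add: dg_lie_map_def)
    then have "g (bracket A (I +> a) (I +> b)) = graded_commutator D (g (I +> a)) (g (I +> b))"
      using Ac[OF homog_closed[OF a]] Ac[OF homog_closed[OF b]] by blast
    then have "g' (bracket R a b) = graded_commutator D (g' a) (g' b)"
      by (simp add: A_bracket[OF homog_closed[OF a] homog_closed[OF b]] g'_def)
    then show ?thesis by (simp add: D.graded_commutator_homog[OF g'_graded[OF a] g'_graded[OF b]])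
  qed
  have g'_mult: "g' (a \<otimes> b) = f' a \<otimes>\<^bsub>D\<^esub> g' b \<oplus>\<^bsub>D\<^esub> koszul D (p * q) (f' b \<otimes>\<^bsub>D\<^esub> g' a)"
    if a: "a \<in> homog R p" and b: "b \<in> homog R q" for a b p q
    using rels[OF Ah[OF a] Ah[OF b]] A_ops(2)[OF homog_closed[OF a] homog_closed[OF b]]
    by (simp add: f'_def g'_def)
  \<comment> \<open>Elements of I have the class of zero, so the pullbacks kill I by linearity on
    R.\<close>
  have zI: "I +> r = I +> \<zero>" if "r \<in> I" for r
    using that I.a_rcos_const[OF that] I.coset_zero by simp
  have f'_I: "f' r = \<zero>\<^bsub>D\<^esub>" if "r \<in> I" for r
    using linear_map_zero[OF alg_hom_linear[OF f'_hom] ag_R ag_D] by (simp add: f'_def zI[OF that])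
  have g'_I: "g' r = \<zero>\<^bsub>D\<^esub>" if "r \<in> I" for r
    using linear_map_zero[OF g'_lin ag_R ag_D] by (simp add: g'_def zI[OF that])
  obtain \<Phi> where \<Phi>: "alg_hom K U D \<Phi>" and \<Phi>m: "\<And>r. r \<in> carrier R \<Longrightarrow> \<Phi> (m r) = f' r"
    and \<Phi>h: "\<And>r. r \<in> carrier R \<Longrightarrow> \<Phi> (h r) = g' r"
  proof (rule env_lift[OF D.k_algebra_axioms f'_hom g'_lin g'_mult f'_I g'_I])
    fix \<alpha> \<beta> assume \<alpha>: "\<alpha> \<in> \<Lambda>" and \<beta>: "\<beta> \<in> \<Lambda>"
    show "f' (bracket R (x \<alpha>) (x \<beta>)) = signed_comm D (deg \<alpha> * deg \<beta>) (g' (x \<alpha>)) (f' (x \<beta>))"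
      "g' (bracket R (x \<alpha>) (x \<beta>)) = signed_comm D (deg \<alpha> * deg \<beta>) (g' (x \<alpha>)) (g' (x \<beta>))"
      by (rule f'_bracket[OF x_homog[OF \<alpha>] x_homog[OF \<beta>]], rule g'_bracket[OF x_homog[OF \<alpha>] x_homog[OF \<beta>]])
  qed (assumption | rule that)+
  note \<Phi>_lin = alg_hom_linear[OF \<Phi>]
  have \<Phi>_mult_graded: "\<Phi> (v \<otimes>\<^bsub>U\<^esub> u) \<in> homog D (p + n)"
    if "v \<in> homog U p" "u \<in> homog U n" "\<Phi> v \<in> homog D p" "\<Phi> u \<in> homog D n" for v u p n
    using alg_hom_mult[OF \<Phi> U.homog_closed[OF that(1)] U.homog_closed[OF that(2)]]
      D.mult_homog[OF that(3,4)] by simp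
  have \<Phi>_graded: "\<Phi> u \<in> homog D n" if "u \<in> homog U n" for u n
    using that
  proof (induction rule: U_induct)
    case one
    then show ?case by (simp add: alg_hom_one[OF \<Phi>] D.one_homog)
  next
    case (zero n)
    then show ?case by (simp add: linear_map_zero[OF \<Phi>_lin ag_U ag_D] D.homog_zero)
  next
    case (m p r n u)
    show ?case
      using f'_graded[OF m(1)] \<Phi>m[OF homog_closed[OF m(1)]]
      by (intro \<Phi>_mult_graded[OF m_graded[OF m(1)] m(2) _ m(3)]) simp
  next
    case (h \<alpha> n u)
    show ?case
      using g'_graded[OF x_homog[OF h(1)]] \<Phi>h[OF x_closed[OF h(1)]]
      by (intro \<Phi>_mult_graded[OF h_graded[OF x_homog[OF h(1)]] h(2) _ h(3)]) simp
  next
    case (add n u v)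
    then show ?case
      using linear_map_add[OF \<Phi>_lin U.homog_closed[OF add(1)] U.homog_closed[OF add(2)]]
      by (simp add: D.homog_add)
  next
    case (smult n c u)
    then show ?case
      using linear_map_smult[OF \<Phi>_lin smult(1) U.homog_closed[OF smult(2)]]
      by (simp add: D.homog_smult)
  qed
  note lin = linear_map_comp[OF dU_linear \<Phi>_lin] linear_map_comp[OF \<Phi>_lin D.dif_linear]
  have \<Phi>_dif_mult: "\<Phi> (dU (v \<otimes>\<^bsub>U\<^esub> u)) = dif D (\<Phi> (v \<otimes>\<^bsub>U\<^esub> u))"
    if v: "v \<in> homog U p" and u: "u \<in> homog U n"
      and "\<Phi> (dU v) = dif D (\<Phi> v)" "\<Phi> (dU u) = dif D (\<Phi> u)" for v u p n
  proof -
    note c = U.homog_closed[OF v] U.homog_closed[OF u] dU_closed[OF U.homog_closed[OF v]]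
      dU_closed[OF U.homog_closed[OF u]]
    show ?thesis
      using c by (simp add: dU_mult[OF v c(2)] alg_hom_add[OF \<Phi>] alg_hom_mult[OF \<Phi>]
          linear_map_koszul[OF \<Phi>_lin ag_U ag_D] that(3,4)
          D.leibniz[OF \<Phi>_graded[OF v] linear_map_closed[OF \<Phi>_lin c(2)]])
  qed
  have \<Phi>_dif: "\<Phi> (dU u) = dif D (\<Phi> u)" if "u \<in> carrier U" for u
    using ag_D lin that
  proof (induction rule: U_linear_eq)
    case one
    then show ?case
      by (simp add: dU_one alg_hom_one[OF \<Phi>] D.dif_one linear_map_zero[OF \<Phi>_lin ag_U ag_D])
  next
    case (m p r n u)
    note c = homog_closed[OF m(1)]
    show ?case
      using f'_dif[OF c] \<Phi>m[OF c] \<Phi>m[OF dif_closed[OF c]] dU_m[OF c]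
      by (intro \<Phi>_dif_mult[OF m_graded[OF m(1)] m(2) _ m(3)]) simp
  next
    case (h \<alpha> n u)
    note c = x_closed[OF h(1)]
    show ?case
      using g'_dif[OF c] \<Phi>h[OF c] \<Phi>h[OF dif_closed[OF c]] dU_h[OF c]
      by (intro \<Phi>_dif_mult[OF h_graded[OF x_homog[OF h(1)]] h(2) _ h(3)]) simp
  qed
  \<comment> \<open>Restriction makes the map extensional, since uniqueness concerns functions on
    the carrier.\<close>
  define \<phi> where "\<phi> = restrict \<Phi> (carrier U)"
  have \<phi>: "\<phi> u = \<Phi> u" if "u \<in> carrier U" for u using that by (simp add: \<phi>_def)
  have \<phi>_dg: "dg_algebra_map K Ud D \<phi>"
    unfolding dg_algebra_map_def
  proof (intro conjI allI ballI)
    show "\<phi> \<in> ring_hom Ud D"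
      by (rule ring_hom_memI)
        (simp_all add: \<phi> alg_hom_closed[OF \<Phi>] alg_hom_mult[OF \<Phi>] alg_hom_add[OF \<Phi>] alg_hom_one[OF \<Phi>])
    show "linear_map K Ud D \<phi>"
      by (rule linear_mapI)
        (simp_all add: \<phi> alg_hom_closed[OF \<Phi>] alg_hom_add[OF \<Phi>] alg_hom_smult[OF \<Phi>])
    show "\<phi> ` homog Ud n \<subseteq> homog D n" for n
    proof
      fix w assume "w \<in> \<phi> ` homog Ud n"
      then obtain u where u: "u \<in> homog U n" "w = \<phi> u" by auto
      then show "w \<in> homog D n" using \<phi>[OF U.homog_closed[OF u(1)]] \<Phi>_graded[OF u(1)] by simp
    qed
    fix u assume "u \<in> carrier Ud"
    then have u: "u \<in> carrier U" by simp
    show "\<phi> (dif Ud u) = dif D (\<phi> u)"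
      using \<phi>[OF u] \<phi>[OF dU_closed[OF u]] \<Phi>_dif[OF u] by simp
  qed
  show ?thesis
  proof (rule ex1I[of _ \<phi>])
    show "\<phi> \<in> extensional (carrier Ud) \<and> dg_algebra_map K Ud D \<phi> \<and>
      (\<forall>a\<in>carrier A. \<phi> (em a) = f a) \<and> (\<forall>a\<in>carrier A. \<phi> (eh a) = g a)"
    proof (intro conjI ballI \<phi>_dg)
      show "\<phi> \<in> extensional (carrier Ud)" by (simp add: \<phi>_def)
      fix X assume "X \<in> carrier A"
      then obtain a where a: "a \<in> carrier R" "X = I +> a" by (rule A_cases)
      show "\<phi> (em X) = f X"
        using \<phi>[OF Um_closed[OF a(1)]] \<Phi>m[OF a(1)] em_coset[OF a(1)] a(2) by (simp add: f'_def)
      show "\<phi> (eh X) = g X"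
        using \<phi>[OF Uh_closed[OF a(1)]] \<Phi>h[OF a(1)] eh_coset[OF a(1)] a(2) by (simp add: g'_def)
    qed
    fix \<chi> assume \<chi>: "\<chi> \<in> extensional (carrier Ud) \<and> dg_algebra_map K Ud D \<chi> \<and>
      (\<forall>a\<in>carrier A. \<chi> (em a) = f a) \<and> (\<forall>a\<in>carrier A. \<chi> (eh a) = g a)"
    have \<chi>m: "\<chi> (m r) = f' r" and \<chi>h: "\<chi> (h r) = g' r" if "r \<in> carrier R" for r
      using \<chi> Ac[OF that] em_coset[OF that] eh_coset[OF that] by (metis f'_def, metis g'_def)
    \<comment> \<open>The conditions on em and eh fix the values at all m r and h (x_\<alpha>),
      which generate \<open>U\<close>.\<close>
    have "\<chi> u = \<Phi> u" if "u \<in> carrier U" for u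
    proof (rule U_hom_eq[OF D.k_algebra_axioms _ \<Phi> _ _ that])
      show "alg_hom K U D \<chi>" using \<chi> by (intro dg_alg_hom_U) simp
      show "\<chi> (m r) = \<Phi> (m r)" if "r \<in> carrier R" for r using \<chi>m[OF that] \<Phi>m[OF that] by simp
      show "\<chi> (h (x \<alpha>)) = \<Phi> (h (x \<alpha>))" if "\<alpha> \<in> \<Lambda>" for \<alpha>
        using \<chi>h[OF x_closed[OF that]] \<Phi>h[OF x_closed[OF that]] by simp
    qed
    then show "\<chi> = \<phi>"
      using \<chi> by (intro extensionalityI[of \<chi> "carrier U"]) (simp_all add: \<phi>_def)
  qed
qed

theorem universal_enveloping: "universal_enveloping_algebra TYPE('d) K A Ud em eh"
  unfolding universal_enveloping_algebra_def
proof (intro conjI allI impI Ud_dg_algebra enveloping_pair_U)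
  fix D :: "('k, 'd) dgalg" and f g
  assume "dg_algebra K D \<and> enveloping_pair K A D f g"
  then show "\<exists>!\<phi>. \<phi> \<in> extensional (carrier Ud) \<and> dg_algebra_map K Ud D \<phi> \<and>
    (\<forall>a\<in>carrier A. \<phi> (em a) = f a) \<and> (\<forall>a\<in>carrier A. \<phi> (eh a) = g a)"
    by (elim conjE) (rule universal)
qed

end

theorem theorem2p12:
  fixes K :: "('k, 'm) ring_scheme"
    and \<Lambda> :: "'i set" and deg :: "'i \<Rightarrow> int"
    and d :: "('i list \<Rightarrow> 'k) set \<Rightarrow> ('i list \<Rightarrow> 'k) set"
    and br :: "('i list \<Rightarrow> 'k) set \<Rightarrow> ('i list \<Rightarrow> 'k) set \<Rightarrow> ('i list \<Rightarrow> 'k) set"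
    and R :: "('k, ('i list \<Rightarrow> 'k) set) dgbalg"
    and I :: "('i list \<Rightarrow> 'k) set set"
    and x :: "'i \<Rightarrow> ('i list \<Rightarrow> 'k) set"
  assumes "field K"
    and "R = add_bracket (add_dif (sym_galg K \<Lambda> deg) d) br"
    and "x = sym_var K \<Lambda> deg"
    and "dg_poisson_algebra K R"
    and "dg_poisson_ideal R I"
  shows "universal_enveloping_algebra TYPE('d) K (quot_dgbalg R I)
           (env_dgalg K R \<Lambda> deg x I) (env_m K R \<Lambda> deg x I) (env_h K R \<Lambda> deg x I)"
proof -
  interpret R: dg_poisson_algebra K R by fact
  have eqs: "carrier R = carrier (sym_galg K \<Lambda> deg)" "add R = add (sym_galg K \<Lambda> deg)"
    "\<zero>\<^bsub>R\<^esub> = \<zero>\<^bsub>sym_galg K \<Lambda> deg\<^esub>" "monoid.mult R = monoid.mult (sym_galg K \<Lambda> deg)"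
    "\<one>\<^bsub>R\<^esub> = \<one>\<^bsub>sym_galg K \<Lambda> deg\<^esub>" "smult R = smult (sym_galg K \<Lambda> deg)"
    "homog R = homog (sym_galg K \<Lambda> deg)"
    unfolding assms(2) by simp_all
  \<comment> \<open>R has the operations of \<open>sym_galg\<close>, so generation transfers to it;
    its graded commutativity, part of the DG Poisson axioms, yields the partial derivatives.\<close>
  interpret envelope K R \<Lambda> deg x I
  proof unfold_locales
    show "graded_generated K R \<Lambda> x deg"
      unfolding assms(3)
      using sym_graded_generated[OF R.V.R.cring_axioms] eqs(3,2,4-) by (rule graded_generated_record_cong)
    show "dg_poisson_ideal R I" by fact
    show "\<exists>D. linear_map K R R D \<and>
      (\<forall>\<beta>\<in>\<Lambda>. D (x \<beta>) = (if \<alpha> = \<beta> then \<one>\<^bsub>R\<^esub> else \<zero>\<^bsub>R\<^esub>)) \<and>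
      (\<forall>p q. \<forall>a\<in>homog R p. \<forall>b\<in>homog R q.
        D (a \<otimes>\<^bsub>R\<^esub> b) = a \<otimes>\<^bsub>R\<^esub> D b \<oplus>\<^bsub>R\<^esub> koszul R (p * q) (b \<otimes>\<^bsub>R\<^esub> D a))" for \<alpha>
      unfolding assms(3)
      by (rule sym_partial_derivative[OF R.graded_algebra_axioms eqs R.graded_commutative])
  qed
  show ?thesis by (rule universal_enveloping)
qed

end
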